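(* Let $d\ge 2$ and let $(w_e)$ be i.i.d. positive random conductances on the nearest-neighbour edges of $\mathbb{Z}^d$, with law $\mathbb{P}$ and distribution function $F(u)=\mathbb{P}[w\le u]$. Assume: (i) $F$ is continuous and varies regularly at zero with index $\gamma\in[0,1/4)$; (ii) there exists $a^\ast>0$ such that $F(ab)\ge bF(a)$ for all $a\le a^\ast$ and all $0\le b\le 1$; (iii) in the case $\gamma=0$, there exists $\epsilon_1\in(0,1)$ such that $n^{2+\epsilon_1}g(n)$ converges monotonically to zero as $n\to\infty$, where $g(u)=\sup\{s\ge 0: F(s)=u^{-1/2}\}$. If $\gamma=0$ let $\epsilon_1$ be as in (iii); if $\gamma>0$ let $\epsilon_1\in(0,1)$ be such that $-1/(2\gamma)<-(2+\epsilon_1)$. Let $k\in\mathbb{N}$. Let $\lambda_k^{(n)}$ be the $k$th Dirichlet eigenvalue and $\psi_k^{(n)}$ the $k$th Dirichlet eigenvector of $-\mathcal{L}^w$ in $B_n$ with zero Dirichlet conditions outside $B_n$. Let $\pi_{k,B_n}$ be the $k$th smallest value of the local speed measure $\pi$ over $B_n$ and $z_{(k,n)}\in B_n$ the site where it is attained. Then $$\mathbb{P}\left[\lim_{n\to\infty}\frac{\lambda_k^{(n)}}{\pi_{k,B_n}}=1\right]=1 .$$ More precisely, for every $\epsilon\in(0,\epsilon_1)$, $\mathbb{P}$-almost surely for all $n$ large enough, $$1-n^{-\epsilon/8}\le\frac{\lambda_k^{(n)}}{\pi_{k,B_n}}\le 1\qquad\text{and}\qquad \psi_k^{(n)}\left(z_{(k,n)}\right)\ge\sqrt{1-n^{-\epsilon/4}}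 .$$
   Context: Write $x\sim y$ if $x,y\in\mathbb{Z}^d$ and $|x-y|_1=1$. Edges are undirected, so $w_{xy}=w_{yx}$. The random conductance Laplacian is $(\mathcal{L}^w f)(x)=\sum_{y\sim x}w_{xy}(f(y)-f(x))$. The box is $B_n=[-n,n]^d\cap\mathbb{Z}^d$. The Dirichlet eigenvalues $\lambda_1^{(n)}\le\lambda_2^{(n)}\le\dots\le\lambda^{(n)}_{|B_n|}$ (with multiplicity) and eigenvectors $\psi_1^{(n)},\psi_2^{(n)},\dots$ are those of the problem $-\mathcal{L}^w\psi=\lambda\psi$ on $B_n$, $\psi=0$ on $\mathbb{Z}^d\setminus B_n$. The eigenvectors are chosen orthonormal in $\ell^2(B_n)$, with the sign of $\psi_k^{(n)}$ chosen such that $\psi_k^{(n)}(z_{(k,n)})\ge 0$. The local speed measure is $\pi_z=\sum_{x\sim z}w_{xz}$, and $\pi_{1,B_n}\le\pi_{2,B_n}\le\dots\le\pi_{|B_n|,B_n}$ is the order statistics of $\{\pi_z\}_{z\in B_n}$; $z_{(k,n)}\in B_n$ is the site with $\pi_{z_{(k,n)}}=\pi_{k,B_n}$ (almost surely unique because $F$ is continuous). $F$ varies regularly at zero with index $\gamma$ if $\lim_{t\downarrow 0}F(ts)/F(t)=s^\gamma$ for all $s>0$. Only the values of $g(u)$ for large $u$ matter. *)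

theory Defs
  imports "HOL-Probability.Probability" "HOL-Library.Multiset"
begin

(* The lattice Z^d is the type int ^ 'd with d = CARD('d).  Edges are undirected, hence
   two-element sets of sites; a conductance configuration is a function w on such sets,
   and only its values on lattice_edges matter. *)

definition nearest_neighbour :: "int ^ 'd \<Rightarrow> int ^ 'd \<Rightarrow> bool"  (infix "\<sim>\<^sub>l" 50) where
  "x \<sim>\<^sub>l y \<longleftrightarrow> (\<Sum>i\<in>UNIV. \<bar>x $ i - y $ i\<bar>) = 1"

definition lattice_edges :: "(int ^ 'd) set set" where
  "lattice_edges = {{x, y} | x y. x \<sim>\<^sub>l y}"

definition lattice_box :: "nat \<Rightarrow> (int ^ 'd) set" where
  "lattice_box n = {x. \<forall>i. \<bar>x $ i\<bar> \<le> int n}"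

definition rc_laplacian ::
  "((int ^ 'd) set \<Rightarrow> real) \<Rightarrow> (int ^ 'd \<Rightarrow> real) \<Rightarrow> int ^ 'd \<Rightarrow> real" where
  "rc_laplacian w f x = (\<Sum>y | y \<sim>\<^sub>l x. w {x, y} * (f y - f x))"

definition local_speed :: "((int ^ 'd) set \<Rightarrow> real) \<Rightarrow> int ^ 'd \<Rightarrow> real" where
  "local_speed w z = (\<Sum>x | x \<sim>\<^sub>l z. w {x, z})"

(* Order statistics are indexed from 1, as are the eigenvalues below. *)
definition speed_order_stat :: "((int ^ 'd) set \<Rightarrow> real) \<Rightarrow> nat \<Rightarrow> nat \<Rightarrow> real" where
  "speed_order_stat w n k =
     sorted_list_of_multiset (image_mset (local_speed w) (mset_set (lattice_box n))) ! (k - 1)"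

(* If the conductances are independent with continuous laws, this site is almost surely
   unique for 1 \<le> k \<le> |B_n|; the choice operator is only relevant on a null set. *)
definition speed_site :: "((int ^ 'd) set \<Rightarrow> real) \<Rightarrow> nat \<Rightarrow> nat \<Rightarrow> int ^ 'd" where
  "speed_site w n k = (SOME z. z \<in> lattice_box n \<and> local_speed w z = speed_order_stat w n k)"

(* lam 1 \<le> ... \<le> lam |B_n| are the Dirichlet eigenvalues of the negative Laplacian on B_n,
   with multiplicity, and psi 1, ..., psi |B_n| are corresponding eigenvectors.  Being
   orthonormal and |B_n| in number, they form a basis of l^2(B_n), so every eigenvalue
   is listed exactly as often as its multiplicity and lam is determined by w and n on
   {1..|B_n|}. *)
definition dirichlet_eigensystem ::
  "((int ^ 'd) set \<Rightarrow> real) \<Rightarrow> nat \<Rightarrow> (nat \<Rightarrow> real) \<Rightarrow> (nat \<Rightarrow> int ^ 'd \<Rightarrow> real) \<Rightarrow> bool" where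
  "dirichlet_eigensystem w n lam psi \<longleftrightarrow>
     (let B = lattice_box n; I = {1..card B} in
       mono_on I lam \<and>
       (\<forall>i\<in>I. (\<forall>x\<in>B. - rc_laplacian w (psi i) x = lam i * psi i x) \<and>
              (\<forall>x. x \<notin> B \<longrightarrow> psi i x = 0)) \<and>
       (\<forall>i\<in>I. \<forall>j\<in>I. (\<Sum>x\<in>B. psi i x * psi j x) = (if i = j then 1 else 0)) \<and>
       (\<forall>i\<in>I. psi i (speed_site w n i) \<ge> 0))"

definition regularly_varying_at_zero :: "(real \<Rightarrow> real) \<Rightarrow> real \<Rightarrow> bool" where
  "regularly_varying_at_zero F \<gamma> \<longleftrightarrow>
     (\<forall>s>0. ((\<lambda>t. F (t * s) / F t) \<longlongrightarrow> s powr \<gamma>) (at_right 0))"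

(* If F is the continuous distribution function of a positive random variable, the set is
   nonempty and bounded for u > 1, so that the supremum is meaningful for all large u. *)
definition quantile_scale :: "(real \<Rightarrow> real) \<Rightarrow> real \<Rightarrow> real" where
  "quantile_scale F u = Sup {s. 0 \<le> s \<and> F s = u powr (- 1 / 2)}"

(* Monotonicity is only required for large indices. *)
definition monotonically_to_zero :: "(nat \<Rightarrow> real) \<Rightarrow> bool" where
  "monotonically_to_zero h \<longleftrightarrow> (\<exists>N. \<forall>m\<ge>N. \<forall>n\<ge>m. h n \<le> h m) \<and> h \<longlonglongrightarrow> 0"

end

theory Submission
  imports Defs
begin

text \<open>
  Take scales \<open>L < t < s\<close> with \<open>F(s) = n\<^sup>-\<^sup>\<theta>\<close> for a small \<open>\<theta>\<close>, \<open>F(t) = n\<^sup>-\<^sup>3\<^sup>/\<^sup>8\<close> and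
  \<open>F(L) = n\<^sup>-\<^sup>1\<^sup>/\<^sup>2\<^sup>+\<^sup>\<tau>\<close>, so that the \<open>k\<close> smallest speeds lie below \<open>L\<close>; by Potter's bound,
  \<open>n\<^sup>2 L / s\<close> and \<open>L / t\<close> are negative powers of \<open>n\<close>.  Since bonds below \<open>s\<close> have polynomially small density,
  cubes of a fixed size contain a bounded number of them, and fewer than \<open>3d\<close> bonds below \<open>t\<close>.  Hence open
  hyperplane slabs in neighbouring cubes join up to paths that carry a Poincare inequality of order \<open>n\<^sup>2 / s\<close>, and
  each site with at least one bond above \<open>t\<close> is attached to them, because \<open>4d - 2\<close> disjoint rays leave such a bond.
  An eigenfunction with eigenvalue at most \<open>L\<close> therefore has little mass off the remaining sites, the traps.

  Traps are isolated, so testing with the indicators of the \<open>k\<close> slowest sites gives \<open>\<lambda>\<^sub>k \<le> \<pi>\<^sub>k\<close>.  At a trap \<open>x\<close>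
  the eigenvalue equation reads \<open>(\<pi>\<^sub>x - \<lambda>) \<psi>(x) = \<Sum> w \<psi>\<close> with the sum over neighbours, which carry little
  mass; so \<open>\<psi>\<close> lives where \<open>\<pi>\<^sub>x\<close> is within a factor \<open>1 \<plusminus> \<eta>\<close> of \<open>\<lambda>\<close>.  The scaling assumption
  \<open>F(ab) \<ge> b F(a)\<close> rules out two such sites, orthonormality makes the sites of different eigenfunctions
  distinct, and \<open>\<lambda>\<^sub>i \<le> \<pi>\<^sub>i\<close> for all \<open>i \<le> k\<close> then forces the \<open>k\<close>th one to be the \<open>k\<close>th slowest site.
\<close>

section \<open>The lattice\<close>

text \<open>Connections are found by pigeonhole in cubes of fixed size, so no percolation estimate
  enters. The exponent 3/8 and the count 3d serve several ends at once. A union bound over order n^d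
  cubes excludes 3d bonds below \<open>t\<close> since 3d * 3/8 > d. Two adjacent traps would use 4d
  - 1 >= 3d such bonds, and 3d <= 4d - 2 keeps an intact ray as soon as d >= 2. A single trap uses
  only 2d < 8d/3 bonds, so traps cannot be excluded, only isolated. The failure probabilities are
  small negative powers of n, in general not summable over n. They are therefore estimated only for
  N = 2^m, for an event that controls every n with N <= n < 2N. Exponents: with
  \<open>\<eta>\<close> = n^-\<open>\<delta>\<close> and \<open>\<delta>\<close> =
  \<open>\<epsilon>\<^sub>1\<close>/25, a near tie has probability of order n^(2d)
  \<open>\<eta>\<close> F(L)^(4d), small once 4d \<open>\<tau>\<close> <= \<open>\<delta>\<close>/2.
  In return, localization loses \<open>\<eta>\<close>^-2, which turns the mass bound
  n^-(\<open>\<epsilon>\<^sub>1\<close>/3) into n^-(19 \<open>\<epsilon>\<^sub>1\<close>/75). As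
  19/75 = 1/4 + 1/300, the required rate survives and the surplus absorbs all constants.\<close>

abbreviation ax :: "'d::finite \<Rightarrow> int ^ 'd" where "ax k \<equiv> axis k 1"

text \<open>Each edge gets a unique name, its lower endpoint and its direction, so that counting
  edges becomes counting pairs.\<close>

definition bond :: "int ^ 'd \<Rightarrow> 'd \<Rightarrow> (int ^ 'd) set" where
  "bond u k = {u, u + ax k}"

lemma axis_nth_if: "axis k c $ i = (if i = k then c else 0)"
  by (simp add: axis_def)

lemma nearest_neighbour_sym: "x \<sim>\<^sub>l y \<longleftrightarrow> y \<sim>\<^sub>l x"
  by (simp add: nearest_neighbour_def abs_minus_commute)

lemma nearest_neighbour_iff:
  fixes x y :: "int ^ 'd"
  shows "x \<sim>\<^sub>l y \<longleftrightarrow> (\<exists>k. y = x + ax k \<or> y = x - ax k)"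
proof
  assume a: "x \<sim>\<^sub>l y"
  then have s: "(\<Sum>i\<in>UNIV. \<bar>x $ i - y $ i\<bar>) = 1" by (simp add: nearest_neighbour_def)
  then obtain k where k: "\<bar>x $ k - y $ k\<bar> \<noteq> 0"
    by fastforce
  have "(\<Sum>i\<in>UNIV. \<bar>x $ i - y $ i\<bar>) = \<bar>x $ k - y $ k\<bar> + (\<Sum>i\<in>UNIV-{k}. \<bar>x $ i - y $ i\<bar>)"
    by (simp add: sum.remove)
  moreover have "(\<Sum>i\<in>UNIV-{k}. \<bar>x $ i - y $ i\<bar>) \<ge> 0" by (simp add: sum_nonneg)
  ultimately have 1: "\<bar>x $ k - y $ k\<bar> = 1" and 2: "(\<Sum>i\<in>UNIV-{k}. \<bar>x $ i - y $ i\<bar>) = 0"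
    using s k by linarith+
  have 3: "x $ i = y $ i" if "i \<noteq> k" for i
    using 2 that by (subst (asm) sum_nonneg_eq_0_iff) auto
  from 1 have "y $ k = x $ k + 1 \<or> y $ k = x $ k - 1" by linarith
  then show "\<exists>k. y = x + ax k \<or> y = x - ax k"
    using 3 by (intro exI[of _ k]) (auto simp: vec_eq_iff axis_nth_if)
next
  assume "\<exists>k. y = x + ax k \<or> y = x - ax k"
  then show "x \<sim>\<^sub>l y"
    by (auto simp: nearest_neighbour_def axis_nth_if if_distrib[of abs] cong: if_cong)
qed

lemma ax_neq_minus_ax: "ax k \<noteq> - ax (l::'d::finite)"
proof
  assume "ax k = - ax l"
  then have "ax k $ k = (- ax l) $ k" by simp
  then show False by (auto simp: axis_nth_if split: if_splits)
qed

lemma ax_inj: "ax k = ax l \<Longrightarrow> k = (l::'d::finite)"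
  by (metis axis_nth_if zero_neq_one)

lemma ax_nonzero: "ax k \<noteq> (0 :: int ^ 'd)"
  by (simp add: axis_eq_0_iff)

lemma neighbours_eq: "{y. y \<sim>\<^sub>l x} = range (\<lambda>k. x + ax k) \<union> range (\<lambda>k. x - ax k)"
proof -
  have "{y. y \<sim>\<^sub>l x} = {y. x \<sim>\<^sub>l y}" by (simp add: nearest_neighbour_sym)
  then show ?thesis unfolding nearest_neighbour_iff by auto
qed

lemma neighbours_disjoint: "range (\<lambda>k. x + ax k) \<inter> range (\<lambda>k. x - ax k) = {}"
proof -
  have False if "x + ax k = x - ax l" for k l
    using that ax_neq_minus_ax[of k l] by (simp add: diff_conv_add_uminus del: add_uminus_conv_diff)
  then show ?thesis by blast
qed

lemma finite_neighbours [simp]: "finite {y. y \<sim>\<^sub>l x}"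
  by (simp add: neighbours_eq)

lemma sum_neighbours:
  fixes h :: "int ^ 'd \<Rightarrow> 'b::comm_monoid_add"
  shows "(\<Sum>y | y \<sim>\<^sub>l x. h y) = (\<Sum>k\<in>UNIV. h (x + ax k)) + (\<Sum>k\<in>UNIV. h (x - ax k))"
proof -
  have "inj (\<lambda>k. x + ax k)" "inj (\<lambda>k. x - ax k)"
    by (auto intro!: injI dest: ax_inj)
  then show ?thesis
    unfolding neighbours_eq
    by (subst sum.union_disjoint) (auto simp: neighbours_disjoint sum.reindex)
qed

lemma bond_in_edges [simp]: "bond u k \<in> lattice_edges"
  unfolding bond_def lattice_edges_def mem_Collect_eq nearest_neighbour_iff by blast

lemma bond_inj: "bond u k = bond v l \<longleftrightarrow> u = v \<and> k = l"
proof
  assume a: "bond u k = bond v l"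
  then have "(u = v \<and> u + ax k = v + ax l) \<or> (u = v + ax l \<and> u + ax k = v)"
    by (simp add: bond_def doubleton_eq_iff)
  then show "u = v \<and> k = l"
  proof
    assume "u = v + ax l \<and> u + ax k = v"
    then have "ax l + ax k = 0" by (metis add.assoc add_cancel_left_right)
    then show ?thesis using ax_neq_minus_ax[of l k] by (simp add: eq_neg_iff_add_eq_0)
  qed (auto dest: ax_inj)
qed simp

lemma bond_pred: "bond (x - ax k) k = {x - ax k, x}"
  by (simp add: bond_def)

lemma local_speed_bonds:
  "local_speed w x = (\<Sum>k\<in>UNIV. w (bond x k)) + (\<Sum>k\<in>UNIV. w (bond (x - ax k) k))"
  unfolding local_speed_def sum_neighbours by (simp add: bond_def insert_commute)

lemma lattice_edges_bonds: "lattice_edges = range (\<lambda>(u, k). bond u k)"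
proof -
  have "\<exists>u k. {x, y} = bond u k" if xy: "x \<sim>\<^sub>l y" for x y
  proof -
    obtain k where "y = x + ax k \<or> y = x - ax k" using xy unfolding nearest_neighbour_iff by blast
    then have "{x, y} = bond x k \<or> {x, y} = bond y k"
      by (metis bond_def bond_pred insert_commute diff_add_cancel)
    then show ?thesis by blast
  qed
  then have "lattice_edges \<subseteq> range (\<lambda>(u, k). bond u k)" 
    unfolding lattice_edges_def by (fastforce simp: image_iff)
  then show ?thesis by auto
qed

section \<open>Sup-norm cubes and monotone lattice paths inside them\<close>

definition cube :: "int ^ 'd \<Rightarrow> nat \<Rightarrow> (int ^ 'd) set" where
  "cube v K = {x. \<forall>i. \<bar>x $ i - v $ i\<bar> \<le> int K}"

lemma lattice_box_cube: "lattice_box n = cube 0 n"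
  by (simp add: lattice_box_def cube_def)

lemma cube_commute: "x \<in> cube v K \<longleftrightarrow> v \<in> cube x K"
  by (simp add: cube_def abs_minus_commute)

lemma card_vec_PiE:
  fixes A :: "'d::finite \<Rightarrow> int set"
  assumes "\<And>i. finite (A i)"
  shows "finite {x :: int ^ 'd. \<forall>i. x $ i \<in> A i}"
    and "card {x :: int ^ 'd. \<forall>i. x $ i \<in> A i} = (\<Prod>i\<in>UNIV. card (A i))"
proof -
  have e: "{x :: int ^ 'd. \<forall>i. x $ i \<in> A i} = vec_lambda ` PiE UNIV A" (is "?L = _")
  proof
    show "?L \<subseteq> vec_lambda ` PiE UNIV A"
    proof
      fix x assume "x \<in> ?L"
      then have "vec_nth x \<in> PiE UNIV A" "x = vec_lambda (vec_nth x)" by auto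
      then show "x \<in> vec_lambda ` PiE UNIV A" by (metis image_eqI)
    qed
  qed auto
  show "finite ?L" unfolding e using assms by (intro finite_imageI finite_PiE) auto
  have "inj_on vec_lambda (PiE UNIV A)" by (simp add: inj_on_def vec_lambda_inject)
  then show "card ?L = (\<Prod>i\<in>UNIV. card (A i))"
    unfolding e by (simp add: card_image card_PiE)
qed

lemma cube_as_product: "cube (v :: int ^ 'd) K = {x. \<forall>i. x $ i \<in> {v $ i - int K .. v $ i + int K}}"
proof -
  have "\<bar>x $ i - v $ i\<bar> \<le> int K \<longleftrightarrow> x $ i \<in> {v $ i - int K .. v $ i + int K}" for x :: "int ^ 'd" and i
    by auto
  then show ?thesis by (simp add: cube_def)
qed

lemma finite_cube [simp]: "finite (cube v K)"
  unfolding cube_as_product by (rule card_vec_PiE) simp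

lemma card_cube: "card (cube (v :: int ^ 'd) K) = (2 * K + 1) ^ CARD('d)"
  unfolding cube_as_product by (subst card_vec_PiE(2)) (simp_all add: nat_add_distrib nat_mult_distrib)

text \<open>Induction on the l1-distance: a unit step of \<open>P\<close> towards \<open>Q\<close>
  in a coordinate where they differ shrinks their bounding box, so the remaining path stays inside
  the original one.\<close>

lemma hull_path:
  fixes f :: "int ^ 'd \<Rightarrow> real"
  defines "bounding_box \<equiv> \<lambda>P Q. {b. \<forall>i. min (P $ i) (Q $ i) \<le> b $ i \<and> b $ i \<le> max (P $ i) (Q $ i)}"
  assumes step: "\<And>b k. b \<in> bounding_box P Q \<Longrightarrow> b + ax k \<in> bounding_box P Q \<Longrightarrow> \<bar>f (b + ax k) - f b\<bar> \<le> M"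
  shows "\<bar>f P - f Q\<bar> \<le> M * real_of_int (\<Sum>i\<in>UNIV. \<bar>P $ i - Q $ i\<bar>)"
  using step
proof (induction "nat (\<Sum>i\<in>UNIV. \<bar>P $ i - Q $ i\<bar>)" arbitrary: P)
  case 0
  have "(\<Sum>i\<in>UNIV. \<bar>P $ i - Q $ i\<bar>) \<ge> 0" by (simp add: sum_nonneg)
  with 0 have "(\<Sum>i\<in>UNIV. \<bar>P $ i - Q $ i\<bar>) = 0" by linarith
  then have "P = Q" by (subst (asm) sum_nonneg_eq_0_iff) (auto simp: vec_eq_iff)
  then show ?case by simp
next
  case (Suc n)
  have "(\<Sum>i\<in>UNIV. \<bar>P $ i - Q $ i\<bar>) \<noteq> 0" using Suc(2) by (intro notI) simp
  then obtain k where k: "P $ k \<noteq> Q $ k"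
    by fastforce
  define P' where "P' = (if P $ k < Q $ k then P + ax k else P - ax k)"
  have P'_nth: "P' $ i = (if i = k then (if P $ k < Q $ k then P $ k + 1 else P $ k - 1) else P $ i)" for i
    by (simp add: P'_def axis_nth_if)
  have hP: "P \<in> bounding_box P Q" by (simp add: bounding_box_def)
  have hP': "P' \<in> bounding_box P Q" using k by (auto simp: bounding_box_def P'_nth)
  have sub: "bounding_box P' Q \<subseteq> bounding_box P Q"
    unfolding bounding_box_def
  proof (clarify)
    fix b i assume "\<forall>i. min (P' $ i) (Q $ i) \<le> b $ i \<and> b $ i \<le> max (P' $ i) (Q $ i)"
    then have "min (P' $ i) (Q $ i) \<le> b $ i \<and> b $ i \<le> max (P' $ i) (Q $ i)" by blast
    then show "min (P $ i) (Q $ i) \<le> b $ i \<and> b $ i \<le> max (P $ i) (Q $ i)"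
      using k by (auto simp: P'_nth split: if_splits)
  qed
  have "\<bar>f P - f P'\<bar> \<le> M"
  proof (cases "P $ k < Q $ k")
    case True
    then have e: "P' = P + ax k" by (simp add: P'_def)
    show ?thesis using Suc.prems[of P k] hP hP' unfolding e by (simp add: abs_minus_commute)
  next
    case False
    then have e: "P = P' + ax k" by (simp add: P'_def)
    show ?thesis using Suc.prems[of P' k] hP hP' unfolding e[symmetric] by simp
  qed
  have sums: "(\<Sum>i\<in>UNIV. \<bar>P $ i - Q $ i\<bar>) = (\<Sum>i\<in>UNIV. \<bar>P' $ i - Q $ i\<bar>) + 1"
  proof -
    have "(\<Sum>i\<in>UNIV. \<bar>P $ i - Q $ i\<bar>) = \<bar>P $ k - Q $ k\<bar> + (\<Sum>i\<in>UNIV-{k}. \<bar>P $ i - Q $ i\<bar>)"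
      by (simp add: sum.remove)
    moreover have "(\<Sum>i\<in>UNIV. \<bar>P' $ i - Q $ i\<bar>) = \<bar>P' $ k - Q $ k\<bar> + (\<Sum>i\<in>UNIV-{k}. \<bar>P' $ i - Q $ i\<bar>)"
      by (simp add: sum.remove)
    moreover have "(\<Sum>i\<in>UNIV-{k}. \<bar>P' $ i - Q $ i\<bar>) = (\<Sum>i\<in>UNIV-{k}. \<bar>P $ i - Q $ i\<bar>)"
      by (intro sum.cong) (auto simp: P'_nth)
    moreover have "\<bar>P $ k - Q $ k\<bar> = \<bar>P' $ k - Q $ k\<bar> + 1" using k by (auto simp: P'_nth)
    ultimately show ?thesis by linarith
  qed
  then have "n = nat (\<Sum>i\<in>UNIV. \<bar>P' $ i - Q $ i\<bar>)" using Suc(2) by linarith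
  then have "\<bar>f P' - f Q\<bar> \<le> M * real_of_int (\<Sum>i\<in>UNIV. \<bar>P' $ i - Q $ i\<bar>)"
    using sub Suc.prems by (intro Suc(1)) auto
  then show ?case using \<open>\<bar>f P - f P'\<bar> \<le> M\<close> unfolding sums by (simp add: distrib_left)
qed

text \<open>Common form of all connections below: endpoints that agree in some coordinates confine
  the path to a hyperplane or a line. The strict inequality on \<open>b $ k\<close> says that the
  lower endpoint of a bond is never the far end, which decides on which side of a site the bond
  lies.\<close>

lemma path_in_cube:
  fixes f :: "int ^ 'd \<Rightarrow> real"
  assumes P: "P \<in> cube v K" and Q: "Q \<in> cube v K" and M: "0 \<le> M"
    and step: "\<And>b k. b \<in> cube v K \<Longrightarrow> P $ k \<noteq> Q $ k \<Longrightarrow>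
        (\<And>i. min (P $ i) (Q $ i) \<le> b $ i \<and> b $ i \<le> max (P $ i) (Q $ i)) \<Longrightarrow>
        b $ k < max (P $ k) (Q $ k) \<Longrightarrow> \<bar>f (b + ax k) - f b\<bar> \<le> M"
  shows "\<bar>f P - f Q\<bar> \<le> M * (2 * real K * CARD('d))"
proof -
  have "\<bar>f P - f Q\<bar> \<le> M * real_of_int (\<Sum>i\<in>UNIV. \<bar>P $ i - Q $ i\<bar>)"
  proof (rule hull_path, clarify)
    fix b k
    assume b: "\<forall>i. min (P $ i) (Q $ i) \<le> b $ i \<and> b $ i \<le> max (P $ i) (Q $ i)"
      and b': "\<forall>i. min (P $ i) (Q $ i) \<le> (b + ax k) $ i \<and> (b + ax k) $ i \<le> max (P $ i) (Q $ i)"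
    have "b \<in> cube v K" unfolding cube_def
    proof (clarify)
      fix i show "\<bar>b $ i - v $ i\<bar> \<le> int K"
      proof -
        have "\<bar>P $ i - v $ i\<bar> \<le> int K" "\<bar>Q $ i - v $ i\<bar> \<le> int K"
          using P Q by (auto simp: cube_def)
        then show ?thesis using b[rule_format, of i] by linarith
      qed
    qed
    moreover have "b $ k < max (P $ k) (Q $ k)" "P $ k \<noteq> Q $ k"
      using b[rule_format, of k] b'[rule_format, of k] by (auto simp: axis_nth_if)
    ultimately show "\<bar>f (b + ax k) - f b\<bar> \<le> M" using b by (intro step) auto
  qed
  also have "\<dots> \<le> M * (2 * real K * CARD('d))"
  proof (rule mult_left_mono[OF _ M])
    have "\<bar>P $ i - Q $ i\<bar> \<le> 2 * int K" for i
    proof -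
      have "\<bar>P $ i - v $ i\<bar> \<le> int K" "\<bar>Q $ i - v $ i\<bar> \<le> int K"
        using P Q by (auto simp: cube_def)
      then show ?thesis by linarith
    qed
    then have "(\<Sum>i\<in>UNIV. \<bar>P $ i - Q $ i\<bar>) \<le> of_nat (card (UNIV :: 'd set)) * (2 * int K)"
      by (intro sum_bounded_above) auto
    then have "real_of_int (\<Sum>i\<in>UNIV. \<bar>P $ i - Q $ i\<bar>)
        \<le> real_of_int (of_nat (card (UNIV :: 'd set)) * (2 * int K))"
      by (simp only: of_int_le_iff)
    then show "real_of_int (\<Sum>i\<in>UNIV. \<bar>P $ i - Q $ i\<bar>) \<le> 2 * real K * CARD('d)"
      by (simp add: mult_ac)
  qed
  finally show ?thesis .
qed

text \<open>Pigeonhole: fewer bad bonds than labels leave a label class with no bad bond in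
  it.\<close>

lemma free_label:
  assumes "finite Z" "finite Ls" "card Z < card Ls"
  shows "\<exists>l\<in>Ls. \<forall>z\<in>Z. h z \<noteq> l"
proof (rule ccontr)
  assume "\<not> ?thesis"
  then have "Ls \<subseteq> h ` Z" by (auto simp: image_iff)
  then have "card Ls \<le> card (h ` Z)" using assms by (intro card_mono) auto
  also have "\<dots> \<le> card Z" using assms by (intro card_image_le)
  finally show False using assms by simp
qed

section \<open>Connecting sites to a well-conducting core\<close>

definition bonds_below ::
  "((int ^ 'd) set \<Rightarrow> real) \<Rightarrow> real \<Rightarrow> int ^ 'd \<Rightarrow> nat \<Rightarrow> ((int ^ 'd) \<times> 'd) set" where
  "bonds_below w s v K = {(b, k). b \<in> cube v K \<and> w (bond b k) < s}"

lemma finite_bonds_below [simp]: "finite (bonds_below w s (v :: int ^ 'd) K)"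
  by (rule finite_subset[of _ "cube v K \<times> UNIV"]) (auto simp: bonds_below_def)

definition bond_energy ::
  "((int ^ 'd) set \<Rightarrow> real) \<Rightarrow> (int ^ 'd \<Rightarrow> real) \<Rightarrow> int ^ 'd \<Rightarrow> real" where
  "bond_energy w f b = (\<Sum>k\<in>UNIV. w (bond b k) * (f (b + ax k) - f b)\<^sup>2)"

text \<open>\<open>q\<close> is the normal direction of the slabs and \<open>p\<close> the direction
  in which neighbouring cubes are chained. \<open>J\<close> bounds the number of bonds below
  \<open>s\<close> in a cube and is also the number of parallel hyperplanes to choose from;
  \<open>J + 1 \<le> K\<close> leaves room for these hyperplanes when they are counted from either
  endpoint of a unit bond.\<close>

locale lattice_geometry =
  fixes w :: "(int ^ 'd) set \<Rightarrow> real" and s t :: real and J K :: nat and p q :: 'd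
  assumes pq: "p \<noteq> q" and J: "1 \<le> J" and K: "J + 1 \<le> K"
    and t: "0 < t" and ts: "t \<le> s" and pos: "\<And>u k. 0 < w (bond u k)"
begin

definition cube_energy :: "(int ^ 'd \<Rightarrow> real) \<Rightarrow> int ^ 'd \<Rightarrow> real" where
  "cube_energy f v = (\<Sum>b\<in>cube v K. bond_energy w f b)"

lemma bond_energy_nonneg: "0 \<le> bond_energy w f b"
  unfolding bond_energy_def by (intro sum_nonneg mult_nonneg_nonneg) (auto intro: less_imp_le pos)

lemma cube_energy_nonneg: "0 \<le> cube_energy f v"
  unfolding cube_energy_def by (intro sum_nonneg bond_energy_nonneg)

lemma gradient_bound:
  assumes "b \<in> cube v K" "\<sigma> \<le> w (bond b k)" "0 < \<sigma>"
  shows "\<bar>f (b + ax k) - f b\<bar> \<le> sqrt (cube_energy f v / \<sigma>)"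
proof (rule real_le_rsqrt)
  have "\<sigma> * (f (b + ax k) - f b)\<^sup>2 \<le> w (bond b k) * (f (b + ax k) - f b)\<^sup>2"
    using assms by (intro mult_right_mono) auto
  also have "\<dots> \<le> bond_energy w f b"
    unfolding bond_energy_def
    by (rule member_le_sum[where f = "\<lambda>k. w (bond b k) * (f (b + ax k) - f b)\<^sup>2"]) (auto intro!: mult_nonneg_nonneg less_imp_le[OF pos])
  also have "\<dots> \<le> cube_energy f v"
    unfolding cube_energy_def using assms
    by (intro member_le_sum) (auto intro: bond_energy_nonneg)
  finally show "\<bar>f (b + ax k) - f b\<bar>\<^sup>2 \<le> cube_energy f v / \<sigma>"
    using assms by (simp add: field_simps)
qed

text \<open>Bonds in direction \<open>q\<close> are exempt because they leave the hyperplane, which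
  only has to be connected within itself.\<close>

definition open_slab :: "int ^ 'd \<Rightarrow> int \<Rightarrow> bool" where
  "open_slab v m \<longleftrightarrow> 1 \<le> m \<and> m \<le> int J \<and>
     (\<forall>b\<in>cube v K. \<forall>k. k \<noteq> q \<and> b $ q = v $ q + m \<longrightarrow> s \<le> w (bond b k))"

definition core_height :: "int ^ 'd \<Rightarrow> int" where
  "core_height v = (SOME m. open_slab v m)"

definition core :: "int ^ 'd \<Rightarrow> int ^ 'd" where
  "core v = v + axis q (core_height v)"

text \<open>The label 0 is never returned, so callers use it as a bin for the bonds that do not
  matter to them.\<close>

lemma free_coordinate:
  fixes h :: "int ^ 'd \<Rightarrow> 'd \<Rightarrow> int"
  assumes "card (bonds_below w s v K) < J"
  obtains l where "1 \<le> l" "l \<le> int J"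
    "\<forall>b k. b \<in> cube v K \<longrightarrow> h b k = l \<longrightarrow> s \<le> w (bond b k)"
proof -
  have "\<exists>l\<in>{1..int J}. \<forall>z\<in>bonds_below w s v K. case_prod h z \<noteq> l"
    using assms by (intro free_label) auto
  then obtain l where "l \<in> {1..int J}" and l: "\<forall>z\<in>bonds_below w s v K. case_prod h z \<noteq> l" by blast
  then show ?thesis unfolding bonds_below_def by (intro that[of l]) (auto simp: not_less[symmetric])
qed

lemma open_slab_core:
  assumes "card (bonds_below w s v K) < J"
  shows "open_slab v (core_height v)"
proof -
  obtain l where "1 \<le> l" "l \<le> int J"
    and l: "\<forall>b k. b \<in> cube v K \<longrightarrow> (if k = q then 0 else b $ q - v $ q) = l \<longrightarrow> s \<le> w (bond b k)"
    by (rule free_coordinate[OF assms, of "\<lambda>b k. if k = q then 0 else b $ q - v $ q"], rule that)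
  then have "open_slab v l" unfolding open_slab_def by auto
  then show ?thesis unfolding core_height_def by (rule someI)
qed

definition path_bound :: real where "path_bound = 2 * real K * CARD('d)"

lemma path_bound_ge: "1 \<le> path_bound"
proof -
  have "1 * 1 \<le> real K * CARD('d)" using K by (intro mult_mono) (auto simp: Suc_le_eq)
  then show ?thesis by (simp add: path_bound_def)
qed

lemma path_in_cube_bound:
  fixes P Q v :: "int ^ 'd"
  assumes "P \<in> cube v K" "Q \<in> cube v K" "0 \<le> M"
    and "\<And>b k. b \<in> cube v K \<Longrightarrow> P $ k \<noteq> Q $ k \<Longrightarrow>
        (\<And>i. min (P $ i) (Q $ i) \<le> b $ i \<and> b $ i \<le> max (P $ i) (Q $ i)) \<Longrightarrow>
        b $ k < max (P $ k) (Q $ k) \<Longrightarrow> \<bar>f (b + ax k) - f b\<bar> \<le> M"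
  shows "\<bar>f P - f Q\<bar> \<le> M * path_bound"
  unfolding path_bound_def by (rule path_in_cube[OF assms(1-3)]) (rule assms(4))

lemma slab_path:
  assumes v: "open_slab v m" and P: "P \<in> cube v K" "P $ q = v $ q + m" and Q: "Q \<in> cube v K" "Q $ q = v $ q + m"
  shows "\<bar>f P - f Q\<bar> \<le> sqrt (cube_energy f v / s) * path_bound"
proof (rule path_in_cube_bound[OF P(1) Q(1)])
  show "0 \<le> sqrt (cube_energy f v / s)" using cube_energy_nonneg t ts by simp
  fix b k assume b: "b \<in> cube v K" "P $ k \<noteq> Q $ k"
    "\<And>i. min (P $ i) (Q $ i) \<le> b $ i \<and> b $ i \<le> max (P $ i) (Q $ i)"
  have "k \<noteq> q" using b(2) P Q by auto
  moreover have "b $ q = v $ q + m" using b(3)[of q] P Q by auto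
  ultimately have "s \<le> w (bond b k)" using v b(1) unfolding open_slab_def by blast
  then show "\<bar>f (b + ax k) - f b\<bar> \<le> sqrt (cube_energy f v / s)"
    using b t ts by (intro gradient_bound) auto
qed

text \<open>The open slabs of neighbouring cubes may sit at different heights. They are joined by a
  line in direction \<open>q\<close> at a \<open>p\<close>-offset \<open>l\<close> where the first
  cube has no \<open>q\<close>-bond below \<open>s\<close>. The path has three legs: slab of
  \<open>v\<close>, line, slab of \<open>v + ax p\<close>.\<close>

lemma core_step:
  assumes c: "card (bonds_below w s v K) < J" "card (bonds_below w s (v + ax p) K) < J"
  shows "(f (core v) - f (core (v + ax p)))\<^sup>2
    \<le> 8 * path_bound\<^sup>2 / s * (cube_energy f v + cube_energy f (v + ax p))"
proof -
  define u where "u = v + ax p"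
  define m where "m = core_height v"
  define m' where "m' = core_height u"
  define A where "A = sqrt (cube_energy f v / s)"
  define B where "B = sqrt (cube_energy f u / s)"
  have sl: "open_slab v m" "open_slab u m'" using c open_slab_core by (simp_all add: m_def m'_def u_def)
  have mb: "1 \<le> m" "m \<le> int J" "1 \<le> m'" "m' \<le> int J" using sl by (auto simp: open_slab_def)
  obtain l where l1: "1 \<le> l" "l \<le> int J"
    and l: "\<forall>b k. b \<in> cube v K \<longrightarrow> (if k = q then b $ p - v $ p else 0) = l \<longrightarrow> s \<le> w (bond b k)"
    by (rule free_coordinate[OF c(1), of "\<lambda>b k. if k = q then b $ p - v $ p else 0"], rule that)
  define P1 where "P1 = v + axis p l + axis q m"
  define P2 where "P2 = v + axis p l + axis q m'"
  have core: "core v = v + axis q m" "core u = u + axis q m'" by (simp_all add: core_def m_def m'_def)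
  have in1: "core v \<in> cube v K" "P1 \<in> cube v K" "P2 \<in> cube v K" "P2 \<in> cube u K" "core u \<in> cube u K"
    using mb l1 pq K by (auto simp: cube_def core core(2)[unfolded u_def] P1_def P2_def u_def axis_nth_if)
  have "\<bar>f (core v) - f P1\<bar> \<le> A * path_bound"
    unfolding A_def using sl(1) in1(1) _ in1(2) by (rule slab_path) (use pq in \<open>auto simp: core P1_def axis_nth_if\<close>)
  moreover have "\<bar>f P2 - f (core u)\<bar> \<le> B * path_bound"
    unfolding B_def using sl(2) in1(4) _ in1(5) by (rule slab_path) (use pq in \<open>auto simp: core(2)[unfolded u_def] P2_def u_def axis_nth_if\<close>)
  moreover have "\<bar>f P1 - f P2\<bar> \<le> A * path_bound"
  proof (rule path_in_cube_bound[OF in1(2,3)])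
    show "0 \<le> A" using cube_energy_nonneg t ts by (simp add: A_def)
    fix b k assume b: "b \<in> cube v K" "P1 $ k \<noteq> P2 $ k"
      "\<And>i. min (P1 $ i) (P2 $ i) \<le> b $ i \<and> b $ i \<le> max (P1 $ i) (P2 $ i)"
    have "k = q" using b(2) by (auto simp: P1_def P2_def axis_nth_if split: if_splits)
    moreover have "b $ p = v $ p + l" using b(3)[of p] pq by (auto simp: P1_def P2_def axis_nth_if)
    ultimately have "s \<le> w (bond b k)" using b(1) l by auto
    then show "\<bar>f (b + ax k) - f b\<bar> \<le> A"
      unfolding A_def using b t ts by (intro gradient_bound) auto
  qed
  \<comment> \<open>Two legs are charged to the first cube and one to the second.\<close>
  ultimately have "\<bar>f (core v) - f (core u)\<bar> \<le> 2 * path_bound * (A + B)"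
    using mult_nonneg_nonneg[of B path_bound] path_bound_ge cube_energy_nonneg[of f u] t ts
    by (simp add: algebra_simps B_def)
  then have "\<bar>f (core v) - f (core u)\<bar>\<^sup>2 \<le> (2 * path_bound * (A + B))\<^sup>2"
    by (rule power_mono) simp
  also have "\<dots> = 4 * path_bound\<^sup>2 * (A + B)\<^sup>2" by (simp add: power_mult_distrib)
  also have "\<dots> \<le> 4 * path_bound\<^sup>2 * (2 * (A\<^sup>2 + B\<^sup>2))"
    using sum_squares_bound[of A B] by (intro mult_left_mono) (auto simp: power2_sum)
  also have "\<dots> = 8 * path_bound\<^sup>2 / s * (cube_energy f v + cube_energy f u)"
    using cube_energy_nonneg t ts by (simp add: A_def B_def field_simps)
  finally show ?thesis by (simp add: u_def)
qed

text \<open>The rays leaving the endpoints of the bond \<open>(u, i)\<close> away from it are \<open>4d - 2\<close> in number and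
  edge-disjoint, so fewer than \<open>4d - 2\<close> bad bonds leave one of them intact.\<close>
lemma open_ray:
  fixes u :: "int ^ 'd"
  assumes c: "card (bonds_below w t u K) < 4 * CARD('d) - 2" and i: "t \<le> w (bond u i)"
  obtains a j \<tau> where "a = u \<or> a = u + ax i" "\<tau> = 1 \<or> \<tau> = (-1::int)"
    "\<forall>l\<ge>0. l \<le> int J \<longrightarrow> \<bar>f a - f (a + axis j (\<tau> * l))\<bar> \<le> sqrt (cube_energy f u / t) * path_bound"
proof -
  \<comment> \<open>A bond is labelled by its direction, by the side of \<open>(u, i)\<close> on
    which it lies, and by its offset in direction \<open>i\<close>; the offset is suppressed for
    bonds parallel to \<open>i\<close>. A label class is larger than a ray, but the classes are
    disjoint and each ray stays in one of them.\<close>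
  define h where "h = (\<lambda>(b :: int ^ 'd, k :: 'd).
    (k, b $ k \<ge> u $ k + (if k = i then 1 else 0), if k = i then 0 else b $ i - u $ i))"
  \<comment> \<open>Four rays for each direction other than \<open>i\<close> (two endpoints, two
    signs), and two rays prolonging the bond itself.\<close>
  define Ls where "Ls = (UNIV - {i}) \<times> (UNIV :: bool set) \<times> {0, 1 :: int} \<union> {i} \<times> (UNIV :: bool set) \<times> {0}"
  have "card Ls = (CARD('d) - 1) * (2 * 2) + 2"
    unfolding Ls_def by (subst card_Un_disjoint) (auto simp: card_cartesian_product card_Diff_singleton)
  also have "\<dots> = 4 * CARD('d) - 2"
  proof -
    have "1 \<le> CARD('d)" by (simp add: Suc_le_eq)
    then show ?thesis by linarith
  qed
  finally have "card Ls = 4 * CARD('d) - 2" .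
  then have "\<exists>x\<in>Ls. \<forall>z\<in>bonds_below w t u K. h z \<noteq> x"
    using c by (intro free_label) (auto simp: Ls_def)
  then obtain j \<sigma> \<beta> where jl: "(j, \<sigma>, \<beta>) \<in> Ls" and free: "\<And>b k. b \<in> cube u K \<Longrightarrow> h (b, k) = (j, \<sigma>, \<beta>) \<Longrightarrow> t \<le> w (bond b k)"
    unfolding bonds_below_def by (fastforce simp: not_less)
  define \<tau> where "\<tau> = (if \<sigma> then 1 else -1 :: int)"
  define a where "a = u + axis i (if j = i then (if \<sigma> then 1 else 0) else \<beta>)"
  have \<beta>: "j \<noteq> i \<Longrightarrow> \<beta> = 0 \<or> \<beta> = 1" "j = i \<Longrightarrow> \<beta> = 0" using jl by (auto simp: Ls_def)
  have au: "a = u \<or> a = u + ax i" using \<beta> by (auto simp: a_def vec_eq_iff axis_nth_if)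
  show ?thesis
  proof (rule that[of a \<tau> j])
    show "a = u \<or> a = u + ax i" by (fact au)
    show "\<tau> = 1 \<or> \<tau> = -1" by (simp add: \<tau>_def)
    show "\<forall>l\<ge>0. l \<le> int J \<longrightarrow> \<bar>f a - f (a + axis j (\<tau> * l))\<bar> \<le> sqrt (cube_energy f u / t) * path_bound"
    proof (intro allI impI)
      fix l assume l: "0 \<le> l" "l \<le> int J"
      define Q where "Q = a + axis j (\<tau> * l)"
      have inA: "a \<in> cube u K" using K au by (auto simp: cube_def axis_nth_if)
      have inQ: "Q \<in> cube u K" unfolding cube_def Q_def a_def \<tau>_def using K l \<beta>
        by (auto simp: axis_nth_if)
      show "\<bar>f a - f (a + axis j (\<tau> * l))\<bar> \<le> sqrt (cube_energy f u / t) * path_bound"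
        unfolding Q_def[symmetric]
      proof (rule path_in_cube_bound[OF inA inQ])
        show "0 \<le> sqrt (cube_energy f u / t)" using cube_energy_nonneg t by simp
        fix b k assume b: "b \<in> cube u K" "a $ k \<noteq> Q $ k"
          "\<And>i. min (a $ i) (Q $ i) \<le> b $ i \<and> b $ i \<le> max (a $ i) (Q $ i)"
          and bk: "b $ k < max (a $ k) (Q $ k)"
        have k: "k = j" using b(2) by (auto simp: Q_def axis_nth_if split: if_splits)
        have "h (b, k) = (j, \<sigma>, \<beta>)"
          using b(3)[of j] b(3)[of i] bk l \<beta> unfolding k h_def Q_def a_def \<tau>_def
          by (auto simp: axis_nth_if split: if_splits)
        then have "t \<le> w (bond b k)" using free b(1) by blast
        then show "\<bar>f (b + ax k) - f b\<bar> \<le> sqrt (cube_energy f u / t)"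
          using b t by (intro gradient_bound) auto
      qed
    qed
  qed
qed

text \<open>Cross the bond if necessary, follow the intact ray in direction \<open>j\<close> to a
  hyperplane normal to \<open>j\<close> without in-plane bonds below \<open>s\<close>, and continue
  inside it. If \<open>j\<close> differs from \<open>q\<close>, this hyperplane meets the core slab;
  if \<open>j = q\<close>, the two are parallel and a line in direction \<open>q\<close> is
  inserted. At most five legs, each costing at most \<open>A * path_bound\<close>, give the factor
  25.\<close>

lemma near_core:
  assumes c: "card (bonds_below w s u K) < J" "card (bonds_below w t u K) < 4 * CARD('d) - 2"
    and i: "t \<le> w (bond u i)" and x: "x = u \<or> x = u + ax i"
  shows "(f x - f (core u))\<^sup>2 \<le> 25 * path_bound\<^sup>2 / t * cube_energy f u"
proof -
  define A where "A = sqrt (cube_energy f u / t)"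
  define B where "B = sqrt (cube_energy f u / s)"
  have A0: "0 \<le> A" using cube_energy_nonneg t by (simp add: A_def)
  have BA: "B \<le> A" unfolding A_def B_def
    using cube_energy_nonneg t ts by (intro real_sqrt_le_mono divide_left_mono) auto
  have B0: "0 \<le> B" using cube_energy_nonneg t ts by (simp add: B_def)
  define m where "m = core_height u"
  have sl: "open_slab u m" using c open_slab_core by (simp add: m_def)
  have mb: "1 \<le> m" "m \<le> int J" using sl by (auto simp: open_slab_def)
  have core: "core u = u + axis q m" by (simp add: core_def m_def)
  have inC: "core u \<in> cube u K" using mb K by (auto simp: core cube_def axis_nth_if)
  obtain a j \<tau> where a: "a = u \<or> a = u + ax i" and \<tau>: "\<tau> = 1 \<or> \<tau> = (-1::int)"
    and ray: "\<forall>l\<ge>0. l \<le> int J \<longrightarrow> \<bar>f a - f (a + axis j (\<tau> * l))\<bar> \<le> A * path_bound"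
    by (rule open_ray[OF c(2) i, of f, folded A_def], rule that)
  have start: "\<bar>f x - f a\<bar> \<le> A * path_bound"
  proof -
    have "u \<in> cube u K" by (simp add: cube_def)
    then have "\<bar>f (u + ax i) - f u\<bar> \<le> A" unfolding A_def using i t by (intro gradient_bound)
    also have "A \<le> A * path_bound" using A0 path_bound_ge mult_left_mono[of 1 path_bound A] by simp
    finally have e: "\<bar>f (u + ax i) - f u\<bar> \<le> A * path_bound" .
    have "0 \<le> A * path_bound" using A0 path_bound_ge by simp
    then show ?thesis using e x a by (auto simp: abs_minus_commute)
  qed
  obtain l where l1: "1 \<le> l" "l \<le> int J"
    and l: "\<forall>b k. b \<in> cube u K \<longrightarrow> (if k = j then 0 else \<tau> * (b $ j - a $ j)) = l \<longrightarrow> s \<le> w (bond b k)"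
    by (rule free_coordinate[OF c(1), of "\<lambda>b k. if k = j then 0 else \<tau> * (b $ j - a $ j)"], rule that)
  define P1 where "P1 = a + axis j (\<tau> * l)"
  have in1: "P1 \<in> cube u K"
    using a \<tau> l1 K by (auto simp: cube_def P1_def axis_nth_if)
  have slab: "\<bar>f P1 - f P2\<bar> \<le> B * path_bound" if P2: "P2 \<in> cube u K" "P2 $ j = a $ j + \<tau> * l" for P2
  proof (rule path_in_cube_bound[OF in1 P2(1) B0])
    fix b k assume b: "b \<in> cube u K" "P1 $ k \<noteq> P2 $ k"
      "\<And>i. min (P1 $ i) (P2 $ i) \<le> b $ i \<and> b $ i \<le> max (P1 $ i) (P2 $ i)"
    have P1j: "P1 $ j = a $ j + \<tau> * l" by (simp add: P1_def axis_nth_if)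
    have "k \<noteq> j" using b(2) P2 P1j by auto
    moreover have "b $ j = a $ j + \<tau> * l" using b(3)[of j] P2 P1j by auto
    ultimately have "s \<le> w (bond b k)" using b(1) \<tau> l1 by (intro l[rule_format]) auto
    then show "\<bar>f (b + ax k) - f b\<bar> \<le> B"
      unfolding B_def using b t ts by (intro gradient_bound) auto
  qed
  have "\<bar>f x - f (core u)\<bar> \<le> 5 * path_bound * A"
  proof (cases "j = q")
    case False
    define P2 where "P2 = u + axis q m + axis j (a $ j + \<tau> * l - u $ j)"
    have in2: "P2 \<in> cube u K"
      using a \<tau> l1 K mb False by (auto simp: cube_def P2_def axis_nth_if)
    have "\<bar>f P1 - f P2\<bar> \<le> B * path_bound"
      using in2 False by (intro slab) (auto simp: P2_def axis_nth_if)
    moreover have "\<bar>f P2 - f (core u)\<bar> \<le> B * path_bound"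
      unfolding B_def using sl in2 _ inC
      by (rule slab_path) (use False in \<open>auto simp: core P2_def axis_nth_if\<close>)
    moreover have "\<bar>f a - f P1\<bar> \<le> A * path_bound" unfolding P1_def using l1 by (intro ray[rule_format]) auto
    moreover have "B * path_bound \<le> A * path_bound" "0 \<le> A * path_bound" using BA path_bound_ge A0 by (auto intro: mult_right_mono)
    ultimately have "\<bar>f x - f (core u)\<bar> \<le> 5 * (A * path_bound)" using start by linarith
    then show ?thesis by (simp add: mult_ac)
  next
    case True
    obtain l' where l'1: "1 \<le> l'" "l' \<le> int J"
      and l': "\<forall>b k. b \<in> cube u K \<longrightarrow> (if k = q then b $ p - u $ p else 0) = l' \<longrightarrow> s \<le> w (bond b k)"
      by (rule free_coordinate[OF c(1), of "\<lambda>b k. if k = q then b $ p - u $ p else 0"], rule that)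
    define P2 where "P2 = u + axis p l' + axis q (a $ q + \<tau> * l - u $ q)"
    define P3 where "P3 = u + axis p l' + axis q m"
    have in2: "P2 \<in> cube u K"
      using a \<tau> l1 K l'1 pq by (auto simp: cube_def P2_def axis_nth_if)
    have in3: "P3 \<in> cube u K"
      using K mb l'1 pq by (auto simp: cube_def P3_def axis_nth_if)
    have "\<bar>f P1 - f P2\<bar> \<le> B * path_bound"
      using in2 pq True by (intro slab) (auto simp: P2_def axis_nth_if)
    moreover have "\<bar>f P2 - f P3\<bar> \<le> B * path_bound"
    proof (rule path_in_cube_bound[OF in2 in3 B0])
      fix b k assume b: "b \<in> cube u K" "P2 $ k \<noteq> P3 $ k"
        "\<And>i. min (P2 $ i) (P3 $ i) \<le> b $ i \<and> b $ i \<le> max (P2 $ i) (P3 $ i)"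
      have "k = q" using b(2) by (auto simp: P2_def P3_def axis_nth_if split: if_splits)
      moreover have "b $ p = u $ p + l'" using b(3)[of p] pq by (auto simp: P2_def P3_def axis_nth_if)
      ultimately have "s \<le> w (bond b k)" using b(1) l' by auto
      then show "\<bar>f (b + ax k) - f b\<bar> \<le> B"
        unfolding B_def using b t ts by (intro gradient_bound) auto
    qed
    moreover have "\<bar>f P3 - f (core u)\<bar> \<le> B * path_bound"
      unfolding B_def using sl in3 _ inC
      by (rule slab_path) (use pq in \<open>auto simp: core P3_def axis_nth_if\<close>)
    moreover have "\<bar>f a - f P1\<bar> \<le> A * path_bound" unfolding P1_def using l1 by (intro ray[rule_format]) auto
    moreover have "B * path_bound \<le> A * path_bound" using BA path_bound_ge by (intro mult_right_mono) auto
    ultimately have "\<bar>f x - f (core u)\<bar> \<le> 5 * (A * path_bound)" using start by linarith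
    then show ?thesis by (simp add: mult_ac)
  qed
  then have "\<bar>f x - f (core u)\<bar>\<^sup>2 \<le> (5 * path_bound * A)\<^sup>2"
    by (rule power_mono) simp
  also have "\<dots> = 25 * path_bound\<^sup>2 / t * cube_energy f u"
    using cube_energy_nonneg t by (simp add: A_def power_mult_distrib)
  finally show ?thesis by simp
qed

end

section \<open>A Poincare inequality off the traps\<close>

text \<open>Summation by parts: the squared difference over a bond splits into a term for each
  endpoint, and the term of the upper endpoint is shifted by \<open>ax k\<close>. The radius
  \<open>R\<close> only has to be large enough to include every bond touching the box.\<close>

lemma energy_identity:
  fixes f :: "int ^ 'd \<Rightarrow> real"
  assumes f: "\<And>x. x \<notin> lattice_box n \<Longrightarrow> f x = 0" and R: "n + 1 \<le> R"
  shows "(\<Sum>b\<in>cube 0 R. bond_energy w f b) = (\<Sum>x\<in>lattice_box n. f x * - rc_laplacian w f x)"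
proof -
  have sub: "lattice_box n \<subseteq> cube (0 :: int ^ 'd) R"
    using R by (auto simp: lattice_box_cube cube_def intro: order_trans)
  have one: "(\<Sum>b\<in>cube 0 R. w (bond b k) * (f (b + ax k) - f b)\<^sup>2)
      = (\<Sum>x\<in>lattice_box n. f x * (w (bond x k) * (f x - f (x + ax k)) + w (bond (x - ax k) k) * (f x - f (x - ax k))))"
    for k
  proof -
    define h where "h = (\<lambda>x. f x * (w (bond (x - ax k) k) * (f x - f (x - ax k))))"
    have "(\<Sum>b\<in>cube 0 R. h (b + ax k)) = (\<Sum>x\<in>(\<lambda>b. b + ax k) ` cube 0 R. h x)"
      by (subst sum.reindex) (auto simp: inj_on_def)
    also have "\<dots> = (\<Sum>x\<in>lattice_box n. h x)"
    proof (rule sum.mono_neutral_right)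
      show "lattice_box n \<subseteq> (\<lambda>b. b + ax k) ` cube 0 R"
      proof
        fix x :: "int ^ 'd" assume x: "x \<in> lattice_box n"
        have "x - ax k \<in> cube 0 R"
          unfolding cube_def
        proof (clarify)
          fix i have "\<bar>x $ i\<bar> \<le> int n" using x by (simp add: lattice_box_def)
          then show "\<bar>(x - ax k) $ i - 0 $ i\<bar> \<le> int R" using R by (auto simp: axis_nth_if)
        qed
        then show "x \<in> (\<lambda>b. b + ax k) ` cube 0 R" by (intro image_eqI[of _ _ "x - ax k"]) auto
      qed
    qed (auto simp: h_def f)
    finally have 1: "(\<Sum>b\<in>cube 0 R. h (b + ax k)) = (\<Sum>x\<in>lattice_box n. h x)" .
    have 2: "(\<Sum>b\<in>cube 0 R. f b * (w (bond b k) * (f b - f (b + ax k))))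
        = (\<Sum>x\<in>lattice_box n. f x * (w (bond x k) * (f x - f (x + ax k))))"
      using sub f by (intro sum.mono_neutral_right) auto
    have "(\<Sum>b\<in>cube 0 R. w (bond b k) * (f (b + ax k) - f b)\<^sup>2)
        = (\<Sum>b\<in>cube 0 R. h (b + ax k)) + (\<Sum>b\<in>cube 0 R. f b * (w (bond b k) * (f b - f (b + ax k))))"
      unfolding sum.distrib[symmetric] by (intro sum.cong) (auto simp: h_def power2_eq_square algebra_simps)
    also have "\<dots> = (\<Sum>x\<in>lattice_box n. f x * (w (bond x k) * (f x - f (x + ax k)) + w (bond (x - ax k) k) * (f x - f (x - ax k))))"
      unfolding 1 2 sum.distrib[symmetric] by (intro sum.cong) (auto simp: h_def algebra_simps)
    finally show ?thesis .
  qed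
  have lap: "- rc_laplacian w f x
      = (\<Sum>k\<in>UNIV. w (bond x k) * (f x - f (x + ax k)) + w (bond (x - ax k) k) * (f x - f (x - ax k)))" for x
  proof -
    have "- rc_laplacian w f x = (\<Sum>y | y \<sim>\<^sub>l x. w {x, y} * (f x - f y))"
      unfolding rc_laplacian_def sum_negf[symmetric] by (intro sum.cong) (auto simp: algebra_simps)
    then show ?thesis
      unfolding sum_neighbours sum.distrib by (simp add: bond_def insert_commute)
  qed
  have "(\<Sum>b\<in>cube 0 R. bond_energy w f b)
      = (\<Sum>k\<in>UNIV. \<Sum>b\<in>cube 0 R. w (bond b k) * (f (b + ax k) - f b)\<^sup>2)"
    unfolding bond_energy_def by (rule sum.swap)
  also have "\<dots> = (\<Sum>x\<in>lattice_box n. f x * - rc_laplacian w f x)"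
    unfolding one lap sum_distrib_left by (rule sum.swap)
  finally show ?thesis .
qed

definition trap :: "((int ^ 'd) set \<Rightarrow> real) \<Rightarrow> real \<Rightarrow> int ^ 'd \<Rightarrow> bool" where
  "trap w t x \<longleftrightarrow> (\<forall>k. w (bond x k) < t \<and> w (bond (x - ax k) k) < t)"

lemma cube_add: "x \<in> cube v K \<Longrightarrow> v \<in> cube u L \<Longrightarrow> x \<in> cube (u :: int ^ 'd) (L + K)"
  unfolding cube_def
proof (clarify)
  fix i assume "\<forall>i. \<bar>x $ i - v $ i\<bar> \<le> int K" "\<forall>i. \<bar>v $ i - u $ i\<bar> \<le> int L"
  then have "\<bar>x $ i - v $ i\<bar> \<le> int K" "\<bar>v $ i - u $ i\<bar> \<le> int L" by blast+
  then show "\<bar>x $ i - u $ i\<bar> \<le> int (L + K)" by linarith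
qed

lemma axis_in_cube: "\<bar>j\<bar> \<le> int L \<Longrightarrow> v + axis k j \<in> cube v L"
  by (simp add: cube_def axis_nth_if)

context lattice_geometry
begin

text \<open>Double counting: a base point lies in at most (2K + 1)^d of the cubes.\<close>

lemma sum_cube_energy:
  assumes V: "finite V" "V \<subseteq> cube 0 R"
  shows "(\<Sum>v\<in>V. cube_energy f v) \<le> (2 * K + 1) ^ CARD('d) * (\<Sum>b\<in>cube 0 (R + K). bond_energy w f b)"
proof -
  have e: "cube v K = {b \<in> cube 0 (R + K). b \<in> cube v K}" if "v \<in> V" for v
    using V that cube_add[of _ v K 0 R] by auto
  have "(\<Sum>v\<in>V. cube_energy f v) = (\<Sum>v\<in>V. \<Sum>b | b \<in> cube 0 (R + K) \<and> b \<in> cube v K. bond_energy w f b)"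
    unfolding cube_energy_def using e by (intro sum.cong) auto
  also have "\<dots> = (\<Sum>b\<in>cube 0 (R + K). \<Sum>v | v \<in> V \<and> b \<in> cube v K. bond_energy w f b)"
    using V by (intro sum.swap_restrict) auto
  also have "\<dots> \<le> (\<Sum>b\<in>cube 0 (R + K). (2 * K + 1) ^ CARD('d) * bond_energy w f b)"
  proof (rule sum_mono)
    fix b :: "int ^ 'd"
    have "card {v \<in> V. b \<in> cube v K} \<le> card (cube b K)"
      by (intro card_mono) (auto simp: cube_commute)
    then have "real (card {v \<in> V. b \<in> cube v K}) \<le> real ((2 * K + 1) ^ CARD('d))" 
      unfolding card_cube by (simp only: of_nat_le_iff)
    then show "(\<Sum>v | v \<in> V \<and> b \<in> cube v K. bond_energy w f b) \<le> (2 * K + 1) ^ CARD('d) * bond_energy w f b"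
      unfolding sum_constant by (simp add: mult_right_mono bond_energy_nonneg)
  qed
  finally show ?thesis by (simp add: sum_distrib_left)
qed

lemma core_nth: "core v $ p = v $ p"
  using pq by (simp add: core_def axis_nth_if)

text \<open>A one-dimensional Poincare inequality along rows of cores. Passing to the core keeps the
  \<open>p\<close>-coordinate, so after 2n + 2 steps in direction \<open>p\<close> the core is
  outside the box, where \<open>f\<close> vanishes. Cauchy-Schwarz over the steps and the sum over
  the steps contribute one factor 2n + 2 each.\<close>

lemma core_mass:
  assumes f: "\<And>x. x \<notin> lattice_box n \<Longrightarrow> f x = 0"
    and c: "\<And>v. v \<in> cube 0 (3 * n + 4) \<Longrightarrow> card (bonds_below w s v K) < J"
  shows "(\<Sum>v\<in>cube 0 (n + 1). (f (core v))\<^sup>2)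
     \<le> 16 * path_bound\<^sup>2 / s * (2 * real n + 2)\<^sup>2 * (2 * K + 1) ^ CARD('d)
        * (\<Sum>b\<in>cube 0 (3 * n + 4 + K). bond_energy w f b)"
proof -
  define T where "T = 2 * n + 2"
  define C where "C = 8 * path_bound\<^sup>2 / s"
  define E where "E = (2 * K + 1) ^ CARD('d) * (\<Sum>b\<in>cube 0 (3 * n + 4 + K). bond_energy w f b)"
  have C0: "0 \<le> C" using t ts by (simp add: C_def)
  have inc: "v + axis p (int j) \<in> cube 0 (3 * n + 4)" if "v \<in> cube 0 (n + 1)" "j \<le> T" for v j
    using cube_add[OF axis_in_cube[of "int j" T v p] that(1)] that(2) cube_add[of _ _ _ 0 "n + 1"]
    unfolding T_def by (auto simp: cube_def intro: order_trans)
  have pt: "(f (core v))\<^sup>2 \<le> real T * (\<Sum>j<T. C * (cube_energy f (v + axis p (int j)) + cube_energy f (v + axis p (int (Suc j)))))"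
    if v: "v \<in> cube 0 (n + 1)" for v
  proof -
    define g where "g = (\<lambda>j. f (core (v + axis p (int j))))"
    have "\<bar>v $ p\<bar> \<le> int n + 1" using v by (simp add: cube_def add.commute)
    then have "core (v + axis p (int T)) \<notin> lattice_box n"
      unfolding lattice_box_def using core_nth[of "v + axis p (int T)"]
      by (auto simp: axis_nth_if T_def intro!: exI[of _ p])
    then have "g T = 0" by (simp add: g_def f)
    then have "f (core v) = (\<Sum>j<T. g j - g (Suc j))"
      unfolding sum_lessThan_telescope' by (simp add: g_def axis_eq_0_iff[THEN iffD2])
    then have "(f (core v))\<^sup>2 \<le> (\<Sum>j<T. (g j - g (Suc j))\<^sup>2) * card {..<T}"
      using sum_squared_le_sum_of_squares by metis
    also have "\<dots> \<le> (\<Sum>j<T. C * (cube_energy f (v + axis p (int j)) + cube_energy f (v + axis p (int (Suc j))))) * card {..<T}"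
    proof (intro mult_right_mono sum_mono)
      fix j assume j: "j \<in> {..<T}"
      have e: "v + axis p (int (Suc j)) = v + axis p (int j) + ax p"
        by (simp add: vec_eq_iff axis_nth_if)
      show "(g j - g (Suc j))\<^sup>2 \<le> C * (cube_energy f (v + axis p (int j)) + cube_energy f (v + axis p (int (Suc j))))"
        unfolding g_def C_def e using inc[OF v, of j] inc[OF v, of "Suc j"] j unfolding e
        by (intro core_step c) auto
    qed auto
    finally show ?thesis by (simp add: mult.commute)
  qed
  have sh: "(\<Sum>v\<in>cube 0 (n + 1). cube_energy f (v + axis p (int j))) \<le> E" if "j \<le> T" for j
  proof -
    have "(\<Sum>v\<in>cube 0 (n + 1). cube_energy f (v + axis p (int j)))
        = (\<Sum>v\<in>(\<lambda>v. v + axis p (int j)) ` cube 0 (n + 1). cube_energy f v)"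
      by (subst sum.reindex) (auto simp: inj_on_def)
    also have "\<dots> \<le> E" unfolding E_def by (rule sum_cube_energy) (use inc that in auto)
    finally show ?thesis .
  qed
  have "(\<Sum>v\<in>cube 0 (n + 1). (f (core v))\<^sup>2)
      \<le> (\<Sum>v\<in>cube 0 (n + 1). real T * (\<Sum>j<T. C * (cube_energy f (v + axis p (int j)) + cube_energy f (v + axis p (int (Suc j))))))"
    by (intro sum_mono pt)
  also have "\<dots> = real T * (\<Sum>j<T. C * ((\<Sum>v\<in>cube 0 (n + 1). cube_energy f (v + axis p (int j)))
       + (\<Sum>v\<in>cube 0 (n + 1). cube_energy f (v + axis p (int (Suc j))))))"
    unfolding sum_distrib_left[symmetric] sum.distrib[symmetric] by (subst sum.swap) (simp add: sum_distrib_left)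
  also have "\<dots> \<le> real T * (\<Sum>j<T. C * (E + E))"
  proof (intro mult_left_mono sum_mono add_mono C0)
    fix j assume "j \<in> {..<T}"
    then show "(\<Sum>v\<in>cube 0 (n + 1). cube_energy f (v + axis p (int j))) \<le> E"
      "(\<Sum>v\<in>cube 0 (n + 1). cube_energy f (v + axis p (int (Suc j)))) \<le> E"
      using sh[of j] sh[of "Suc j"] by (simp_all del: of_nat_Suc)
  qed simp
  also have "\<dots> = 16 * path_bound\<^sup>2 / s * (2 * real n + 2)\<^sup>2 * (2 * K + 1) ^ CARD('d)
        * (\<Sum>b\<in>cube 0 (3 * n + 4 + K). bond_energy w f b)"
    by (simp add: C_def E_def T_def power2_eq_square add.commute)
  finally show ?thesis .
qed

definition poincare_const :: real where
  "poincare_const = (CARD('d) + 1) * 50 * path_bound\<^sup>2 * (2 * K + 1) ^ CARD('d)"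

text \<open>A non-trap \<open>x\<close> is an endpoint of a bond \<open>(u, k)\<close> above
  \<open>t\<close> with \<open>u = x\<close> or \<open>u = x - ax k\<close>, so f(x) is compared
  with the value at \<open>core u\<close>. Adding \<open>g\<close> over all d + 1 candidates for
  \<open>u\<close> makes the sum over \<open>x\<close> a sum of shifts, whence the factor d +
  1.\<close>

lemma poincare:
  assumes f: "\<And>x. x \<notin> lattice_box n \<Longrightarrow> f x = 0"
    and c: "\<And>v. v \<in> cube 0 (3 * n + 4) \<Longrightarrow> card (bonds_below w s v K) < J"
    and c': "\<And>v. v \<in> cube 0 (3 * n + 4) \<Longrightarrow> card (bonds_below w t v K) < 4 * CARD('d) - 2"
  shows "(\<Sum>x | x \<in> lattice_box n \<and> \<not> trap w t x. (f x)\<^sup>2)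
     \<le> poincare_const * ((2 * real n + 2)\<^sup>2 / s + 1 / t) * (\<Sum>x\<in>lattice_box n. f x * - rc_laplacian w f x)"
proof -
  define E where "E = (\<Sum>b\<in>cube 0 (3 * n + 4 + K). bond_energy w f b)"
  define m where "m = real ((2 * K + 1) ^ CARD('d))"
  have E: "E = (\<Sum>x\<in>lattice_box n. f x * - rc_laplacian w f x)"
    unfolding E_def by (rule energy_identity) (use f in auto)
  have E0: "0 \<le> E" unfolding E_def by (intro sum_nonneg bond_energy_nonneg)
  define g where "g = (\<lambda>v. 2 * (f (core v))\<^sup>2 + 50 * path_bound\<^sup>2 / t * cube_energy f v)"
  have g0: "0 \<le> g v" for v unfolding g_def using cube_energy_nonneg[of f v] t by simp
  have sub: "cube 0 (n + 1) \<subseteq> cube (0 :: int ^ 'd) (3 * n + 4)"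
    by (auto simp: cube_def intro: order_trans)
  have box: "x \<in> cube 0 (n + 1)" "x - ax k \<in> cube 0 (n + 1)" if "x \<in> lattice_box n" for x :: "int ^ 'd" and k
  proof -
    have "\<bar>x $ i\<bar> \<le> int n" for i using that by (simp add: lattice_box_def)
    then show "x \<in> cube 0 (n + 1)" "x - ax k \<in> cube 0 (n + 1)"
      by (auto simp: cube_def axis_nth_if abs_le_iff intro: order_trans) (smt (verit))+
  qed
  have pt: "(f x)\<^sup>2 \<le> g x + (\<Sum>k\<in>UNIV. g (x - ax k))" if x: "x \<in> lattice_box n" "\<not> trap w t x" for x
  proof -
    obtain k where "t \<le> w (bond x k) \<or> t \<le> w (bond (x - ax k) k)"
      using x(2) by (auto simp: trap_def not_less)
    then obtain u where u: "t \<le> w (bond u k)" "x = u \<or> x = u + ax k" "u = x \<or> u = x - ax k"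
      by (metis diff_add_cancel)
    have uc: "u \<in> cube 0 (3 * n + 4)" using u(3) box(1)[OF x(1)] box(2)[OF x(1), of k] sub by blast
    have "(f x)\<^sup>2 \<le> 2 * (f (core u))\<^sup>2 + 2 * (f x - f (core u))\<^sup>2"
      using sum_squares_bound[of "f (core u)" "f x - f (core u)"] by (simp add: power2_eq_square algebra_simps)
    also have "\<dots> \<le> 2 * (f (core u))\<^sup>2 + 2 * (25 * path_bound\<^sup>2 / t * cube_energy f u)"
      using near_core[OF c[OF uc] c'[OF uc] u(1,2)] by (intro add_left_mono mult_left_mono) auto
    also have "\<dots> = g u" by (simp add: g_def)
    also have "g u \<le> g x + (\<Sum>k\<in>UNIV. g (x - ax k))"
      using u(3)
    proof
      assume "u = x" then show ?thesis using g0 by (simp add: sum_nonneg)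
    next
      assume "u = x - ax k"
      then have "g u \<le> (\<Sum>k\<in>UNIV. g (x - ax k))"
        using g0 by (auto intro!: member_le_sum[of k UNIV "\<lambda>k. g (x - ax k)"])
      then show ?thesis using g0[of x] by simp
    qed
    finally show ?thesis .
  qed
  define G where "G = (\<Sum>v\<in>cube 0 (n + 1). g v)"
  have "(\<Sum>x | x \<in> lattice_box n \<and> \<not> trap w t x. (f x)\<^sup>2)
      \<le> (\<Sum>x | x \<in> lattice_box n \<and> \<not> trap w t x. g x + (\<Sum>k\<in>UNIV. g (x - ax k)))"
    using pt by (intro sum_mono) auto
  also have "\<dots> \<le> (\<Sum>x\<in>lattice_box n. g x + (\<Sum>k\<in>UNIV. g (x - ax k)))"
    using g0 by (intro sum_mono2) (auto intro!: add_nonneg_nonneg sum_nonneg simp: lattice_box_cube)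
  also have "\<dots> = (\<Sum>x\<in>lattice_box n. g x) + (\<Sum>k\<in>UNIV. \<Sum>x\<in>lattice_box n. g (x - ax k))"
    unfolding sum.distrib by (subst sum.swap) simp
  also have "\<dots> \<le> G + (\<Sum>k\<in>(UNIV :: 'd set). G)"
  proof (intro add_mono sum_mono)
    show "(\<Sum>x\<in>lattice_box n. g x) \<le> G" unfolding G_def
      using box g0 by (intro sum_mono2) auto
    fix k :: 'd
    have "(\<Sum>x\<in>lattice_box n. g (x - ax k)) = (\<Sum>x\<in>(\<lambda>x. x - ax k) ` lattice_box n. g x)"
      by (subst sum.reindex) (auto simp: inj_on_def)
    also have "\<dots> \<le> G" unfolding G_def
      using box g0 by (intro sum_mono2) auto
    finally show "(\<Sum>x\<in>lattice_box n. g (x - ax k)) \<le> G" .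
  qed
  also have "\<dots> = (CARD('d) + 1) * G" by (simp add: algebra_simps)
  also have "\<dots> \<le> (CARD('d) + 1) * (2 * (16 * path_bound\<^sup>2 / s * (2 * real n + 2)\<^sup>2 * m * E)
      + 50 * path_bound\<^sup>2 / t * (m * E))"
  proof (rule mult_left_mono)
    have "(\<Sum>v\<in>cube 0 (n + 1). cube_energy f v) \<le> m * E"
      unfolding m_def E_def of_nat_power using sum_cube_energy[of "cube 0 (n + 1)" "3 * n + 4" f] sub by simp
    then have "50 * path_bound\<^sup>2 / t * (\<Sum>v\<in>cube 0 (n + 1). cube_energy f v) \<le> 50 * path_bound\<^sup>2 / t * (m * E)"
      using t by (intro mult_left_mono) auto
    moreover have "(\<Sum>v\<in>cube 0 (n + 1). (f (core v))\<^sup>2) \<le> 16 * path_bound\<^sup>2 / s * (2 * real n + 2)\<^sup>2 * m * E"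
      unfolding m_def E_def by (rule core_mass[OF f c])
    ultimately show "G \<le> 2 * (16 * path_bound\<^sup>2 / s * (2 * real n + 2)\<^sup>2 * m * E)
      + 50 * path_bound\<^sup>2 / t * (m * E)"
      unfolding G_def g_def sum.distrib sum_distrib_left[symmetric] by linarith
  qed simp
  \<comment> \<open>The constant 32 of the core term is raised to 50 so that both terms share one
    prefactor.\<close>
  also have "\<dots> \<le> (CARD('d) + 1) * (50 * path_bound\<^sup>2 / s * (2 * real n + 2)\<^sup>2 * m * E
      + 50 * path_bound\<^sup>2 / t * (m * E))"
  proof (intro mult_left_mono add_right_mono)
    have "0 \<le> path_bound\<^sup>2 / s * (2 * real n + 2)\<^sup>2 * m * E"
      using E0 t ts by (simp add: m_def)
    then have "32 * (path_bound\<^sup>2 / s * (2 * real n + 2)\<^sup>2 * m * E) \<le> 50 * (path_bound\<^sup>2 / s * (2 * real n + 2)\<^sup>2 * m * E)"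
      by (intro mult_right_mono) auto
    moreover have e: "2 * (16 * path_bound\<^sup>2 / s * (2 * real n + 2)\<^sup>2 * m * E)
        = 32 * (path_bound\<^sup>2 / s * (2 * real n + 2)\<^sup>2 * m * E)"
      "50 * path_bound\<^sup>2 / s * (2 * real n + 2)\<^sup>2 * m * E
        = 50 * (path_bound\<^sup>2 / s * (2 * real n + 2)\<^sup>2 * m * E)" by (simp_all add: mult_ac)
    ultimately show "2 * (16 * path_bound\<^sup>2 / s * (2 * real n + 2)\<^sup>2 * m * E) \<le> 50 * path_bound\<^sup>2 / s * (2 * real n + 2)\<^sup>2 * m * E"
      unfolding e by simp
  qed simp
  also have "\<dots> = poincare_const * ((2 * real n + 2)\<^sup>2 / s + 1 / t) * E"
    by (simp add: poincare_const_def m_def algebra_simps add_divide_distrib)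
  finally show ?thesis unfolding E .
qed

end

section \<open>Orthonormal expansions and order statistics\<close>

text \<open>Gaussian elimination, one equation at a time. It supplies both a linear dependence among
  too many functions and a trial function orthogonal to given eigenvectors.\<close>

lemma underdetermined_solution:
  fixes a :: "'t \<Rightarrow> 's \<Rightarrow> real"
  assumes "finite T" "finite S" "card T < card S"
  shows "\<exists>c. (\<exists>s\<in>S. c s \<noteq> 0) \<and> (\<forall>t\<in>T. (\<Sum>s\<in>S. c s * a t s) = 0)"
  using assms
proof (induction T arbitrary: S a rule: finite_induct)
  case empty
  then obtain s where "s \<in> S" by (metis card_gt_0_iff card.empty equals0I)
  then show ?case by (intro exI[of _ "\<lambda>_. 1"]) auto
next
  case (insert t T)
  show ?case
  proof (cases "\<forall>s\<in>S. a t s = 0")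
    case True
    have "card T < card S" using insert by simp
    from insert.IH[OF insert.prems(1) this] obtain c where
      c: "\<exists>s\<in>S. c s \<noteq> 0" "\<forall>t\<in>T. (\<Sum>s\<in>S. c s * a t s) = 0" by blast
    then show ?thesis using True by (intro exI[of _ c]) auto
  next
    case False
    then obtain s0 where s0: "s0 \<in> S" "a t s0 \<noteq> 0" by blast
    define b where "b = (\<lambda>u s. a u s - a t s / a t s0 * a u s0)"
    have "card T < card (S - {s0})" using insert s0 by simp
    from insert.IH[OF _ this, of b] insert.prems(1) obtain c where
      c: "\<exists>s\<in>S-{s0}. c s \<noteq> 0" "\<forall>u\<in>T. (\<Sum>s\<in>S-{s0}. c s * b u s) = 0" by auto
    define r where "r = - (\<Sum>s\<in>S-{s0}. c s * a t s) / a t s0"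
    define c' where "c' = c(s0 := r)"
    have sp: "(\<Sum>s\<in>S. c' s * a u s) = r * a u s0 + (\<Sum>s\<in>S-{s0}. c s * a u s)" for u
    proof -
      have "(\<Sum>s\<in>S. c' s * a u s) = c' s0 * a u s0 + (\<Sum>s\<in>S-{s0}. c' s * a u s)"
        using s0 insert.prems by (simp add: sum.remove)
      also have "(\<Sum>s\<in>S-{s0}. c' s * a u s) = (\<Sum>s\<in>S-{s0}. c s * a u s)"
        by (intro sum.cong) (auto simp: c'_def)
      finally show ?thesis by (simp add: c'_def)
    qed
    have "(\<Sum>s\<in>S. c' s * a t s) = 0" unfolding sp using s0 by (simp add: r_def)
    moreover have "(\<Sum>s\<in>S. c' s * a u s) = 0" if "u \<in> T" for u
    proof -
      have "0 = (\<Sum>s\<in>S-{s0}. c s * b u s)" using c(2) that by simp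
      also have "\<dots> = (\<Sum>s\<in>S-{s0}. c s * a u s - (a u s0 / a t s0) * (c s * a t s))"
        by (intro sum.cong) (auto simp: b_def algebra_simps)
      also have "\<dots> = (\<Sum>s\<in>S-{s0}. c s * a u s) - (a u s0 / a t s0) * (\<Sum>s\<in>S-{s0}. c s * a t s)"
        unfolding sum_subtractf sum_distrib_left ..
      also have "\<dots> = (\<Sum>s\<in>S. c' s * a u s)" unfolding sp by (simp add: r_def)
      finally show ?thesis by simp
    qed
    moreover have "\<exists>s\<in>S. c' s \<noteq> 0" using c(1) by (auto simp: c'_def)
    ultimately show ?thesis by (intro exI[of _ c']) auto
  qed
qed

text \<open>Completeness by counting: a nonzero residual would give card B + 1 nonzero, pairwise
  orthogonal functions on a set of card B points. These are linearly dependent, and pairing the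
  relation with each of them kills every coefficient.\<close>

lemma orthonormal_expansion:
  fixes \<psi> :: "nat \<Rightarrow> 'x \<Rightarrow> real"
  assumes B: "finite B"
    and on: "\<And>i j. i \<in> {1..card B} \<Longrightarrow> j \<in> {1..card B} \<Longrightarrow> (\<Sum>x\<in>B. \<psi> i x * \<psi> j x) = (if i = j then 1 else 0)"
    and x: "x \<in> B"
  shows "g x = (\<Sum>i\<in>{1..card B}. (\<Sum>y\<in>B. g y * \<psi> i y) * \<psi> i x)"
proof (rule ccontr)
  assume neq: "g x \<noteq> (\<Sum>i\<in>{1..card B}. (\<Sum>y\<in>B. g y * \<psi> i y) * \<psi> i x)"
  define I where "I = {1..card B}"
  define a where "a = (\<lambda>i. \<Sum>y\<in>B. g y * \<psi> i y)"
  define r where "r = (\<lambda>x. g x - (\<Sum>i\<in>I. a i * \<psi> i x))"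
  have rx: "r x \<noteq> 0" using neq by (simp add: r_def I_def a_def)
  have r_orth: "(\<Sum>y\<in>B. r y * \<psi> j y) = 0" if j: "j \<in> I" for j
  proof -
    have "(\<Sum>y\<in>B. r y * \<psi> j y) = a j - (\<Sum>y\<in>B. \<Sum>i\<in>I. a i * (\<psi> i y * \<psi> j y))"
      by (simp add: r_def a_def left_diff_distrib sum_subtractf sum_distrib_right mult.assoc)
    also have "(\<Sum>y\<in>B. \<Sum>i\<in>I. a i * (\<psi> i y * \<psi> j y)) = (\<Sum>i\<in>I. a i * (\<Sum>y\<in>B. \<psi> i y * \<psi> j y))"
      unfolding sum_distrib_left by (rule sum.swap)
    also have "\<dots> = (\<Sum>i\<in>I. if i = j then a i else 0)"
      using on j by (intro sum.cong) (auto simp: I_def)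
    also have "\<dots> = a j" using j by (simp add: I_def)
    finally show ?thesis by simp
  qed
  \<comment> \<open>Eigenvectors are numbered from 1, so index 0 is free for the residual.\<close>
  define \<phi> where "\<phi> = (\<lambda>i. if i = 0 then r else \<psi> i)"
  have "card B < card {0..card B}" by simp
  from underdetermined_solution[OF B _ this, of "\<lambda>y i. \<phi> i y"] obtain c where
    c: "\<exists>i\<in>{0..card B}. c i \<noteq> 0" "\<And>y. y \<in> B \<Longrightarrow> (\<Sum>i\<in>{0..card B}. c i * \<phi> i y) = 0" by auto
  have \<phi>_orth: "(\<Sum>y\<in>B. \<phi> i y * \<phi> j y) = 0" if "i \<in> {0..card B}" "j \<in> {0..card B}" "i \<noteq> j" for i j
    using r_orth[of i] r_orth[of j] on[of i j] that
    by (auto simp: \<phi>_def I_def mult.commute)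
  have \<phi>_pos: "(\<Sum>y\<in>B. \<phi> j y * \<phi> j y) \<noteq> 0" if "j \<in> {0..card B}" for j
  proof (cases "j = 0")
    case True
    have "(\<Sum>y\<in>B. r y * r y) \<ge> r x * r x" using x B by (intro member_le_sum) auto
    moreover have "r x * r x > 0" using rx by (metis not_real_square_gt_zero)
    ultimately show ?thesis using True by (simp add: \<phi>_def)
  next
    case False then show ?thesis using on[of j j] that by (simp add: \<phi>_def)
  qed
  have "c j = 0" if j: "j \<in> {0..card B}" for j
  proof -
    have "0 = (\<Sum>y\<in>B. (\<Sum>i\<in>{0..card B}. c i * \<phi> i y) * \<phi> j y)" using c(2) by simp
    also have "\<dots> = (\<Sum>i\<in>{0..card B}. c i * (\<Sum>y\<in>B. \<phi> i y * \<phi> j y))"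
      unfolding sum_distrib_left sum_distrib_right by (subst sum.swap) (simp add: mult.assoc)
    also have "\<dots> = (\<Sum>i\<in>{0..card B}. if i = j then c j * (\<Sum>y\<in>B. \<phi> j y * \<phi> j y) else 0)"
      using \<phi>_orth j by (intro sum.cong) auto
    also have "\<dots> = c j * (\<Sum>y\<in>B. \<phi> j y * \<phi> j y)" using j by simp
    finally show "c j = 0" using \<phi>_pos[OF j] by simp
  qed
  then show False using c(1) by blast
qed

lemma orthonormal_parseval:
  fixes \<psi> :: "nat \<Rightarrow> 'x \<Rightarrow> real"
  assumes B: "finite B"
    and on: "\<And>i j. i \<in> {1..card B} \<Longrightarrow> j \<in> {1..card B} \<Longrightarrow> (\<Sum>x\<in>B. \<psi> i x * \<psi> j x) = (if i = j then 1 else 0)"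
  shows "(\<Sum>x\<in>B. f x * g x) = (\<Sum>i\<in>{1..card B}. (\<Sum>y\<in>B. f y * \<psi> i y) * (\<Sum>y\<in>B. g y * \<psi> i y))"
proof -
  have "(\<Sum>x\<in>B. f x * g x) = (\<Sum>x\<in>B. f x * (\<Sum>i\<in>{1..card B}. (\<Sum>y\<in>B. g y * \<psi> i y) * \<psi> i x))"
    using orthonormal_expansion[OF B on] by (intro sum.cong) auto
  also have "\<dots> = (\<Sum>x\<in>B. \<Sum>i\<in>{1..card B}. (\<Sum>y\<in>B. g y * \<psi> i y) * (f x * \<psi> i x))"
    unfolding sum_distrib_left by (simp add: mult_ac)
  also have "\<dots> = (\<Sum>i\<in>{1..card B}. (\<Sum>y\<in>B. g y * \<psi> i y) * (\<Sum>x\<in>B. f x * \<psi> i x))"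
    unfolding sum_distrib_left by (rule sum.swap)
  finally show ?thesis by (simp add: mult_ac)
qed

lemma rc_laplacian_local:
  "- rc_laplacian w f x = local_speed w x * f x - (\<Sum>y | y \<sim>\<^sub>l x. w {x, y} * f y)"
proof -
  have "local_speed w x = (\<Sum>y | y \<sim>\<^sub>l x. w {x, y})"
    unfolding local_speed_def by (simp add: insert_commute)
  then show ?thesis
    unfolding rc_laplacian_def by (simp add: right_diff_distrib sum_subtractf sum_distrib_right)
qed

text \<open>One enumeration of the box by increasing speed, ties broken arbitrarily, turns ranks
  into list positions; rank \<open>i\<close> is position \<open>i - 1\<close>.\<close>

definition speed_list :: "((int ^ 'd) set \<Rightarrow> real) \<Rightarrow> nat \<Rightarrow> (int ^ 'd) list \<Rightarrow> bool" where
  "speed_list w n zs \<longleftrightarrow> distinct zs \<and> set zs = lattice_box n \<and> sorted (map (local_speed w) zs) \<and>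
     (\<forall>i. 1 \<le> i \<and> i \<le> card (lattice_box n :: (int ^ 'd) set) \<longrightarrow>
       speed_order_stat w n i = local_speed w (zs ! (i - 1)))"

lemma speed_list_exists:
  fixes w :: "(int ^ 'd) set \<Rightarrow> real"
  shows "\<exists>zs. speed_list w n zs"
proof -
  let ?B = "lattice_box n :: (int ^ 'd) set"
  have fin: "finite ?B" by (simp add: lattice_box_cube)
  obtain xs where xs: "set xs = ?B" "distinct xs" using finite_distinct_list[OF fin] by blast
  define zs where "zs = sort_key (local_speed w) xs"
  have d: "distinct zs" "set zs = ?B" using xs by (auto simp: zs_def)
  have l: "length zs = card ?B" using d distinct_card by fastforce
  have so: "sorted (map (local_speed w) zs)" by (simp add: zs_def)
  have "mset zs = mset_set ?B" using d by (metis mset_set_set)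
  then have "image_mset (local_speed w) (mset_set ?B) = mset (map (local_speed w) zs)" by simp
  then have "sorted_list_of_multiset (image_mset (local_speed w) (mset_set ?B)) = sort (map (local_speed w) zs)"
    by (simp only: sorted_list_of_multiset_mset)
  also have "\<dots> = map (local_speed w) zs" using so by (simp add: sorted_sort_id)
  finally have e: "sorted_list_of_multiset (image_mset (local_speed w) (mset_set ?B)) = map (local_speed w) zs" .
  show ?thesis unfolding speed_list_def
    using d so l by (intro exI[of _ zs]) (auto simp: speed_order_stat_def e)
qed

section \<open>Localization in a fixed configuration\<close>

lemma rc_laplacian_self_adjoint:
  fixes f g :: "int ^ 'd \<Rightarrow> real"
  assumes "\<And>x. x \<notin> lattice_box n \<Longrightarrow> f x = 0" "\<And>x. x \<notin> lattice_box n \<Longrightarrow> g x = 0"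
  shows "(\<Sum>x\<in>lattice_box n. (- rc_laplacian w f x) * g x) = (\<Sum>x\<in>lattice_box n. f x * (- rc_laplacian w g x))"
proof -
  let ?B = "lattice_box n :: (int ^ 'd) set"
  have fin: "finite ?B" by (simp add: lattice_box_cube)
  have e: "(\<Sum>y | y \<sim>\<^sub>l x. w {x, y} * h y) = (\<Sum>y | y \<in> ?B \<and> x \<sim>\<^sub>l y. w {x, y} * h y)"
    if "\<And>x. x \<notin> ?B \<Longrightarrow> h x = 0" for h x
  proof -
    have "(\<Sum>y | y \<sim>\<^sub>l x. w {x, y} * h y) = (\<Sum>y | y \<sim>\<^sub>l x \<and> y \<in> ?B. w {x, y} * h y)"
      using that by (intro sum.mono_neutral_right) auto
    also have "\<dots> = (\<Sum>y | y \<in> ?B \<and> x \<sim>\<^sub>l y. w {x, y} * h y)"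
      by (intro sum.cong) (auto simp: nearest_neighbour_sym)
    finally show ?thesis .
  qed
  have "(\<Sum>x\<in>?B. \<Sum>y | y \<in> ?B \<and> x \<sim>\<^sub>l y. w {x, y} * f y * g x)
      = (\<Sum>y\<in>?B. \<Sum>x | x \<in> ?B \<and> x \<sim>\<^sub>l y. w {x, y} * f y * g x)"
    by (rule sum.swap_restrict[OF fin fin])
  also have "\<dots> = (\<Sum>x\<in>?B. \<Sum>y | y \<in> ?B \<and> x \<sim>\<^sub>l y. w {x, y} * g y * f x)"
    by (intro sum.cong) (auto simp: nearest_neighbour_sym insert_commute mult_ac)
  finally have sw: "(\<Sum>x\<in>?B. (\<Sum>y | y \<in> ?B \<and> x \<sim>\<^sub>l y. w {x, y} * f y) * g x)
      = (\<Sum>x\<in>?B. (\<Sum>y | y \<in> ?B \<and> x \<sim>\<^sub>l y. w {x, y} * g y) * f x)"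
    by (simp add: sum_distrib_right)
  have lap: "- rc_laplacian w h x = local_speed w x * h x - (\<Sum>y | y \<in> ?B \<and> x \<sim>\<^sub>l y. w {x, y} * h y)"
    if "\<And>x. x \<notin> ?B \<Longrightarrow> h x = 0" for h x
    unfolding rc_laplacian_local using e[of h, OF that] by simp
  note lapf = lap[of f, OF assms(1), simplified] and lapg = lap[of g, OF assms(2), simplified]
  show ?thesis
    unfolding lapf lapg
    using sw by (simp add: left_diff_distrib right_diff_distrib sum_subtractf mult_ac)
qed

text \<open>The deterministic input about one configuration in one box. The condition
  \<open>gaps\<close> is restricted to non-adjacent sites because only their speeds are independent;
  adjacent pairs are recovered from \<open>few_t\<close>.\<close>

locale box_eigen = lattice_geometry w s t J K p q
  for w :: "(int ^ 'd) set \<Rightarrow> real" and s t :: real and J K :: nat and p q :: 'd +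
  fixes n k :: nat and lam :: "nat \<Rightarrow> real" and psi :: "nat \<Rightarrow> int ^ 'd \<Rightarrow> real" and L \<eta> \<nu> :: real
  assumes eig: "dirichlet_eigensystem w n lam psi"
    and few_s: "\<And>v. v \<in> cube 0 (3 * n + 4) \<Longrightarrow> card (bonds_below w s v K) < J"
    and few_t: "\<And>v. v \<in> cube 0 (3 * n + 4) \<Longrightarrow> card (bonds_below w t v K) < 3 * CARD('d)"
    and k1: "1 \<le> k" and kB: "k \<le> card (lattice_box n :: (int ^ 'd) set)"
    and kL: "speed_order_stat w n k \<le> L" and Lt: "6 * L < t"
    and eta: "0 < \<eta>" "\<eta> \<le> 1 / 2"
    and gaps: "\<And>x y. x \<in> lattice_box n \<Longrightarrow> y \<in> lattice_box n \<Longrightarrow> x \<noteq> y \<Longrightarrow> \<not> x \<sim>\<^sub>l y \<Longrightarrow>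
       local_speed w x \<le> 2 * L \<Longrightarrow> local_speed w x \<le> local_speed w y \<Longrightarrow>
       (1 + 4 * \<eta>) * local_speed w x < local_speed w y"
    and nu: "poincare_const * ((2 * real n + 2)\<^sup>2 / s + 1 / t) * L * (1 + 2 * CARD('d) / \<eta>\<^sup>2) \<le> \<nu>"
    and nu_half: "\<nu> < 1 / 2"
begin

abbreviation B :: "(int ^ 'd) set" where "B \<equiv> lattice_box n"
abbreviation \<pi> :: "int ^ 'd \<Rightarrow> real" where "\<pi> \<equiv> local_speed w"
abbreviation stat :: "nat \<Rightarrow> real" where "stat \<equiv> speed_order_stat w n"

definition mu :: real where "mu = poincare_const * ((2 * real n + 2)\<^sup>2 / s + 1 / t) * L"

lemma finB [simp]: "finite B"
  by (simp add: lattice_box_cube)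

lemma box_sub: "x \<in> B \<Longrightarrow> x \<in> cube 0 (3 * n + 4)"
  by (auto simp: lattice_box_cube cube_def intro: order_trans)

lemma psi_supp: "i \<in> {1..card B} \<Longrightarrow> x \<notin> B \<Longrightarrow> psi i x = 0"
  and psi_eq: "i \<in> {1..card B} \<Longrightarrow> x \<in> B \<Longrightarrow> - rc_laplacian w (psi i) x = lam i * psi i x"
  and psi_orth: "i \<in> {1..card B} \<Longrightarrow> j \<in> {1..card B} \<Longrightarrow> (\<Sum>x\<in>B. psi i x * psi j x) = (if i = j then 1 else 0)"
  and lam_mono: "i \<in> {1..card B} \<Longrightarrow> j \<in> {1..card B} \<Longrightarrow> i \<le> j \<Longrightarrow> lam i \<le> lam j"
  and psi_sign: "i \<in> {1..card B} \<Longrightarrow> 0 \<le> psi i (speed_site w n i)"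
  using eig unfolding dirichlet_eigensystem_def Let_def by (auto simp: mono_on_def)

lemma speed_pos: "0 < \<pi> x"
  unfolding local_speed_bonds by (intro add_pos_pos sum_pos) (auto simp: pos)

lemma bond_le_speed: "y \<sim>\<^sub>l x \<Longrightarrow> 0 < w {x, y} \<and> w {x, y} \<le> \<pi> x"
proof -
  assume y: "y \<sim>\<^sub>l x"
  have p: "0 < w {z, x}" if "z \<sim>\<^sub>l x" for z
  proof -
    have "{z, x} \<in> lattice_edges" using that by (auto simp: lattice_edges_def)
    then show ?thesis unfolding lattice_edges_bonds using pos by auto
  qed
  have "w {y, x} \<le> \<pi> x" unfolding local_speed_def
    using y p by (intro member_le_sum[where f = "\<lambda>y. w {y, x}"]) (auto intro: less_imp_le)
  then show ?thesis using p[OF y] by (simp add: insert_commute)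
qed

lemma small_speed_trap: "\<pi> x < t \<Longrightarrow> trap w t x"
proof -
  assume "\<pi> x < t"
  moreover have "w (bond x k) \<le> \<pi> x" for k
    using bond_le_speed[of "x + ax k" x] nearest_neighbour_iff[of "x + ax k" x] by (auto simp: bond_def)
  moreover have "w (bond (x - ax k) k) \<le> \<pi> x" for k
    using bond_le_speed[of "x - ax k" x] nearest_neighbour_iff[of "x - ax k" x]
    by (auto simp: bond_def insert_commute)
  ultimately show ?thesis unfolding trap_def by (meson le_less_trans)
qed

text \<open>Of the 4d - 1 bonds at two adjacent traps, 3d already contradict \<open>few_t\<close>:
  the forward and backward bonds of \<open>x\<close> and the forward bonds of
  \<open>x + ax i\<close>.\<close>

lemma trap_pair:
  assumes x: "x \<in> cube 0 (3 * n + 4)" and tr: "trap w t x" "trap w t (x + ax i)"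
  shows False
proof -
  define A where "A = range (\<lambda>k. (x, k)) \<union> range (\<lambda>k. (x - ax k, k)) \<union> range (\<lambda>k. (x + ax i, k))"
  have "x - ax k \<noteq> x + ax i" for k
    using ax_neq_minus_ax[of i k] by (metis add_diff_cancel_left' diff_add_cancel diff_conv_add_uminus)
  then have "card A = 3 * CARD('d)"
    unfolding A_def
    by (subst card_Un_disjoint, simp, simp, force simp: ax_nonzero, subst card_Un_disjoint)
       (auto simp: card_image inj_on_def ax_nonzero)
  moreover have "A \<subseteq> bonds_below w t x K"
    using tr K J unfolding A_def bonds_below_def trap_def by (auto simp: cube_def axis_nth_if)
  then have "card A \<le> card (bonds_below w t x K)" by (intro card_mono) auto
  ultimately show False using few_t[OF x] by simp
qed

lemma trap_isolated:
  assumes "x \<in> B" "y \<in> B" "trap w t x" "x \<sim>\<^sub>l y"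
  shows "\<not> trap w t y"
proof
  assume y: "trap w t y"
  obtain i where "y = x + ax i \<or> y = x - ax i" using assms(4) unfolding nearest_neighbour_iff by blast
  then have "y = x + ax i \<or> x = y + ax i" by auto
  then show False using trap_pair[of x i] trap_pair[of y i] assms y box_sub by auto
qed

text \<open>For adjacent sites, \<open>x\<close> is a trap, so \<open>y\<close> is not and has speed
  at least \<open>t\<close>, while (1 + 4 \<open>\<eta>\<close>) times the speed of \<open>x\<close>
  is at most 3 * 2L < t.\<close>

lemma gaps': "x \<in> B \<Longrightarrow> y \<in> B \<Longrightarrow> x \<noteq> y \<Longrightarrow> \<pi> x \<le> 2 * L \<Longrightarrow> \<pi> x \<le> \<pi> y \<Longrightarrow> (1 + 4 * \<eta>) * \<pi> x < \<pi> y"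
proof (cases "x \<sim>\<^sub>l y")
  case True
  assume a: "x \<in> B" "y \<in> B" "\<pi> x \<le> 2 * L"
  have "\<pi> x < t" using a Lt speed_pos[of x] by linarith
  then have "\<not> trap w t y" using trap_isolated[OF a(1,2) _ True] small_speed_trap by blast
  then have "t \<le> \<pi> y" using small_speed_trap by force
  moreover have "(1 + 4 * \<eta>) * \<pi> x \<le> 3 * \<pi> x"
    using eta speed_pos[of x] by (intro mult_right_mono) auto
  ultimately show ?thesis using a Lt by linarith
qed (use gaps in blast)

lemma poincare_const_nonneg: "0 \<le> poincare_const"
  by (simp add: poincare_const_def)

lemma L_pos: "0 < L"
proof -
  obtain zs where "speed_list w n zs" using speed_list_exists by blast
  then show ?thesis using kL speed_pos k1 kB unfolding speed_list_def by (smt (verit))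
qed

lemma mu_nonneg: "0 \<le> mu"
  unfolding mu_def using L_pos t ts poincare_const_nonneg by simp

lemma mu_nu: "mu + 2 * CARD('d) * mu / \<eta>\<^sup>2 \<le> \<nu>"
  using nu unfolding mu_def[symmetric] by (simp add: distrib_left mult_ac)

text \<open>With \<open>i\<close> free coefficients on the \<open>i\<close> slowest sites, a nonzero
  trial function orthogonal to the first \<open>i - 1\<close> eigenvectors exists. Parseval bounds
  its Rayleigh quotient below by \<open>lam i\<close>; above it is at most \<open>stat i\<close>,
  since the energy is diagonal on pairwise non-adjacent sites.\<close>

lemma eigenvalue_upper:
  assumes zs: "speed_list w n zs" and i: "i \<in> {1..k}"
  shows "lam i \<le> stat i"
proof -
  define Z where "Z = set (take i zs)"
  have d: "distinct zs" and setz: "set zs = B" and so: "sorted (map \<pi> zs)"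
    and st: "\<And>j. 1 \<le> j \<Longrightarrow> j \<le> card B \<Longrightarrow> stat j = \<pi> (zs ! (j - 1))"
    using zs by (auto simp: speed_list_def)
  have len: "length zs = card B" using d setz distinct_card by fastforce
  have i': "1 \<le> i" "i \<le> k" "i \<le> card B" using i kB by auto
  have Zc: "card Z = i" unfolding Z_def using d i' len by (simp add: distinct_card)
  have ZB: "Z \<subseteq> B" unfolding Z_def setz[symmetric] by (rule set_take_subset)
  have Zpi: "\<pi> x \<le> stat i" if xZ: "x \<in> Z" for x
  proof -
    obtain j where j: "j < i" "x = zs ! j" using xZ i' len by (fastforce simp: Z_def in_set_conv_nth)
    have "map \<pi> zs ! j \<le> map \<pi> zs ! (i - 1)" using j i' len so by (intro sorted_nth_mono) auto
    then show ?thesis using j i' len st by simp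
  qed
  have "map \<pi> zs ! (i - 1) \<le> map \<pi> zs ! (k - 1)" using i' kB k1 len so by (intro sorted_nth_mono) auto
  then have "stat i \<le> L" using kL i' k1 kB len st by simp
  then have Ztr: "trap w t x" if "x \<in> Z" for x
    using Zpi[OF that] L_pos Lt by (intro small_speed_trap) linarith
  have "card {1..<i} < card Z" using Zc i' by simp
  from underdetermined_solution[OF _ _ this, of "psi"] obtain c where
    c0: "\<exists>x\<in>Z. c x \<noteq> 0" "\<forall>l\<in>{1..<i}. (\<Sum>x\<in>Z. c x * psi l x) = 0"
    unfolding Z_def by blast
  note c = c0(1) c0(2)[rule_format]
  define g where "g = (\<lambda>x. if x \<in> Z then c x else 0)"
  have restr: "(\<Sum>x\<in>B. g x * h x) = (\<Sum>x\<in>Z. c x * h x)" for h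
    using ZB by (subst sum.mono_neutral_right[of B Z]) (auto simp: g_def)
  have gsupp: "x \<notin> B \<Longrightarrow> g x = 0" for x using ZB by (auto simp: g_def)
  define a where "a = (\<lambda>l. \<Sum>y\<in>B. g y * psi l y)"
  have a0: "a l = 0" if "l \<in> {1..<i}" for l unfolding a_def restr using c(2) that by simp
  have norm: "(\<Sum>x\<in>B. g x * g x) = (\<Sum>l\<in>{1..card B}. a l * a l)"
    unfolding a_def by (rule orthonormal_parseval[OF finB psi_orth])
  have "(\<Sum>x\<in>B. g x * - rc_laplacian w g x)
      = (\<Sum>l\<in>{1..card B}. a l * (\<Sum>y\<in>B. (- rc_laplacian w g y) * psi l y))"
    unfolding a_def by (rule orthonormal_parseval[OF finB psi_orth])
  also have "\<dots> = (\<Sum>l\<in>{1..card B}. lam l * (a l * a l))"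
  proof (intro sum.cong refl)
    fix l assume l: "l \<in> {1..card B}"
    have "(\<Sum>y\<in>B. (- rc_laplacian w g y) * psi l y) = (\<Sum>y\<in>B. g y * - rc_laplacian w (psi l) y)"
      by (rule rc_laplacian_self_adjoint) (use gsupp psi_supp[OF l] in auto)
    also have "\<dots> = lam l * a l"
      using psi_eq[OF l] by (simp add: a_def sum_distrib_left mult_ac)
    finally show "a l * (\<Sum>y\<in>B. (- rc_laplacian w g y) * psi l y) = lam l * (a l * a l)" by simp
  qed
  also have "\<dots> \<ge> (\<Sum>l\<in>{1..card B}. lam i * (a l * a l))"
  proof (rule sum_mono)
    fix l assume l: "l \<in> {1..card B}"
    show "lam i * (a l * a l) \<le> lam l * (a l * a l)"
    proof (cases "l < i")
      case True then show ?thesis using a0[of l] l by simp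
    next
      case False
      then have "lam i \<le> lam l" using l i' by (intro lam_mono) auto
      then show ?thesis by (intro mult_right_mono) auto
    qed
  qed
  finally have lower: "lam i * (\<Sum>x\<in>B. g x * g x) \<le> (\<Sum>x\<in>B. g x * - rc_laplacian w g x)"
    unfolding norm sum_distrib_left .
  have "(\<Sum>x\<in>B. g x * - rc_laplacian w g x) = (\<Sum>x\<in>Z. c x * - rc_laplacian w g x)"
    by (rule restr)
  also have "\<dots> = (\<Sum>x\<in>Z. \<pi> x * (c x * c x))"
  proof (intro sum.cong refl)
    fix x assume x: "x \<in> Z"
    have "g y = 0" if "y \<sim>\<^sub>l x" for y
      using trap_isolated[of x y] x ZB Ztr that nearest_neighbour_sym[of x y] unfolding g_def by auto
    then have "(\<Sum>y | y \<sim>\<^sub>l x. w {x, y} * g y) = 0" by simp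
    then show "c x * - rc_laplacian w g x = \<pi> x * (c x * c x)"
      unfolding rc_laplacian_local using x by (simp add: g_def)
  qed
  also have "\<dots> \<le> (\<Sum>x\<in>Z. stat i * (c x * c x))"
    using Zpi by (intro sum_mono mult_right_mono) auto
  also have "\<dots> = stat i * (\<Sum>x\<in>B. g x * g x)"
    unfolding restr using ZB by (simp add: sum_distrib_left g_def)
  finally have "lam i * (\<Sum>x\<in>B. g x * g x) \<le> stat i * (\<Sum>x\<in>B. g x * g x)" using lower by simp
  moreover have "(\<Sum>x\<in>B. g x * g x) > 0"
  proof -
    obtain x where x: "x \<in> Z" "c x \<noteq> 0" using c(1) by blast
    then have "0 < g x * g x" by (auto simp: g_def) (metis not_real_square_gt_zero)
    also have "\<dots> \<le> (\<Sum>x\<in>B. g x * g x)" using x ZB by (intro member_le_sum) auto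
    finally show ?thesis .
  qed
  ultimately show ?thesis by simp
qed


lemma stat_mono: "1 \<le> i \<Longrightarrow> i \<le> j \<Longrightarrow> j \<le> card B \<Longrightarrow> stat i \<le> stat j"
proof -
  assume ij: "1 \<le> i" "i \<le> j" "j \<le> card B"
  obtain zs where zs: "speed_list w n zs" using speed_list_exists by blast
  then have "length zs = card B" using distinct_card by (fastforce simp: speed_list_def)
  moreover have "map \<pi> zs ! (i - 1) \<le> map \<pi> zs ! (j - 1)"
    using zs ij calculation by (intro sorted_nth_mono) (auto simp: speed_list_def)
  ultimately show ?thesis using zs ij by (simp add: speed_list_def)
qed

lemma lam_le_stat: "i \<in> {1..k} \<Longrightarrow> lam i \<le> stat i"
  using eigenvalue_upper speed_list_exists by blast

lemma lam_le_L: "i \<in> {1..k} \<Longrightarrow> lam i \<le> L"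
  using lam_le_stat[of i] stat_mono[of i k] kL kB by auto

lemma psi_norm: "i \<in> {1..k} \<Longrightarrow> (\<Sum>x\<in>B. (psi i x)\<^sup>2) = 1"
  using psi_orth[of i i] kB by (simp add: power2_eq_square)

lemma mass_off_traps:
  assumes i: "i \<in> {1..k}"
  shows "(\<Sum>x | x \<in> B \<and> \<not> trap w t x. (psi i x)\<^sup>2) \<le> mu"
proof -
  have i': "i \<in> {1..card B}" using i kB by auto
  define C where "C = poincare_const * ((2 * real n + 2)\<^sup>2 / s + 1 / t)"
  have C0: "0 \<le> C" using poincare_const_nonneg t ts by (simp add: C_def)
  \<comment> \<open>With d >= 2, fewer than 3d bonds below \<open>t\<close> is also fewer than 4d -
    2, as the rays require.\<close>
  have two: "2 \<le> CARD('d)"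
  proof -
    have "card {p, q} \<le> CARD('d)" by (intro card_mono) auto
    then show ?thesis using pq by simp
  qed
  have "(\<Sum>x | x \<in> B \<and> \<not> trap w t x. (psi i x)\<^sup>2)
      \<le> C * (\<Sum>x\<in>B. psi i x * - rc_laplacian w (psi i) x)"
    unfolding C_def
  proof (rule poincare)
    fix v assume "v \<in> cube (0 :: int ^ 'd) (3 * n + 4)"
    then show "card (bonds_below w t v K) < 4 * CARD('d) - 2"
      using few_t[of v] two by linarith
  qed (use few_s psi_supp[OF i'] in auto)
  also have "(\<Sum>x\<in>B. psi i x * - rc_laplacian w (psi i) x) = lam i * (\<Sum>x\<in>B. (psi i x)\<^sup>2)"
    using psi_eq[OF i'] by (simp add: sum_distrib_left power2_eq_square mult_ac)
  also have "\<dots> = lam i" using psi_norm[OF i] by simp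
  also have "C * lam i \<le> C * L" using lam_le_L[OF i] C0 by (intro mult_left_mono)
  finally show ?thesis by (simp add: C_def mu_def)
qed

text \<open>Cauchy-Schwarz in the eigenvalue equation at \<open>x\<close>. The squared conductances
  at \<open>x\<close> sum to at most the squared speed, so the estimate is relative and does not
  degrade when the speed is tiny.\<close>

lemma local_eigen_bound:
  assumes i: "i \<in> {1..k}" and x: "x \<in> B"
  shows "((\<pi> x - lam i) * psi i x)\<^sup>2 \<le> (\<pi> x)\<^sup>2 * (\<Sum>y | y \<sim>\<^sub>l x. (psi i y)\<^sup>2)"
proof -
  have i': "i \<in> {1..card B}" using i kB by auto
  have "(\<pi> x - lam i) * psi i x = (\<Sum>y | y \<sim>\<^sub>l x. w {x, y} * psi i y)"
    using psi_eq[OF i' x] unfolding rc_laplacian_local by (simp add: algebra_simps)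
  then have "((\<pi> x - lam i) * psi i x)\<^sup>2 \<le> (\<Sum>y | y \<sim>\<^sub>l x. (w {x, y})\<^sup>2) * (\<Sum>y | y \<sim>\<^sub>l x. (psi i y)\<^sup>2)"
    by (simp only: Cauchy_Schwarz_ineq_sum)
  also have "\<dots> \<le> (\<pi> x)\<^sup>2 * (\<Sum>y | y \<sim>\<^sub>l x. (psi i y)\<^sup>2)"
  proof (intro mult_right_mono sum_nonneg)
    have "(\<Sum>y | y \<sim>\<^sub>l x. (w {x, y})\<^sup>2) \<le> (\<Sum>y | y \<sim>\<^sub>l x. w {x, y} * \<pi> x)"
      unfolding power2_eq_square
      by (intro sum_mono mult_left_mono) (auto dest!: bond_le_speed)
    also have "\<dots> = (\<pi> x)\<^sup>2"
      by (simp add: local_speed_def sum_distrib_right power2_eq_square insert_commute)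
    finally show "(\<Sum>y | y \<sim>\<^sub>l x. (w {x, y})\<^sup>2) \<le> (\<pi> x)\<^sup>2" .
  qed simp
  finally show ?thesis .
qed

section \<open>Concentration of each eigenfunction on one slow site\<close>

definition near :: "nat \<Rightarrow> int ^ 'd \<Rightarrow> bool" where
  "near i x \<longleftrightarrow> x \<in> B \<and> trap w t x \<and> \<bar>\<pi> x - lam i\<bar> < \<eta> * \<pi> x"

text \<open>A neighbour of a trap is either outside the box, where \<open>psi i\<close> vanishes, or
  not a trap.\<close>

lemma neighbour_mass:
  assumes i: "i \<in> {1..k}" and x: "x \<in> B" "trap w t x"
  shows "(\<Sum>y | y \<sim>\<^sub>l x. (psi i y)\<^sup>2) = (\<Sum>y | y \<in> {y \<in> B. \<not> trap w t y} \<and> y \<sim>\<^sub>l x. (psi i y)\<^sup>2)"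
proof (rule sum.mono_neutral_right)
  have i': "i \<in> {1..card B}" using i kB by auto
  show "\<forall>y\<in>{y. y \<sim>\<^sub>l x} - {y. y \<in> {y \<in> B. \<not> trap w t y} \<and> y \<sim>\<^sub>l x}. (psi i y)\<^sup>2 = 0"
  proof
    fix y assume y: "y \<in> {y. y \<sim>\<^sub>l x} - {y. y \<in> {y \<in> B. \<not> trap w t y} \<and> y \<sim>\<^sub>l x}"
    then have "x \<sim>\<^sub>l y" by (simp add: nearest_neighbour_sym)
    then have "y \<notin> B" using y trap_isolated[OF x(1) _ x(2)] by blast
    then show "(psi i y)\<^sup>2 = 0" using psi_supp[OF i'] by simp
  qed
qed auto

text \<open>At a trap that is not near, the local bound costs \<open>\<eta>\<close>^-2 times the
  mass of its neighbours, all of which is counted off the traps. Each non-trap borders at most 2d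
  sites, whence the factor 2d.\<close>

lemma mass_off_near:
  assumes i: "i \<in> {1..k}"
  shows "(\<Sum>x | x \<in> B \<and> \<not> near i x. (psi i x)\<^sup>2) \<le> \<nu>"
proof -
  define R where "R = {y \<in> B. \<not> trap w t y}"
  define S where "S = {x \<in> B. trap w t x \<and> \<not> near i x}"
  have fin: "finite R" "finite S" by (simp_all add: R_def S_def)
  have pt: "(psi i x)\<^sup>2 \<le> (\<Sum>y | y \<in> R \<and> y \<sim>\<^sub>l x. (psi i y)\<^sup>2) / \<eta>\<^sup>2" if x: "x \<in> S" for x
  proof -
    have x': "x \<in> B" "trap w t x" "\<eta> * \<pi> x \<le> \<bar>\<pi> x - lam i\<bar>" using x by (auto simp: S_def near_def)
    have "(\<pi> x)\<^sup>2 * (\<eta>\<^sup>2 * (psi i x)\<^sup>2) = (\<eta> * \<pi> x)\<^sup>2 * (psi i x)\<^sup>2" by (simp add: power_mult_distrib)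
    also have "\<dots> \<le> (\<bar>\<pi> x - lam i\<bar>)\<^sup>2 * (psi i x)\<^sup>2"
      using x'(3) eta speed_pos[of x] by (intro mult_right_mono power_mono) auto
    also have "\<dots> = ((\<pi> x - lam i) * psi i x)\<^sup>2" by (simp add: power_mult_distrib)
    also have "\<dots> \<le> (\<pi> x)\<^sup>2 * (\<Sum>y | y \<in> R \<and> y \<sim>\<^sub>l x. (psi i y)\<^sup>2)"
      using local_eigen_bound[OF i x'(1)] unfolding neighbour_mass[OF i x'(1,2)] R_def .
    finally have "\<eta>\<^sup>2 * (psi i x)\<^sup>2 \<le> (\<Sum>y | y \<in> R \<and> y \<sim>\<^sub>l x. (psi i y)\<^sup>2)"
      using speed_pos[of x] by (simp add: mult_le_cancel_left_pos)
    then show ?thesis using eta by (simp add: field_simps)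
  qed
  have "(\<Sum>x\<in>S. (psi i x)\<^sup>2) \<le> (\<Sum>x\<in>S. (\<Sum>y | y \<in> R \<and> y \<sim>\<^sub>l x. (psi i y)\<^sup>2) / \<eta>\<^sup>2)"
    by (intro sum_mono pt)
  also have "\<dots> = (\<Sum>x\<in>S. \<Sum>y | y \<in> R \<and> y \<sim>\<^sub>l x. (psi i y)\<^sup>2) / \<eta>\<^sup>2"
    by (simp add: sum_divide_distrib)
  also have "(\<Sum>x\<in>S. \<Sum>y | y \<in> R \<and> y \<sim>\<^sub>l x. (psi i y)\<^sup>2) = (\<Sum>y\<in>R. \<Sum>x | x \<in> S \<and> y \<sim>\<^sub>l x. (psi i y)\<^sup>2)"
    by (rule sum.swap_restrict[OF fin(2,1)])
  also have "\<dots> \<le> (\<Sum>y\<in>R. 2 * CARD('d) * (psi i y)\<^sup>2)"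
  proof (rule sum_mono)
    fix y
    have "card {x \<in> S. y \<sim>\<^sub>l x} \<le> card {x. x \<sim>\<^sub>l y}"
      by (intro card_mono) (auto simp: nearest_neighbour_sym)
    also have "card {x. x \<sim>\<^sub>l y} = 2 * CARD('d)"
      using sum_neighbours[of "\<lambda>_. 1 :: nat" y] by simp
    finally have "real (card {x \<in> S. y \<sim>\<^sub>l x}) \<le> real (2 * CARD('d))" by (simp only: of_nat_le_iff)
    then show "(\<Sum>x | x \<in> S \<and> y \<sim>\<^sub>l x. (psi i y)\<^sup>2) \<le> 2 * CARD('d) * (psi i y)\<^sup>2"
      by (simp add: mult_right_mono)
  qed
  also have "\<dots> \<le> 2 * CARD('d) * mu"
    using mass_off_traps[OF i] by (simp add: R_def flip: sum_distrib_left)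
  finally have "(\<Sum>x\<in>S. (psi i x)\<^sup>2) \<le> 2 * CARD('d) * mu / \<eta>\<^sup>2"
    using eta by (simp add: divide_right_mono)
  moreover have "{x. x \<in> B \<and> \<not> near i x} = R \<union> S" by (auto simp: R_def S_def near_def)
  then have "(\<Sum>x | x \<in> B \<and> \<not> near i x. (psi i x)\<^sup>2) = (\<Sum>x\<in>R. (psi i x)\<^sup>2) + (\<Sum>x\<in>S. (psi i x)\<^sup>2)"
    using fin by (auto simp: R_def S_def intro: sum.union_disjoint)
  ultimately show ?thesis
    using mass_off_traps[OF i] mu_nu by (simp add: R_def)
qed

lemma near_unique:
  assumes i: "i \<in> {1..k}" and x: "near i x" "near i y"
  shows "x = y"
proof -
  have False if a: "near i x" "near i y" "\<pi> x \<le> \<pi> y" "x \<noteq> y" for x y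
  proof -
    have 1: "(1 - \<eta>) * \<pi> x < lam i" "(1 - \<eta>) * \<pi> y < lam i" "lam i < (1 + \<eta>) * \<pi> x"
      using a by (auto simp: near_def algebra_simps)
    have "1 / 2 * \<pi> x \<le> (1 - \<eta>) * \<pi> x" using eta speed_pos[of x] by (intro mult_right_mono) auto
    then have "\<pi> x \<le> 2 * L" using 1 lam_le_L[OF i] by linarith
    then have "(1 + 4 * \<eta>) * \<pi> x < \<pi> y" using a by (intro gaps') (auto simp: near_def)
    then have "(1 - \<eta>) * ((1 + 4 * \<eta>) * \<pi> x) < (1 - \<eta>) * \<pi> y"
      using eta by (intro mult_strict_left_mono) auto
    also have "\<dots> < (1 + \<eta>) * \<pi> x" using 1 by simp
    finally have "((1 - \<eta>) * (1 + 4 * \<eta>)) * \<pi> x < (1 + \<eta>) * \<pi> x" by (simp only: mult.assoc)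
    then have "(1 - \<eta>) * (1 + 4 * \<eta>) < 1 + \<eta>" using speed_pos[of x] by (simp only: mult_less_cancel_right_pos)
    \<comment> \<open>This identity is the source of the factor 1 + 4 \<open>\<eta>\<close> in the
      gap condition and of the bound \<open>\<eta> \<le> 1 / 2\<close>.\<close>
    moreover have "(1 - \<eta>) * (1 + 4 * \<eta>) - (1 + \<eta>) = 2 * \<eta> * (1 - 2 * \<eta>)" by (simp add: algebra_simps)
    moreover have "0 \<le> 2 * \<eta> * (1 - 2 * \<eta>)" using eta by (intro mult_nonneg_nonneg) auto
    ultimately show False by linarith
  qed
  from this[OF x] this[OF x(2,1)] linear[of "\<pi> x" "\<pi> y"] show ?thesis by blast
qed

lemma near_exists:
  assumes i: "i \<in> {1..k}"
  obtains x where "near i x" "1 - \<nu> \<le> (psi i x)\<^sup>2"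
proof -
  have split: "(\<Sum>x | x \<in> B \<and> near i x. (psi i x)\<^sup>2) + (\<Sum>x | x \<in> B \<and> \<not> near i x. (psi i x)\<^sup>2) = 1"
  proof -
    have "B = {x. x \<in> B \<and> near i x} \<union> {x. x \<in> B \<and> \<not> near i x}" by auto
    then show ?thesis using psi_norm[OF i]
      by (subst sum.union_disjoint[symmetric]) auto
  qed
  have "\<exists>x. near i x"
  proof (rule ccontr)
    assume "\<nexists>x. near i x"
    then have "(\<Sum>x | x \<in> B \<and> near i x. (psi i x)\<^sup>2) = 0" by simp
    then show False using split mass_off_near[OF i] nu_half by linarith
  qed
  then obtain x where x: "near i x" by blast
  have "{x. x \<in> B \<and> near i x} = {x}" using x near_unique[OF i] by (auto simp: near_def)
  then show ?thesis using that[OF x] split mass_off_near[OF i] by simp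
qed

text \<open>If \<open>x\<close> were faster than the site of rank \<open>i\<close>, the gap would
  give \<open>lam i\<close> > (1 - \<open>\<eta>\<close>)(1 + 4 \<open>\<eta>\<close>)
  \<open>stat i\<close> >= \<open>stat i\<close>, against the upper bound on \<open>lam i\<close>.
  The gap also excludes a tie with a site of later rank.\<close>

lemma site_eq:
  assumes zs: "speed_list w n zs" and i: "i \<in> {1..k}" and x: "near i x"
  shows "\<exists>h<i. x = zs ! h"
proof -
  have len: "length zs = card B" using zs distinct_card by (fastforce simp: speed_list_def)
  define z where "z = zs ! (i - 1)"
  have i': "1 \<le> i" "i \<le> k" "i \<le> card B" using i kB by auto
  have zB: "z \<in> B" using zs len i' nth_mem[of "i - 1" zs] by (simp add: z_def speed_list_def)
  have st: "stat i = \<pi> z" using zs i' by (simp add: speed_list_def z_def)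
  have zL: "\<pi> z \<le> 2 * L" using stat_mono[of i k] kL kB i' L_pos unfolding st by linarith
  have xB: "x \<in> B" using x by (simp add: near_def)
  have le: "\<pi> x \<le> \<pi> z"
  proof (rule ccontr)
    assume "\<not> \<pi> x \<le> \<pi> z"
    then have "(1 + 4 * \<eta>) * \<pi> z < \<pi> x" using zB xB zL by (intro gaps') auto
    then have "(1 - \<eta>) * ((1 + 4 * \<eta>) * \<pi> z) < (1 - \<eta>) * \<pi> x"
      using eta by (intro mult_strict_left_mono) auto
    also have "\<dots> < lam i" using x by (auto simp: near_def algebra_simps)
    also have "\<dots> \<le> \<pi> z" using lam_le_stat[OF i] st by simp
    finally have "((1 - \<eta>) * (1 + 4 * \<eta>)) * \<pi> z < 1 * \<pi> z" by (simp only: mult.assoc mult_1)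
    then have "(1 - \<eta>) * (1 + 4 * \<eta>) < 1" using speed_pos[of z] by (simp only: mult_less_cancel_right_pos)
    moreover have "(1 - \<eta>) * (1 + 4 * \<eta>) - 1 = \<eta> * (3 - 4 * \<eta>)" by (simp add: algebra_simps)
    moreover have "0 \<le> \<eta> * (3 - 4 * \<eta>)" using eta by (intro mult_nonneg_nonneg) auto
    ultimately show False by linarith
  qed
  obtain h where h: "h < length zs" "x = zs ! h"
    using xB zs by (metis in_set_conv_nth speed_list_def)
  have "h < i"
  proof (rule ccontr)
    assume "\<not> h < i"
    then have "map \<pi> zs ! (i - 1) \<le> map \<pi> zs ! h"
      using h zs i' len by (intro sorted_nth_mono) (auto simp: speed_list_def)
    then have "\<pi> z \<le> \<pi> x" using h i' len by (simp add: z_def)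
    moreover have "x \<noteq> z" using h \<open>\<not> h < i\<close> zs i' len
      by (auto simp: z_def nth_eq_iff_index_eq speed_list_def)
    ultimately have "(1 + 4 * \<eta>) * \<pi> z < \<pi> x" using zB xB zL by (intro gaps') auto
    moreover have "\<pi> z \<le> (1 + 4 * \<eta>) * \<pi> z"
      using eta speed_pos[of z] by (simp add: algebra_simps)
    ultimately show False using le by linarith
  qed
  then show ?thesis using h by blast
qed


text \<open>An injective map with \<open>h i < i\<close> for every \<open>i\<close> in 1..k is
  \<open>h i = i - 1\<close>. Injectivity is Parseval for the indicator of a site: the squared
  values of all eigenvectors there sum to 1, so two of them cannot both exceed 1/2.\<close>

lemma near_site:
  assumes zs: "speed_list w n zs"
  shows "near k (zs ! (k - 1)) \<and> 1 - \<nu> \<le> (psi k (zs ! (k - 1)))\<^sup>2"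
proof -
  have len: "length zs = card B" using zs distinct_card by (fastforce simp: speed_list_def)
  have "\<forall>i\<in>{1..k}. \<exists>h. h < i \<and> near i (zs ! h) \<and> 1 - \<nu> \<le> (psi i (zs ! h))\<^sup>2"
  proof
    fix i assume i: "i \<in> {1..k}"
    obtain x where x: "near i x" "1 - \<nu> \<le> (psi i x)\<^sup>2" using near_exists[OF i] .
    then show "\<exists>h. h < i \<and> near i (zs ! h) \<and> 1 - \<nu> \<le> (psi i (zs ! h))\<^sup>2"
      using site_eq[OF zs i x(1)] by auto
  qed
  from bchoice[OF this] obtain h
    where h0: "\<forall>i\<in>{1..k}. h i < i \<and> near i (zs ! h i) \<and> 1 - \<nu> \<le> (psi i (zs ! h i))\<^sup>2" ..
  have h: "h i < i" "near i (zs ! h i)" "1 - \<nu> \<le> (psi i (zs ! h i))\<^sup>2" if "i \<in> {1..k}" for i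
    using h0 that by blast+
  have inj: "h i \<noteq> h j" if ij: "i \<in> {1..k}" "j \<in> {1..k}" "i \<noteq> j" for i j
  proof
    assume e: "h i = h j"
    define x where "x = zs ! h i"
    have xB: "x \<in> B" using h(2)[OF ij(1)] by (simp add: x_def near_def)
    define \<delta> where "\<delta> = (\<lambda>y. if y = x then 1 else 0 :: real)"
    have \<delta>: "(\<Sum>y\<in>B. \<delta> y * g y) = g x" for g
    proof -
      have "(\<Sum>y\<in>B. \<delta> y * g y) = (\<Sum>y\<in>B. if y = x then g x else 0)"
        by (intro sum.cong) (auto simp: \<delta>_def)
      then show ?thesis using xB by simp
    qed
    have "(\<Sum>y\<in>B. \<delta> y * \<delta> y) = (\<Sum>l\<in>{1..card B}. (\<Sum>y\<in>B. \<delta> y * psi l y) * (\<Sum>y\<in>B. \<delta> y * psi l y))"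
      by (rule orthonormal_parseval[OF finB psi_orth])
    then have "(\<Sum>l\<in>{1..card B}. (psi l x)\<^sup>2) = 1"
      unfolding \<delta> by (simp add: \<delta>_def power2_eq_square)
    moreover have "(\<Sum>l\<in>{i, j}. (psi l x)\<^sup>2) \<le> (\<Sum>l\<in>{1..card B}. (psi l x)\<^sup>2)"
      using ij kB by (intro sum_mono2) auto
    ultimately have "(psi i x)\<^sup>2 + (psi j x)\<^sup>2 \<le> 1" using ij by simp
    then show False using h(3)[OF ij(1)] h(3)[OF ij(2)] nu_half unfolding x_def e by linarith
  qed
  have hi: "i \<in> {1..k} \<Longrightarrow> h i = i - 1" for i
  proof (induction i rule: less_induct)
    case (less i)
    show ?case
    proof (rule ccontr)
      assume "h i \<noteq> i - 1"
      then have j: "h i + 1 \<in> {1..k}" "h i + 1 < i" using h(1)[OF less.prems] less.prems by auto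
      then have "h (h i + 1) = h i" using less.IH by simp
      then show False using inj[OF j(1) less.prems] j by simp
    qed
  qed
  have "k \<in> {1..k}" using k1 by simp
  then show ?thesis using h(2,3)[of k] hi[of k] by simp
qed

text \<open>The gaps exclude ties at rank \<open>k\<close>, which determines the choice in
  \<open>speed_site\<close>.\<close>

lemma speed_site_eq:
  assumes zs: "speed_list w n zs"
  shows "speed_site w n k = zs ! (k - 1)"
proof -
  have len: "length zs = card B" using zs distinct_card by (fastforce simp: speed_list_def)
  define z where "z = zs ! (k - 1)"
  have z: "z \<in> B" "\<pi> z = stat k"
    using zs len k1 kB nth_mem[of "k - 1" zs] by (simp_all add: z_def speed_list_def)
  have un: "x = z" if x: "x \<in> B" "\<pi> x = stat k" for x
  proof (rule ccontr)
    assume "x \<noteq> z"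
    then have "(1 + 4 * \<eta>) * \<pi> x < \<pi> z" using x z kL L_pos by (intro gaps') auto
    moreover have "\<pi> x \<le> (1 + 4 * \<eta>) * \<pi> x" using eta speed_pos[of x] by (simp add: algebra_simps)
    ultimately show False using x z by linarith
  qed
  show ?thesis unfolding speed_site_def z_def[symmetric] 
    by (rule some_equality) (use z un in blast)+
qed

lemma localization:
  "1 - sqrt \<nu> \<le> lam k / stat k" "lam k / stat k \<le> 1" "sqrt (1 - \<nu>) \<le> psi k (speed_site w n k)"
proof -
  obtain zs where zs: "speed_list w n zs" using speed_list_exists by blast
  define z where "z = zs ! (k - 1)"
  have kk: "k \<in> {1..k}" "k \<in> {1..card B}" using k1 kB by auto
  have near: "near k z" "1 - \<nu> \<le> (psi k z)\<^sup>2" using near_site[OF zs] by (auto simp: z_def)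
  have site: "speed_site w n k = z" using speed_site_eq[OF zs] by (simp add: z_def)
  have st: "stat k = \<pi> z" using zs k1 kB by (simp add: speed_list_def z_def)
  have z: "z \<in> B" "trap w t z" using near by (auto simp: near_def)
  have stp: "0 < stat k" unfolding st by (rule speed_pos)
  show "lam k / stat k \<le> 1" using lam_le_stat[OF kk(1)] stp by simp
  have "sqrt (1 - \<nu>) \<le> sqrt ((psi k z)\<^sup>2)" using near by (intro real_sqrt_le_mono)
  then show "sqrt (1 - \<nu>) \<le> psi k (speed_site w n k)" using psi_sign[OF kk(2)] unfolding site by simp
  have "((\<pi> z - lam k) * psi k z)\<^sup>2 \<le> (\<pi> z)\<^sup>2 * (\<Sum>y | y \<sim>\<^sub>l z. (psi k y)\<^sup>2)"
    by (rule local_eigen_bound[OF kk(1) z(1)])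
  also have "\<dots> \<le> (\<pi> z)\<^sup>2 * mu"
  proof (rule mult_left_mono)
    have "(\<Sum>y | y \<sim>\<^sub>l z. (psi k y)\<^sup>2) \<le> (\<Sum>x | x \<in> B \<and> \<not> trap w t x. (psi k x)\<^sup>2)"
      unfolding neighbour_mass[OF kk(1) z] by (intro sum_mono2) auto
    then show "(\<Sum>y | y \<sim>\<^sub>l z. (psi k y)\<^sup>2) \<le> mu" using mass_off_traps[OF kk(1)] by linarith
  qed simp
  finally have 1: "((\<pi> z - lam k) * psi k z)\<^sup>2 \<le> (\<pi> z)\<^sup>2 * mu" .
  \<comment> \<open>The squared eigenvector is at least 1 - \<open>\<nu>\<close> > 1/2 at
    \<open>z\<close>, so dividing by it costs a factor 2. The definition of \<open>\<nu>\<close> has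
    room for this, since \<open>mu\<close> is at most 2d \<open>mu\<close> /
    \<open>\<eta>\<close>^2.\<close>
  have "(\<pi> z - lam k)\<^sup>2 * (1 / 2) \<le> (\<pi> z - lam k)\<^sup>2 * (psi k z)\<^sup>2"
    using near nu_half by (intro mult_left_mono) auto
  then have "(\<pi> z - lam k)\<^sup>2 \<le> (\<pi> z)\<^sup>2 * (2 * mu)" using 1 by (simp add: power_mult_distrib)
  also have "\<dots> \<le> (\<pi> z)\<^sup>2 * \<nu>"
  proof (rule mult_left_mono)
    have "mu * 1 \<le> mu * (2 * CARD('d) / \<eta>\<^sup>2)"
    proof (rule mult_left_mono[OF _ mu_nonneg])
      have "\<eta>\<^sup>2 \<le> 1\<^sup>2" using eta by (intro power_mono) auto
      moreover have "(1 :: real) \<le> 2 * CARD('d)"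
        using zero_less_card_finite[where 'a = 'd] by linarith
      ultimately have "\<eta>\<^sup>2 \<le> 2 * CARD('d)" by (metis one_power2 order_trans)
      then show "1 \<le> 2 * CARD('d) / \<eta>\<^sup>2" using eta by simp
    qed
    then show "2 * mu \<le> \<nu>" using mu_nu by (simp add: mult_ac)
  qed simp
  finally have "(stat k - lam k)\<^sup>2 \<le> (stat k)\<^sup>2 * \<nu>" unfolding st .
  then have "sqrt ((stat k - lam k)\<^sup>2) \<le> sqrt ((stat k)\<^sup>2 * \<nu>)" by (rule real_sqrt_le_mono)
  then have "stat k - lam k \<le> stat k * sqrt \<nu>" using stp by (simp add: real_sqrt_mult)
  then show "1 - sqrt \<nu> \<le> lam k / stat k" using stp by (simp add: field_simps)
qed

end

section \<open>Independent conductances\<close>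

text \<open>The edges on which the speed of \<open>x\<close> depends; disjoint stars give
  independent speeds.\<close>

definition star :: "int ^ 'd \<Rightarrow> (int ^ 'd) set set" where
  "star x = (\<lambda>y. {y, x}) ` {y. y \<sim>\<^sub>l x}"

lemma nearest_neighbour_irrefl: "\<not> x \<sim>\<^sub>l x"
  by (simp add: nearest_neighbour_def)

lemma star_inj: "inj_on (\<lambda>y. {y, x}) {y. y \<sim>\<^sub>l x}"
  by (auto simp: inj_on_def doubleton_eq_iff nearest_neighbour_irrefl)

lemma finite_star [simp]: "finite (star x)"
  by (simp add: star_def)

lemma card_star: "card (star (x :: int ^ 'd)) = 2 * CARD('d)"
  unfolding star_def card_image[OF star_inj]
  using sum_neighbours[of "\<lambda>_. 1 :: nat" x] by simp

lemma star_subset: "star x \<subseteq> lattice_edges"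
  by (auto simp: star_def lattice_edges_def)

lemma local_speed_star: "local_speed w x = (\<Sum>e\<in>star x. w e)"
  unfolding star_def local_speed_def by (subst sum.reindex[OF star_inj]) simp

lemma star_disjoint: "x \<noteq> y \<Longrightarrow> \<not> x \<sim>\<^sub>l y \<Longrightarrow> star x \<inter> star y = {}"
  by (auto simp: star_def doubleton_eq_iff nearest_neighbour_sym)

text \<open>Fubini in both orders, scaling one summand at a time: for fixed \<open>u\<close> the
  condition u + v <= a becomes u + v / b <= a, and for fixed \<open>v\<close> this becomes u + v <=
  b a. Nonnegativity keeps the thresholds \<open>a - u\<close> and \<open>a - v / b\<close> below
  \<open>a0\<close>.\<close>

lemma conv_scaling:
  fixes \<mu> \<nu> :: "real measure"
  assumes pr: "prob_space \<mu>" "prob_space \<nu>"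
    and sets: "sets \<mu> = sets borel" "sets \<nu> = sets borel"
    and nonneg: "AE u in \<mu>. 0 \<le> u" "AE v in \<nu>. 0 \<le> v"
    and b: "0 < b"
    and mu: "\<And>a. a \<le> a0 \<Longrightarrow> ennreal b * emeasure \<mu> {..a} \<le> emeasure \<mu> {..b * a}"
    and nu: "\<And>a. a \<le> a0 \<Longrightarrow> \<beta> * emeasure \<nu> {..a} \<le> emeasure \<nu> {..b * a}"
    and a: "a \<le> a0"
  shows "ennreal b * \<beta> * emeasure (\<mu> \<Otimes>\<^sub>M \<nu>) {(u, v). u + v \<le> a}
    \<le> emeasure (\<mu> \<Otimes>\<^sub>M \<nu>) {(u, v). u + v \<le> b * a}"
proof -
  interpret M: prob_space \<mu> by fact
  interpret N: prob_space \<nu> by fact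
  interpret P: pair_prob_space \<mu> \<nu> ..
  note [measurable_cong] = sets
  have [simp]: "space \<mu> = UNIV" "space \<nu> = UNIV"
    using sets_eq_imp_space_eq[OF sets(1)] sets_eq_imp_space_eq[OF sets(2)] by auto
  have sp: "space (\<mu> \<Otimes>\<^sub>M \<nu>) = UNIV" by (simp add: space_pair_measure)
  have m: "{(u, v). u + v \<le> c} \<in> sets (\<mu> \<Otimes>\<^sub>M \<nu>)" for c :: real
  proof -
    have "{x \<in> space (\<mu> \<Otimes>\<^sub>M \<nu>). fst x + snd x \<le> c} \<in> sets (\<mu> \<Otimes>\<^sub>M \<nu>)" by measurable
    then show ?thesis unfolding sp by (simp add: case_prod_beta')
  qed
  have m2: "{(u, v). u + v / b \<le> c} \<in> sets (\<mu> \<Otimes>\<^sub>M \<nu>)" for c :: real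
  proof -
    have "{x \<in> space (\<mu> \<Otimes>\<^sub>M \<nu>). fst x + snd x / b \<le> c} \<in> sets (\<mu> \<Otimes>\<^sub>M \<nu>)" by measurable
    then show ?thesis unfolding sp by (simp add: case_prod_beta')
  qed
  have "ennreal b * \<beta> * emeasure (\<mu> \<Otimes>\<^sub>M \<nu>) {(u, v). u + v \<le> a}
      = ennreal b * (\<beta> * (\<integral>\<^sup>+u. emeasure \<nu> {..a - u} \<partial>\<mu>))"
    unfolding N.emeasure_pair_measure_alt[OF m]
    by (simp add: vimage_def atMost_def algebra_simps)
  also have "\<beta> * (\<integral>\<^sup>+u. emeasure \<nu> {..a - u} \<partial>\<mu>) = (\<integral>\<^sup>+u. \<beta> * emeasure \<nu> {..a - u} \<partial>\<mu>)"
  proof (rule nn_integral_cmult[symmetric])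
    have "(\<lambda>u. emeasure \<nu> (Pair u -` {(u, v). u + v \<le> a})) \<in> borel_measurable \<mu>"
      by (rule N.measurable_emeasure_Pair[OF m])
    also have "(\<lambda>u. emeasure \<nu> (Pair u -` {(u, v). u + v \<le> a})) = (\<lambda>u. emeasure \<nu> {..a - u})"
      by (intro ext arg_cong[of _ _ "emeasure \<nu>"]) auto
    finally show "(\<lambda>u. emeasure \<nu> {..a - u}) \<in> borel_measurable \<mu>" .
  qed
  also have "\<dots> \<le> (\<integral>\<^sup>+u. emeasure \<nu> {..b * (a - u)} \<partial>\<mu>)"
    using nonneg(1) a by (intro nn_integral_mono_AE) (auto intro!: nu)
  also have "(\<integral>\<^sup>+u. emeasure \<nu> {..b * (a - u)} \<partial>\<mu>) = emeasure (\<mu> \<Otimes>\<^sub>M \<nu>) {(u, v). u + v / b \<le> a}"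
    unfolding N.emeasure_pair_measure_alt[OF m2]
  proof (intro nn_integral_cong arg_cong[of _ _ "emeasure \<nu>"] set_eqI)
    fix u v :: real
    show "v \<in> {..b * (a - u)} \<longleftrightarrow> v \<in> Pair u -` {(u, v). u + v / b \<le> a}"
      using b by (simp add: field_simps)
  qed
  also have "\<dots> = (\<integral>\<^sup>+v. emeasure \<mu> {..a - v / b} \<partial>\<nu>)"
    unfolding P.emeasure_pair_measure_alt2[OF m2]
    by (intro nn_integral_cong arg_cong[of _ _ "emeasure \<mu>"]) auto
  also have "ennreal b * \<dots> = (\<integral>\<^sup>+v. ennreal b * emeasure \<mu> {..a - v / b} \<partial>\<nu>)"
  proof (rule nn_integral_cmult[symmetric])
    have "(\<lambda>v. emeasure \<mu> ((\<lambda>u. (u, v)) -` {(u, v). u + v / b \<le> a})) \<in> borel_measurable \<nu>"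
      by (rule P.measurable_emeasure_Pair2[OF m2])
    also have "(\<lambda>v. emeasure \<mu> ((\<lambda>u. (u, v)) -` {(u, v). u + v / b \<le> a})) = (\<lambda>v. emeasure \<mu> {..a - v / b})"
      by (intro ext arg_cong[of _ _ "emeasure \<mu>"]) auto
    finally show "(\<lambda>v. emeasure \<mu> {..a - v / b}) \<in> borel_measurable \<nu>" .
  qed
  also have "\<dots> \<le> (\<integral>\<^sup>+v. emeasure \<mu> {..b * (a - v / b)} \<partial>\<nu>)"
  proof (rule nn_integral_mono_AE)
    show "AE v in \<nu>. ennreal b * emeasure \<mu> {..a - v / b} \<le> emeasure \<mu> {..b * (a - v / b)}"
      using nonneg(2)
    proof eventually_elim
      case (elim v)
      then have "0 \<le> v / b" using b by simp
      then show ?case using a by (intro mu) linarith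
    qed
  qed
  also have "\<dots> = emeasure (\<mu> \<Otimes>\<^sub>M \<nu>) {(u, v). u + v \<le> b * a}"
    unfolding P.emeasure_pair_measure_alt2[OF m]
    using b by (intro nn_integral_cong arg_cong[of _ _ "emeasure \<mu>"]) (auto simp: algebra_simps)
  finally show ?thesis by (simp add: mult_left_mono)
qed

locale iid_conductances = prob_space M
  for M :: "'a measure" +
  fixes w :: "(int ^ 'd) set \<Rightarrow> 'a \<Rightarrow> real" and F :: "real \<Rightarrow> real"
  assumes indep: "indep_vars (\<lambda>_. borel) w lattice_edges"
    and ident: "\<And>e. e \<in> lattice_edges \<Longrightarrow> cdf (distr M borel (w e)) = F"
    and positive: "\<And>e. e \<in> lattice_edges \<Longrightarrow> AE \<omega> in M. 0 < w e \<omega>"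
begin

lemma w_meas [measurable]: "e \<in> lattice_edges \<Longrightarrow> w e \<in> borel_measurable M"
  using indep unfolding indep_vars_def by auto

abbreviation speed :: "int ^ 'd \<Rightarrow> 'a \<Rightarrow> real" where
  "speed x \<omega> \<equiv> local_speed (\<lambda>e. w e \<omega>) x"

lemma speed_meas [measurable]: "speed x \<in> borel_measurable M"
  unfolding local_speed_star using star_subset[of x] by (intro borel_measurable_sum) auto

lemma prob_bond: "e \<in> lattice_edges \<Longrightarrow> prob {\<omega> \<in> space M. w e \<omega> \<le> x} = F x"
proof -
  assume e: "e \<in> lattice_edges"
  have "F x = measure (distr M borel (w e)) {..x}" using ident[OF e] by (auto simp: cdf_def)
  also have "\<dots> = prob (w e -` {..x} \<inter> space M)" using e by (intro measure_distr) auto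
  also have "w e -` {..x} \<inter> space M = {\<omega> \<in> space M. w e \<omega> \<le> x}" by auto
  finally show ?thesis by simp
qed

lemma prob_bonds:
  assumes E: "finite E" "E \<subseteq> lattice_edges"
  shows "prob {\<omega> \<in> space M. \<forall>e\<in>E. w e \<omega> \<le> x} = F x ^ card E"
proof (cases "E = {}")
  case True then show ?thesis by (simp add: prob_space)
next
  case False
  have "{\<omega> \<in> space M. \<forall>e\<in>E. w e \<omega> \<le> x} = (\<Inter>e\<in>E. w e -` {..x} \<inter> space M)"
    using False by auto
  then have "prob {\<omega> \<in> space M. \<forall>e\<in>E. w e \<omega> \<le> x} = (\<Prod>e\<in>E. prob (w e -` {..x} \<inter> space M))"
    using indep_varsD[OF indep False E, of "\<lambda>_. {..x}"] by simp
  also have "\<dots> = (\<Prod>e\<in>E. F x)"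
  proof (intro prod.cong refl)
    fix e assume "e \<in> E"
    then have "prob {\<omega> \<in> space M. w e \<omega> \<le> x} = F x" using E by (intro prob_bond) auto
    then show "prob (w e -` {..x} \<inter> space M) = F x"
      by (simp add: vimage_def Int_def conj_commute)
  qed
  finally show ?thesis by simp
qed

lemma an_edge: "bond 0 undefined \<in> (lattice_edges :: (int ^ 'd) set set)" by simp

lemma F_nonneg: "0 \<le> F x" and F_le1: "F x \<le> 1" and F_mono: "x \<le> y \<Longrightarrow> F x \<le> F y" and F_zero: "F 0 = 0"
proof -
  let ?e = "bond 0 undefined :: (int ^ 'd) set"
  note p = prob_bond[OF an_edge, symmetric]
  show "0 \<le> F x" "F x \<le> 1" unfolding p by auto
  show "F x \<le> F y" if "x \<le> y" unfolding p using that by (intro finite_measure_mono) auto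
  have "prob {\<omega> \<in> space M. w ?e \<omega> \<le> 0} = 0"
    using positive[OF an_edge] by (intro measure_eq_0_null_sets) (auto simp: AE_iff_null not_less)
  then show "F 0 = 0" unfolding p by simp
qed

text \<open>Union bound over the cubes and over the sets of \<open>j\<close> bonds in each.
  Independence gives each set probability at most \<open>F x ^ j\<close>, and the power of 2 bounds
  the number of sets.\<close>

lemma many_small_bonds:
  fixes V :: "(int ^ 'd) set"
  obtains A where "A \<in> events" "prob A \<le> card V * 2 ^ (card (cube (0 :: int ^ 'd) K) * CARD('d)) * F x ^ j"
    "\<And>\<omega> v. \<omega> \<in> space M \<Longrightarrow> \<omega> \<notin> A \<Longrightarrow> v \<in> V \<Longrightarrow> finite V \<Longrightarrow> card (bonds_below (\<lambda>e. w e \<omega>) x v K) < j"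
proof (cases "finite V")
  case False then show ?thesis by (intro that[of "{}"]) auto
next
  case fin: True
  define \<S> where "\<S> = (\<lambda>v :: int ^ 'd. {S. S \<subseteq> cube v K \<times> (UNIV :: 'd set) \<and> card S = j})"
  define C where "C = (\<lambda>S. {\<omega> \<in> space M. \<forall>e\<in>(\<lambda>(b, k). bond b k) ` S. w e \<omega> \<le> x})"
  define A where "A = (\<Union>v\<in>V. \<Union>S\<in>\<S> v. C S)"
  have finS: "finite S" if "S \<in> \<S> v" for S v
    using that by (auto simp: \<S>_def intro: finite_subset[of _ "cube v K \<times> UNIV"])
  have Cm: "C S \<in> events" if "finite S" for S
    unfolding C_def using that by (intro sets.sets_Collect_finite_All) auto
  have finSS: "finite (\<S> v)" "card (\<S> v) \<le> 2 ^ (card (cube (0 :: int ^ 'd) K) * CARD('d))" for v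
  proof -
    have sub: "\<S> v \<subseteq> Pow (cube v K \<times> UNIV)" by (auto simp: \<S>_def)
    then show "finite (\<S> v)" by (rule finite_subset) auto
    have "card (\<S> v) \<le> card (Pow (cube v K \<times> (UNIV :: 'd set)))" using sub by (intro card_mono) auto
    then show "card (\<S> v) \<le> 2 ^ (card (cube (0 :: int ^ 'd) K) * CARD('d))"
      by (simp add: card_Pow card_cartesian_product card_cube)
  qed
  have pC: "prob (C S) = F x ^ j" if "S \<in> \<S> v" for S v
  proof -
    have "inj_on (\<lambda>(b, k). bond b k) S" by (auto simp: inj_on_def bond_inj)
    then have "card ((\<lambda>(b, k). bond b k) ` S) = j" using that by (simp add: card_image \<S>_def)
    then show ?thesis unfolding C_def using finS[OF that] by (subst prob_bonds) auto
  qed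
  show ?thesis
  proof (rule that[of A])
    show "A \<in> events" unfolding A_def using fin finSS finS Cm by (intro sets.finite_UN) blast+
    have "prob A \<le> (\<Sum>v\<in>V. prob (\<Union>S\<in>\<S> v. C S))"
      unfolding A_def using fin finSS finS Cm by (intro finite_measure_subadditive_finite) (auto intro!: sets.finite_UN)
    also have "\<dots> \<le> (\<Sum>v\<in>V. \<Sum>S\<in>\<S> v. prob (C S))"
      using finSS finS Cm by (intro sum_mono finite_measure_subadditive_finite) auto
    also have "\<dots> = (\<Sum>v\<in>V. card (\<S> v) * F x ^ j)" using pC by (intro sum.cong) auto
    also have "\<dots> \<le> (\<Sum>v\<in>V. real (2 ^ (card (cube (0 :: int ^ 'd) K) * CARD('d))) * F x ^ j)"
      using F_nonneg finSS(2) by (intro sum_mono mult_right_mono) (auto simp only: of_nat_le_iff zero_le_power)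
    finally show "prob A \<le> card V * 2 ^ (card (cube (0 :: int ^ 'd) K) * CARD('d)) * F x ^ j" by simp
    fix \<omega> v assume \<omega>: "\<omega> \<in> space M" "\<omega> \<notin> A" "v \<in> V"
    show "card (bonds_below (\<lambda>e. w e \<omega>) x v K) < j"
    proof (rule ccontr)
      assume "\<not> ?thesis"
      then obtain S where S: "S \<subseteq> bonds_below (\<lambda>e. w e \<omega>) x v K" "card S = j"
        by (meson not_less obtain_subset_with_card_n)
      then have "S \<in> \<S> v" "\<omega> \<in> C S" using \<omega>(1) by (auto simp: \<S>_def C_def bonds_below_def less_imp_le)
      then show False using \<omega> by (auto simp: A_def)
    qed
  qed
qed

end

section \<open>Law of the local speed: near ties and small values\<close>

context iid_conductances
begin

lemma AE_star_pos: "AE \<omega> in M. \<forall>e\<in>star x. 0 < w e \<omega>"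
  using star_subset[of x] positive by (intro AE_finite_allI) auto

lemma AE_speed_pos: "AE \<omega> in M. 0 < speed x \<omega>"
  using AE_star_pos[of x]
proof eventually_elim
  case (elim \<omega>)
  have "star x \<noteq> {}" using card_star[of x] by (metis card.empty mult_eq_0_iff zero_less_card_finite zero_neq_numeral less_numeral_extra(3))
  then show ?case unfolding local_speed_star using elim by (intro sum_pos) auto
qed

text \<open>A small speed forces all 2d bonds of the star to be small. With the converse
  \<open>prob_speed_ge\<close>, whose threshold is smaller by a factor 2d, the lower tail of the
  speed is of order F^(2d); at \<open>L\<close> this is n^-d times a small positive power of
  n.\<close>

lemma prob_speed_le: "prob {\<omega> \<in> space M. speed x \<omega> \<le> a} \<le> F a ^ (2 * CARD('d))"
proof -
  have m: "{\<omega> \<in> space M. \<forall>e\<in>star x. w e \<omega> \<le> a} \<in> events"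
    using star_subset[of x] by (intro sets.sets_Collect_finite_All) auto
  have "prob {\<omega> \<in> space M. speed x \<omega> \<le> a} \<le> prob {\<omega> \<in> space M. \<forall>e\<in>star x. w e \<omega> \<le> a}"
  proof (rule finite_measure_mono_AE[OF _ m])
    show "AE \<omega> in M. \<omega> \<in> {\<omega> \<in> space M. speed x \<omega> \<le> a} \<longrightarrow> \<omega> \<in> {\<omega> \<in> space M. \<forall>e\<in>star x. w e \<omega> \<le> a}"
      using AE_star_pos[of x]
    proof eventually_elim
      case (elim \<omega>)
      have "w e \<omega> \<le> speed x \<omega>" if "e \<in> star x" for e
        unfolding local_speed_star using elim that by (intro member_le_sum) (auto intro: less_imp_le)
      then show ?case by force
    qed
  qed
  also have "\<dots> = F a ^ (2 * CARD('d))"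
    using star_subset[of x] by (simp add: prob_bonds card_star)
  finally show ?thesis .
qed

lemma prob_speed_ge: "F (a / (2 * CARD('d))) ^ (2 * CARD('d)) \<le> prob {\<omega> \<in> space M. speed x \<omega> \<le> a}"
proof -
  have "F (a / (2 * CARD('d))) ^ (2 * CARD('d)) = prob {\<omega> \<in> space M. \<forall>e\<in>star x. w e \<omega> \<le> a / (2 * CARD('d))}"
    using star_subset[of x] by (simp add: prob_bonds card_star)
  also have "\<dots> \<le> prob {\<omega> \<in> space M. speed x \<omega> \<le> a}"
  proof (rule finite_measure_mono)
    show "{\<omega> \<in> space M. \<forall>e\<in>star x. w e \<omega> \<le> a / (2 * CARD('d))} \<subseteq> {\<omega> \<in> space M. speed x \<omega> \<le> a}"
    proof clarify
      fix \<omega> assume a: "\<forall>e\<in>star x. w e \<omega> \<le> a / (2 * CARD('d))"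
      have "speed x \<omega> \<le> card (star x) * (a / (2 * CARD('d)))"
        unfolding local_speed_star using a by (intro sum_bounded_above) auto
      then show "speed x \<omega> \<le> a" by (simp add: card_star)
    qed
  qed measurable
  finally show ?thesis .
qed

lemma emeasure_bond: "e \<in> lattice_edges \<Longrightarrow> emeasure (distr M borel (w e)) {..x} = ennreal (F x)"
proof -
  assume e: "e \<in> lattice_edges"
  have "emeasure (distr M borel (w e)) {..x} = emeasure M (w e -` {..x} \<inter> space M)"
    using e by (intro emeasure_distr) auto
  also have "w e -` {..x} \<inter> space M = {\<omega> \<in> space M. w e \<omega> \<le> x}" by auto
  finally show ?thesis by (simp add: emeasure_eq_measure prob_bond[OF e])
qed

text \<open>Each summand costs one factor \<open>b\<close>: the induction applies
  \<open>conv_scaling\<close> to a new edge and to the partial sum, with \<open>\<beta>\<close>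
  equal to \<open>b ^ card E\<close>.\<close>

lemma sum_scaling:
  assumes E: "finite E" "E \<subseteq> lattice_edges" and b: "0 < b"
    and F: "\<And>a. a \<le> a0 \<Longrightarrow> b * F a \<le> F (b * a)" and a: "a \<le> a0"
  shows "ennreal b ^ card E * emeasure M {\<omega> \<in> space M. (\<Sum>e\<in>E. w e \<omega>) \<le> a}
    \<le> emeasure M {\<omega> \<in> space M. (\<Sum>e\<in>E. w e \<omega>) \<le> b * a}"
  using E a
proof (induction E arbitrary: a rule: finite_induct)
  case empty
  then show ?case using b by (cases "0 \<le> a") auto
next
  case (insert e E)
  define S where "S = (\<lambda>\<omega>. \<Sum>e\<in>E. w e \<omega>)"
  have S_eq: "(\<Sum>e\<in>E. w e \<omega>) = S \<omega>" for \<omega> by (simp add: S_def)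
  have e: "e \<in> lattice_edges" and E: "E \<subseteq> lattice_edges" using insert by auto
  have [measurable]: "w e \<in> borel_measurable M" "S \<in> borel_measurable M"
    using e E unfolding S_def by (auto intro!: borel_measurable_sum)
  let ?\<mu> = "distr M borel (w e)" and ?\<nu> = "distr M borel S"
  have iv: "indep_var borel (w e) borel S" unfolding S_def
    using insert by (intro indep_vars_sum indep_vars_subset[OF indep]) auto
  have joint: "emeasure (?\<mu> \<Otimes>\<^sub>M ?\<nu>) {(u, v). u + v \<le> c} = emeasure M {\<omega> \<in> space M. w e \<omega> + S \<omega> \<le> c}" for c
  proof -
    have "{x \<in> space (borel \<Otimes>\<^sub>M borel :: (real \<times> real) measure). fst x + snd x \<le> c} \<in> sets (borel \<Otimes>\<^sub>M borel)"
      by measurable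
    then have m: "{(u, v). u + v \<le> c} \<in> sets (borel \<Otimes>\<^sub>M borel)"
      by (simp add: space_pair_measure case_prod_beta')
    have "?\<mu> \<Otimes>\<^sub>M ?\<nu> = distr M (borel \<Otimes>\<^sub>M borel) (\<lambda>\<omega>. (w e \<omega>, S \<omega>))"
      using iv unfolding indep_var_distribution_eq by simp
    then have "emeasure (?\<mu> \<Otimes>\<^sub>M ?\<nu>) {(u, v). u + v \<le> c}
        = emeasure M ((\<lambda>\<omega>. (w e \<omega>, S \<omega>)) -` {(u, v). u + v \<le> c} \<inter> space M)"
      using m by (simp add: emeasure_distr)
    also have "(\<lambda>\<omega>. (w e \<omega>, S \<omega>)) -` {(u, v). u + v \<le> c} \<inter> space M = {\<omega> \<in> space M. w e \<omega> + S \<omega> \<le> c}" by auto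
    finally show ?thesis .
  qed
  have "ennreal b * ennreal b ^ card E * emeasure (?\<mu> \<Otimes>\<^sub>M ?\<nu>) {(u, v). u + v \<le> a}
      \<le> emeasure (?\<mu> \<Otimes>\<^sub>M ?\<nu>) {(u, v). u + v \<le> b * a}"
  proof (rule conv_scaling[of ?\<mu> ?\<nu> b a0 "ennreal b ^ card E" a])
    show "AE u in ?\<mu>. 0 \<le> u" using positive[OF e] by (subst AE_distr_iff) (auto elim: eventually_mono)
    have "AE \<omega> in M. \<forall>e\<in>E. 0 < w e \<omega>" using E insert positive by (intro AE_finite_allI) auto
    then have "AE \<omega> in M. 0 \<le> S \<omega>" unfolding S_def
      by eventually_elim (auto intro!: sum_nonneg simp: less_imp_le)
    then show "AE v in ?\<nu>. 0 \<le> v" by (subst AE_distr_iff) auto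
    fix a assume a: "a \<le> a0"
    show "ennreal b * emeasure ?\<mu> {..a} \<le> emeasure ?\<mu> {..b * a}"
      unfolding emeasure_bond[OF e] using b F[OF a] by (simp add: ennreal_mult'[symmetric] ennreal_leI)
    have "S -` {..c} \<inter> space M = {\<omega> \<in> space M. S \<omega> \<le> c}" for c by auto
    then show "ennreal b ^ card E * emeasure ?\<nu> {..a} \<le> emeasure ?\<nu> {..b * a}"
      using insert.IH[OF E a] S_eq by (simp add: emeasure_distr)
  qed (use b insert.prems in \<open>auto intro: prob_space_distr\<close>)
  then show ?case unfolding joint using insert.hyps by (simp add: S_def)
qed

lemma speed_scaling:
  assumes b: "0 < b" and F: "\<And>a. a \<le> a0 \<Longrightarrow> b * F a \<le> F (b * a)" and a: "a \<le> a0"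
  shows "b ^ (2 * CARD('d)) * prob {\<omega> \<in> space M. speed x \<omega> \<le> a} \<le> prob {\<omega> \<in> space M. speed x \<omega> \<le> b * a}"
proof -
  have "ennreal (b ^ (2 * CARD('d)) * prob {\<omega> \<in> space M. speed x \<omega> \<le> a})
      \<le> ennreal (prob {\<omega> \<in> space M. speed x \<omega> \<le> b * a})"
    using sum_scaling[OF finite_star star_subset b F a, of x] b
    unfolding local_speed_star card_star emeasure_eq_measure by (simp add: ennreal_mult'[symmetric] ennreal_power)
  then show ?thesis by simp
qed

lemma speeds_indep:
  assumes S: "\<And>x y. x \<in> S \<Longrightarrow> y \<in> S \<Longrightarrow> \<not> x \<sim>\<^sub>l y"
  shows "indep_vars (\<lambda>_. borel) (\<lambda>x. speed x) S"
proof -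
  have "indep_vars (\<lambda>x. PiM (star x) (\<lambda>_. borel)) (\<lambda>x \<omega>. restrict (\<lambda>e. w e \<omega>) (star x)) S"
    by (intro indep_vars_restrict[OF indep] star_subset) (auto simp: disjoint_family_on_def star_disjoint S)
  then have "indep_vars (\<lambda>_. borel) (\<lambda>x \<omega>. (\<lambda>f. \<Sum>e\<in>star x. f e) (restrict (\<lambda>e. w e \<omega>) (star x))) S"
    by (rule indep_vars_compose2) auto
  then show ?thesis
    by (rule indep_vars_cong[THEN iffD1, rotated -1]) (auto simp: local_speed_star fun_eq_iff)
qed

lemma speeds_indep_pair:
  assumes "x \<noteq> y" "\<not> x \<sim>\<^sub>l y"
  shows "indep_var borel (speed x) borel (speed y)"
proof -
  have "indep_vars (\<lambda>_. borel) (\<lambda>x. speed x) (insert x {y})"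
    using assms nearest_neighbour_irrefl by (intro speeds_indep) (auto simp: nearest_neighbour_sym)
  from indep_vars_sum[OF _ _ this] assms show ?thesis by simp
qed

text \<open>Conditionally on \<open>\<pi>\<^sub>x = u\<close>, the speed \<open>\<pi>\<^sub>y\<close> has to fall into a window of relative size of order \<open>\<eta>\<close>;
  the scaling property bounds the mass of the window by \<open>\<eta>\<close> times that of \<open>{..(1 + 4 \<eta>) u}\<close>.\<close>
lemma close_speeds:
  fixes \<eta> l a0 :: real
  assumes xy: "x \<noteq> y" "\<not> x \<sim>\<^sub>l y" and \<eta>: "0 < \<eta>" "\<eta> \<le> 1 / 2" and l: "0 < l" "3 * l \<le> a0"
    and F: "\<And>a b. a \<le> a0 \<Longrightarrow> 0 \<le> b \<Longrightarrow> b \<le> 1 \<Longrightarrow> b * F a \<le> F (a * b)"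
  shows "prob {\<omega> \<in> space M. speed x \<omega> \<le> l \<and> speed x \<omega> \<le> speed y \<omega> \<and> speed y \<omega> \<le> (1 + 4 * \<eta>) * speed x \<omega>}
     \<le> 16 * CARD('d) * \<eta> * F (3 * l) ^ (4 * CARD('d))"
proof -
  define X where "X = speed x"
  define Y where "Y = speed y"
  define c where "c = 1 + 4 * \<eta>"
  define H where "H = F (3 * l) ^ (2 * CARD('d))"
  have c: "1 < c" "c \<le> 3" using \<eta> by (auto simp: c_def)
  have H0: "0 \<le> H" using F_nonneg by (simp add: H_def)
  have [measurable]: "X \<in> borel_measurable M" "Y \<in> borel_measurable M" by (simp_all add: X_def Y_def)
  let ?\<mu> = "distr M borel X" and ?\<nu> = "distr M borel Y"
  interpret N: prob_space ?\<nu> by (rule prob_space_distr) simp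
  define W where "W = {z :: real \<times> real. fst z \<le> l \<and> fst z \<le> snd z \<and> snd z \<le> c * fst z}"
  have "{z :: real \<times> real. z \<in> space (borel \<Otimes>\<^sub>M borel) \<and> fst z \<le> l \<and> fst z \<le> snd z \<and> snd z \<le> c * fst z} \<in> sets (borel \<Otimes>\<^sub>M borel)"
    by measurable
  then have W: "W \<in> sets (borel \<Otimes>\<^sub>M borel)" by (simp add: space_pair_measure W_def)
  have "emeasure M {\<omega> \<in> space M. X \<omega> \<le> l \<and> X \<omega> \<le> Y \<omega> \<and> Y \<omega> \<le> c * X \<omega>}
      = emeasure (distr M (borel \<Otimes>\<^sub>M borel) (\<lambda>\<omega>. (X \<omega>, Y \<omega>))) W"
    using W by (subst emeasure_distr) (auto simp: W_def intro!: arg_cong[of _ _ "emeasure M"])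
  also have "\<dots> = emeasure (?\<mu> \<Otimes>\<^sub>M ?\<nu>) W"
    using speeds_indep_pair[OF xy] unfolding indep_var_distribution_eq X_def Y_def by simp
  also have "\<dots> = (\<integral>\<^sup>+u. emeasure ?\<nu> (Pair u -` W) \<partial>?\<mu>)"
    using W by (intro N.emeasure_pair_measure_alt) simp
  also have "\<dots> \<le> (\<integral>\<^sup>+u. ennreal (16 * CARD('d) * \<eta> * H) * indicator {..l} u \<partial>?\<mu>)"
  proof (rule nn_integral_mono_AE)
    have "AE u in ?\<mu>. 0 < u" using AE_speed_pos[of x] by (subst AE_distr_iff) (auto simp: X_def)
    then show "AE u in ?\<mu>. emeasure ?\<nu> (Pair u -` W) \<le> ennreal (16 * CARD('d) * \<eta> * H) * indicator {..l} u"
    proof eventually_elim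
      case (elim u)
      show ?case
      proof (cases "u \<le> l")
        case False
        then have "Pair u -` W = {}" by (auto simp: W_def)
        then show ?thesis by simp
      next
        case True
        define G where "G = (\<lambda>a. prob {\<omega> \<in> space M. Y \<omega> \<le> a})"
        \<comment> \<open>Scaling by \<open>b\<close> maps \<open>c * u\<close> to
          \<open>u / c\<close>, so the scaling property compares the two ends of the window. The
          left end lies strictly below \<open>u\<close>, so that the half-open interval still
          contains the point \<open>u\<close>.\<close>
        define b where "b = (1 / c)\<^sup>2"
        have b: "0 < b" "b \<le> 1" using c by (auto simp: b_def power_le_one)
        have bcu: "b * (c * u) = u / c" using c by (simp add: b_def power2_eq_square)
        have cu: "c * u \<le> 3 * l" using True elim c l by (intro mult_mono) auto
        have "emeasure ?\<nu> (Pair u -` W) \<le> emeasure ?\<nu> {u / c<..c * u}"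
        proof (rule emeasure_mono)
          have "u / c < u" using elim c by (simp add: field_simps)
          then show "Pair u -` W \<subseteq> {u / c<..c * u}" by (auto simp: W_def)
        qed simp
        also have "\<dots> = emeasure M (Y -` {u / c<..c * u} \<inter> space M)" by (rule emeasure_distr) auto
        also have "\<dots> = ennreal (prob (Y -` {u / c<..c * u} \<inter> space M))" by (rule emeasure_eq_measure)
        also have "prob (Y -` {u / c<..c * u} \<inter> space M) = G (c * u) - G (u / c)"
        proof -
          have "u / c \<le> c * u"
          proof -
            have "u / c \<le> u / 1" using elim c by (intro divide_left_mono) auto
            also have "\<dots> \<le> c * u" using elim c mult_right_mono[of 1 c u] by simp
            finally show ?thesis .
          qed
          then have "prob ({\<omega> \<in> space M. Y \<omega> \<le> c * u} - {\<omega> \<in> space M. Y \<omega> \<le> u / c}) = G (c * u) - G (u / c)"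
            unfolding G_def by (intro finite_measure_Diff) auto
          moreover have "Y -` {u / c<..c * u} \<inter> space M = {\<omega> \<in> space M. Y \<omega> \<le> c * u} - {\<omega> \<in> space M. Y \<omega> \<le> u / c}" by auto
          ultimately show ?thesis by simp
        qed
        also have "G (c * u) - G (u / c) \<le> (1 - b ^ (2 * CARD('d))) * G (c * u)"
          using speed_scaling[of b a0 "c * u" y] b cu l F[of _ b] unfolding bcu G_def Y_def
          by (simp add: algebra_simps)
        also have "\<dots> \<le> (16 * CARD('d) * \<eta>) * H"
        proof (rule mult_mono)
          \<comment> \<open>Bernoulli linearizes 1 - c^(-4d) to 4d (1 - 1/c), which is at most 16 d
            \<open>\<eta>\<close>.\<close>
          have "1 + real (2 * (2 * CARD('d))) * (1 / c - 1) \<le> (1 + (1 / c - 1)) ^ (2 * (2 * CARD('d)))"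
            using c by (intro Bernoulli_inequality) (auto simp: field_simps)
          also have "1 + (1 / c - 1) = 1 / c" by simp
          also have "(1 / c) ^ (2 * (2 * CARD('d))) = b ^ (2 * CARD('d))" unfolding b_def by (simp only: power_mult)
          finally have "1 - b ^ (2 * CARD('d)) \<le> real (2 * (2 * CARD('d))) * (1 - 1 / c)" by (simp add: algebra_simps)
          also have "\<dots> \<le> real (2 * (2 * CARD('d))) * (4 * \<eta>)"
            using \<eta> by (intro mult_left_mono) (auto simp: c_def field_simps)
          finally show "1 - b ^ (2 * CARD('d)) \<le> 16 * CARD('d) * \<eta>" by simp
          have "G (c * u) \<le> G (3 * l)" unfolding G_def using cu by (intro finite_measure_mono) auto
          also have "\<dots> \<le> H" unfolding G_def H_def Y_def by (rule prob_speed_le)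
          finally show "G (c * u) \<le> H" .
        qed (use \<eta> in \<open>auto simp: G_def\<close>)
        finally show ?thesis using True by (simp add: ennreal_leI)
      qed
    qed
  qed
  also have "\<dots> = ennreal (16 * CARD('d) * \<eta> * H) * emeasure ?\<mu> {..l}"
    by (rule nn_integral_cmult_indicator) simp
  also have "\<dots> \<le> ennreal (16 * CARD('d) * \<eta> * H) * ennreal H"
  proof (rule mult_left_mono)
    have "emeasure ?\<mu> {..l} = emeasure M (X -` {..l} \<inter> space M)" by (rule emeasure_distr) auto
    also have "\<dots> \<le> ennreal (prob {\<omega> \<in> space M. X \<omega> \<le> 3 * l})"
      unfolding emeasure_eq_measure using l by (intro ennreal_leI finite_measure_mono) auto
    also have "\<dots> \<le> ennreal H" unfolding X_def H_def by (intro ennreal_leI prob_speed_le)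
    finally show "emeasure ?\<mu> {..l} \<le> ennreal H" .
  qed simp
  also have "\<dots> = ennreal (16 * CARD('d) * \<eta> * F (3 * l) ^ (4 * CARD('d)))"
  proof -
    have "H * H = F (3 * l) ^ (4 * CARD('d))" unfolding H_def power_add[symmetric] by simp
    then show ?thesis using H0 \<eta> by (simp add: ennreal_mult[symmetric] mult.assoc)
  qed
  finally have "ennreal (prob {\<omega> \<in> space M. X \<omega> \<le> l \<and> X \<omega> \<le> Y \<omega> \<and> Y \<omega> \<le> c * X \<omega>})
      \<le> ennreal (16 * CARD('d) * \<eta> * F (3 * l) ^ (4 * CARD('d)))"
    unfolding emeasure_eq_measure .
  then show ?thesis using \<eta> F_nonneg by (subst (asm) ennreal_le_iff) (auto simp: X_def Y_def c_def)
qed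

text \<open>Cut \<open>S\<close> into \<open>k\<close> disjoint blocks of size
  \<open>card S div k\<close>. By independence a block lacks a slow site with probability at most (1
  - q)^m, and one slow site per block yields \<open>k\<close> distinct ones without a binomial tail
  estimate.\<close>

lemma small_speeds_exist:
  fixes S :: "(int ^ 'd) set"
  assumes S: "finite S" "\<And>x y. x \<in> S \<Longrightarrow> y \<in> S \<Longrightarrow> \<not> x \<sim>\<^sub>l y"
  shows "\<exists>A\<in>events. prob A \<le> k * (1 - F (l / (2 * CARD('d))) ^ (2 * CARD('d))) ^ (card S div k) \<and>
    (\<forall>\<omega>\<in>space M - A. k \<le> card {x \<in> S. speed x \<omega> \<le> l})"
proof -
  define q where "q = F (l / (2 * CARD('d))) ^ (2 * CARD('d))"
  define m where "m = card S div k"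
  obtain h where h: "bij_betw h {0..<card S} S" using ex_bij_betw_nat_finite[OF S(1)] by blast
  define T where "T = (\<lambda>j. h ` {j * m..<(j + 1) * m})"
  have idx: "{j * m..<(j + 1) * m} \<subseteq> {0..<card S}" if "j < k" for j
  proof -
    have "(j + 1) * m \<le> k * m" using that by (intro mult_right_mono) auto
    also have "\<dots> \<le> card S" by (simp add: m_def)
    finally show ?thesis by auto
  qed
  have injh: "inj_on h {0..<card S}" using h by (simp add: bij_betw_def)
  have T: "T j \<subseteq> S" "card (T j) = m" "finite (T j)" if "j < k" for j
  proof -
    show "T j \<subseteq> S" using idx[OF that] h by (auto simp: T_def bij_betw_def)
    show "card (T j) = m" unfolding T_def using inj_on_subset[OF injh idx[OF that]] by (simp add: card_image)
    show "finite (T j)" by (simp add: T_def)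
  qed
  have Tdisj: "T i \<inter> T j = {}" if "i < j" "j < k" for i j
  proof -
    have "(i + 1) * m \<le> j * m" using that by (intro mult_right_mono) auto
    then have "{i * m..<(i + 1) * m} \<inter> {j * m..<(j + 1) * m} = {}" by auto
    moreover have "T i \<inter> T j = h ` ({i * m..<(i + 1) * m} \<inter> {j * m..<(j + 1) * m})"
      unfolding T_def using idx[of i] idx[of j] that by (intro inj_on_image_Int[OF injh, symmetric]) auto
    ultimately show ?thesis by simp
  qed
  define C where "C = (\<lambda>j. {\<omega> \<in> space M. \<forall>x\<in>T j. l < speed x \<omega>})"
  have Cm: "C j \<in> events" if "j < k" for j
    unfolding C_def using T(3)[OF that] by (intro sets.sets_Collect_finite_All) auto
  have pC: "prob (C j) \<le> (1 - q) ^ m" if j: "j < k" for j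
  proof (cases "T j = {}")
    case True then show ?thesis using T(2)[OF j] by simp
  next
    case False
    have iv: "indep_vars (\<lambda>_. borel) (\<lambda>x. speed x) (T j)"
      using S(2) T(1)[OF j] by (intro speeds_indep) auto
    have "C j = (\<Inter>x\<in>T j. speed x -` {l<..} \<inter> space M)" using False by (auto simp: C_def)
    then have "prob (C j) = (\<Prod>x\<in>T j. prob (speed x -` {l<..} \<inter> space M))"
      using indep_varsD[OF iv False T(3)[OF j] subset_refl, of "\<lambda>_. {l<..}"] by simp
    also have "\<dots> \<le> (\<Prod>x\<in>T j. 1 - q)"
    proof (rule prod_mono, safe)
      fix x
      have "prob (speed x -` {l<..} \<inter> space M) = 1 - prob {\<omega> \<in> space M. speed x \<omega> \<le> l}"
      proof -
        have "speed x -` {l<..} \<inter> space M = space M - {\<omega> \<in> space M. speed x \<omega> \<le> l}" by auto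
        then show ?thesis by (simp add: prob_compl)
      qed
      then show "prob (speed x -` {l<..} \<inter> space M) \<le> 1 - q" using prob_speed_ge[of l x] by (simp add: q_def)
    qed simp
    finally show ?thesis using T(2)[OF j] by simp
  qed
  show ?thesis
  proof (intro bexI[of _ "\<Union>j<k. C j"] conjI ballI)
    show "(\<Union>j<k. C j) \<in> events" using Cm by auto
    have "prob (\<Union>j<k. C j) \<le> (\<Sum>j<k. prob (C j))" using Cm by (intro finite_measure_subadditive_finite) auto
    also have "\<dots> \<le> (\<Sum>j<k. (1 - q) ^ m)" using pC by (intro sum_mono) auto
    finally show "prob (\<Union>j<k. C j) \<le> k * (1 - F (l / (2 * CARD('d))) ^ (2 * CARD('d))) ^ (card S div k)"
      by (simp add: q_def m_def)
    fix \<omega> assume \<omega>: "\<omega> \<in> space M - (\<Union>j<k. C j)"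
    then have "\<forall>j\<in>{..<k}. \<exists>x. x \<in> T j \<and> speed x \<omega> \<le> l" by (auto simp: C_def not_less)
    from bchoice[OF this] obtain x where x: "\<forall>j\<in>{..<k}. x j \<in> T j \<and> speed (x j) \<omega> \<le> l" ..
    have "inj_on x {..<k}"
    proof (rule linorder_inj_onI')
      fix i j assume ij: "i \<in> {..<k}" "j \<in> {..<k}" "i < j"
      then have "x i \<in> T i" "x j \<in> T j" using x by auto
      then show "x i \<noteq> x j" using Tdisj[of i j] ij by auto
    qed
    then have "card (x ` {..<k}) = k" by (simp add: card_image)
    moreover have "x ` {..<k} \<subseteq> {x \<in> S. speed x \<omega> \<le> l}" using x T(1) by auto
    then have "card (x ` {..<k}) \<le> card {x \<in> S. speed x \<omega> \<le> l}" using S by (intro card_mono) auto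
    ultimately show "k \<le> card {x \<in> S. speed x \<omega> \<le> l}" by simp
  qed
qed

end

section \<open>Regular variation and typical configurations\<close>

text \<open>Along N = 2^m a negative power of N is a geometric sequence, hence summable however
  small the exponent is.\<close>

lemma (in prob_space) borel_cantelli_geometric:
  assumes A: "\<And>m. A m \<in> events" and r: "0 < r"
    and le: "\<forall>\<^sub>F m in sequentially. prob (A m) \<le> C * (2 ^ m) powr (- r)"
  shows "AE \<omega> in M. \<forall>\<^sub>F m in sequentially. \<omega> \<notin> A m"
proof -
  have e: "(2 ^ m) powr (- r) = (2 powr (- r)) ^ m" for m :: nat
  proof -
    have "(2 ^ m) powr (- r) = (2 powr real m) powr (- r)" by (simp add: powr_realpow)
    also have "\<dots> = (2 powr (- r)) powr real m" by (simp add: powr_powr mult.commute)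
    finally show ?thesis by (simp add: powr_realpow)
  qed
  have "(2 :: real) powr (- r) < 2 powr 0" using r by (subst powr_less_cancel_iff) auto
  then have "summable (\<lambda>m. (2 powr (- r)) ^ m :: real)" by (intro summable_geometric) auto
  then have "summable (\<lambda>m. C * (2 ^ m) powr (- r))" unfolding e by (rule summable_mult)
  then have "summable (\<lambda>m. prob (A m))"
  proof (rule summable_comparison_test_ev[rotated])
    show "\<forall>\<^sub>F m in sequentially. norm (prob (A m)) \<le> C * (2 ^ m) powr (- r)" using le by simp
  qed
  then have "AE \<omega> in M. \<forall>\<^sub>F m in sequentially. \<omega> \<in> space M - A m"
    using A by (intro borel_cantelli_AE1) (auto simp: emeasure_eq_measure)
  then show ?thesis by (rule AE_mp) (auto intro!: AE_I2 elim: eventually_mono)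
qed

lemma regularly_varying_positive:
  assumes rv: "regularly_varying_at_zero F \<gamma>" and mono: "\<And>x y. x \<le> y \<Longrightarrow> F x \<le> F y" and nn: "\<And>x. 0 \<le> F x"
    and x: "0 < x"
  shows "0 < F x"
proof -
  \<comment> \<open>The ratio at scale 1 is not trivially 1: it is 0 where \<open>F t\<close>
    vanishes, as x / 0 = 0. Its limit 1 therefore forces positivity near zero.\<close>
  have "((\<lambda>t. F (t * 1) / F t) \<longlongrightarrow> 1 powr \<gamma>) (at_right 0)"
    using rv unfolding regularly_varying_at_zero_def by (meson zero_less_one)
  then have "\<forall>\<^sub>F t in at_right 0. 0 < F (t * 1) / F t" by (rule order_tendstoD) simp
  then obtain b where b: "0 < b" "\<And>t. 0 < t \<Longrightarrow> t < b \<Longrightarrow> 0 < F (t * 1) / F t"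
    unfolding eventually_at_right_field by blast
  define t where "t = min b x / 2"
  have t: "0 < t" "t < b" "t \<le> x" using b x by (auto simp: t_def)
  have "0 < F t" using b(2)[OF t(1,2)] nn[of t] by (cases "F t = 0") auto
  then show ?thesis using mono[OF t(3)] by linarith
qed

text \<open>One-sided Potter bound: iterate the halving estimate \<open>F(t/2) \<ge> 2\<^sup>-\<^sup>\<kappa> F(t)\<close>.\<close>
lemma potter_bound:
  assumes rv: "regularly_varying_at_zero F \<gamma>" and mono: "\<And>x y. x \<le> y \<Longrightarrow> F x \<le> F y" and nn: "\<And>x. 0 \<le> F x"
    and \<kappa>: "\<gamma> < \<kappa>" "0 < \<kappa>"
  obtains u0 where "0 < u0" "\<And>a b. 0 < a \<Longrightarrow> a \<le> b \<Longrightarrow> b \<le> u0 \<Longrightarrow> F b \<le> (2 * (b / a)) powr \<kappa> * F a"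
proof -
  have pos: "0 < F x" if "0 < x" for x
    by (rule regularly_varying_positive[OF rv]) (auto intro: mono nn that)
  have "((\<lambda>t. F (t * (1 / 2)) / F t) \<longlongrightarrow> (1 / 2) powr \<gamma>) (at_right 0)"
    using rv unfolding regularly_varying_at_zero_def by (meson half_gt_zero_iff zero_less_one)
  moreover have "(1 / 2 :: real) powr \<kappa> < (1 / 2) powr \<gamma>"
    using \<kappa> by (intro powr_less_mono') auto
  ultimately have "\<forall>\<^sub>F t in at_right 0. (1 / 2) powr \<kappa> < F (t * (1 / 2)) / F t"
    by (rule order_tendstoD(1))
  then obtain v where v: "0 < v" "\<And>t. 0 < t \<Longrightarrow> t < v \<Longrightarrow> (1 / 2) powr \<kappa> < F (t * (1 / 2)) / F t"
    unfolding eventually_at_right_field by blast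
  have half: "F t \<le> 2 powr \<kappa> * F (t / 2)" if t: "0 < t" "t \<le> v / 2" for t
  proof -
    have "(1 / 2) powr \<kappa> * F t < F (t / 2)" using v(2)[of t] v(1) t pos[OF t(1)] by (simp add: pos_less_divide_eq)
    then have "2 powr \<kappa> * ((1 / 2) powr \<kappa> * F t) \<le> 2 powr \<kappa> * F (t / 2)" by (intro mult_left_mono) auto
    moreover have "2 powr \<kappa> * (1 / 2 :: real) powr \<kappa> = 1" by (simp add: powr_mult[symmetric])
    ultimately show ?thesis by (simp add: mult.assoc[symmetric])
  qed
  have iter: "F t \<le> (2 powr \<kappa>) ^ m * F (t / 2 ^ m)" if t: "0 < t" "t \<le> v / 2" for t m
  proof (induction m)
    case (Suc m)
    have "t / 2 ^ m \<le> t / 1" using t by (intro divide_left_mono) auto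
    then have "t / 2 ^ m \<le> v / 2" using t(2) unfolding div_by_1 by (rule order_trans)
    then have "F (t / 2 ^ m) \<le> 2 powr \<kappa> * F (t / 2 ^ m / 2)" using t by (intro half) auto
    then have "(2 powr \<kappa>) ^ m * F (t / 2 ^ m) \<le> (2 powr \<kappa>) ^ m * (2 powr \<kappa> * F (t / 2 ^ m / 2))"
      by (intro mult_left_mono) auto
    from order_trans[OF Suc this] show ?case by (simp add: mult_ac)
  qed simp
  show ?thesis
  proof (rule that[of "v / 2"])
    fix a b assume ab: "0 < a" "a \<le> b" "b \<le> v / 2"
    \<comment> \<open>So many halvings bring \<open>b\<close> down to at most \<open>a\<close>;
      rounding up overshoots by at most a factor 2, which is the 2 in the bound.\<close>
    define m where "m = nat \<lceil>log 2 (b / a)\<rceil>"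
    have ba: "1 \<le> b / a" using ab by simp
    then have lg: "0 \<le> log 2 (b / a)" by simp
    then have m: "log 2 (b / a) \<le> m" "m \<le> log 2 (b / a) + 1" unfolding m_def by linarith+
    have "2 powr (log 2 (b / a)) \<le> 2 powr real m" using m by (intro powr_mono) auto
    then have m1: "b / a \<le> 2 ^ m" using ba by (simp add: powr_realpow)
    have "2 powr real m \<le> 2 powr (log 2 (b / a) + 1)" using m by (intro powr_mono) auto
    then have m2: "2 ^ m \<le> 2 * (b / a)" using ba by (simp add: powr_realpow powr_add mult.commute)
    have "b / 2 ^ m \<le> a" using m1 ab by (simp add: field_simps)
    have "F b \<le> (2 powr \<kappa>) ^ m * F (b / 2 ^ m)" using ab by (intro iter) auto
    also have "\<dots> \<le> (2 powr \<kappa>) ^ m * F a" using mono[OF \<open>b / 2 ^ m \<le> a\<close>] by (intro mult_left_mono) auto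
    also have "(2 powr \<kappa>) ^ m = (2 powr real m) powr \<kappa>"
      by (simp add: powr_power powr_powr mult.commute)
    also have "\<dots> = (2 ^ m) powr \<kappa>" by (simp add: powr_realpow)
    also have "(2 ^ m) powr \<kappa> * F a \<le> (2 * (b / a)) powr \<kappa> * F a"
      using m2 \<kappa> nn by (intro mult_right_mono powr_mono2) auto
    finally show "F b \<le> (2 * (b / a)) powr \<kappa> * F a" .
  qed (use v in simp)
qed

section \<open>Slow sites and the typical event at a dyadic scale\<close>

lemma speed_order_stat_le:
  fixes w :: "(int ^ 'd) set \<Rightarrow> real"
  assumes "1 \<le> k" "k \<le> card {x \<in> lattice_box n. local_speed w x \<le> L}"
  shows "k \<le> card (lattice_box n :: (int ^ 'd) set)" "speed_order_stat w n k \<le> L"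
proof -
  let ?B = "lattice_box n :: (int ^ 'd) set"
  have "card {x \<in> ?B. local_speed w x \<le> L} \<le> card ?B"
    by (intro card_mono) (auto simp: lattice_box_cube)
  then show kB: "k \<le> card ?B" using assms by simp
  obtain zs where zs: "speed_list w n zs" using speed_list_exists by blast
  then have len: "length zs = card ?B" using distinct_card by (fastforce simp: speed_list_def)
  have st: "speed_order_stat w n k = local_speed w (zs ! (k - 1))" using zs assms kB by (simp add: speed_list_def)
  show "speed_order_stat w n k \<le> L"
  proof (rule ccontr)
    assume "\<not> ?thesis"
    then have L: "L < local_speed w (zs ! (k - 1))" using st by simp
    have "{x \<in> ?B. local_speed w x \<le> L} \<subseteq> (!) zs ` {..<k - 1}"
    proof clarify
      fix x assume x: "x \<in> ?B" "local_speed w x \<le> L"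
      obtain h where h: "h < length zs" "x = zs ! h" using x(1) zs by (metis in_set_conv_nth speed_list_def)
      have "h < k - 1"
      proof (rule ccontr)
        assume "\<not> h < k - 1"
        then have "map (local_speed w) zs ! (k - 1) \<le> map (local_speed w) zs ! h"
          using h zs by (intro sorted_nth_mono) (auto simp: speed_list_def)
        then show False using h L x \<open>\<not> h < k - 1\<close> by simp
      qed
      then show "x \<in> (!) zs ` {..<k - 1}" using h by auto
    qed
    then have "card {x \<in> ?B. local_speed w x \<le> L} \<le> card ((!) zs ` {..<k - 1})" by (intro card_mono) auto
    also have "\<dots> \<le> k - 1" using card_image_le[of "{..<k - 1}" "(!) zs"] by simp
    finally show False using assms by linarith
  qed
qed

text \<open>Points with only even coordinates: adjacent sites differ by one in some coordinate. Each
  direction offers 2 (N div 2) + 1 >= N values.\<close>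

lemma sparse_sites:
  obtains S :: "(int ^ 'd) set" where "finite S" "S \<subseteq> lattice_box N" "N ^ CARD('d) \<le> card S"
    "\<And>x y. x \<in> S \<Longrightarrow> y \<in> S \<Longrightarrow> \<not> x \<sim>\<^sub>l y"
proof -
  define A where "A = (\<lambda>j :: int. 2 * j) ` {- int (N div 2)..int (N div 2)}"
  define S where "S = {x :: int ^ 'd. \<forall>i. x $ i \<in> A}"
  have A: "finite A" "card A = 2 * (N div 2) + 1"
    unfolding A_def by (auto simp: card_image inj_on_def nat_add_distrib)
  have "N \<le> card A" unfolding A(2) by linarith
  then have "N ^ CARD('d) \<le> card S"
    unfolding S_def using A by (subst card_vec_PiE(2)) (auto intro: power_mono)
  moreover have "S \<subseteq> lattice_box N"
  proof
    fix x assume x: "x \<in> S"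
    have "\<bar>x $ i\<bar> \<le> int N" for i
    proof -
      have "x $ i \<in> A" using x by (simp add: S_def)
      then obtain j where "x $ i = 2 * j" "\<bar>j\<bar> \<le> int (N div 2)" by (auto simp: A_def)
      then show ?thesis by linarith
    qed
    then show "x \<in> lattice_box N" by (simp add: lattice_box_def)
  qed
  moreover have "\<not> x \<sim>\<^sub>l y" if "x \<in> S" "y \<in> S" for x y
  proof
    assume "x \<sim>\<^sub>l y"
    then obtain k where "y = x + ax k \<or> y = x - ax k" unfolding nearest_neighbour_iff by blast
    then have "y $ k = x $ k + 1 \<or> y $ k = x $ k - 1" by (auto simp: axis_nth_if)
    moreover have "x $ k \<in> A" "y $ k \<in> A" using that by (simp_all add: S_def)
    then have "even (x $ k)" "even (y $ k)" by (auto simp: A_def)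
    ultimately show False by auto
  qed
  ultimately show ?thesis using that[of S] A card_vec_PiE(1)[of "\<lambda>_. A"] by (auto simp: S_def)
qed

context iid_conductances
begin

text \<open>Made to serve all boxes with N <= n < 2N: the bad patterns are absent from the larger
  regions (\<open>10 * N\<close> covers the radius 3n + 4), while the \<open>k\<close> slow sites
  are already present in the smaller box.\<close>

definition typical :: "nat \<Rightarrow> nat \<Rightarrow> nat \<Rightarrow> nat \<Rightarrow> real \<Rightarrow> real \<Rightarrow> real \<Rightarrow> real \<Rightarrow> 'a \<Rightarrow> bool" where
  "typical N J K k s t L \<eta> \<omega> \<longleftrightarrow>
     (\<forall>v\<in>cube 0 (10 * N). card (bonds_below (\<lambda>e. w e \<omega>) s v K) < J) \<and>
     (\<forall>v\<in>cube 0 (10 * N). card (bonds_below (\<lambda>e. w e \<omega>) t v K) < 3 * CARD('d)) \<and>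
     (\<forall>x\<in>lattice_box (2 * N). \<forall>y\<in>lattice_box (2 * N). x \<noteq> y \<and> \<not> x \<sim>\<^sub>l y \<and>
        speed x \<omega> \<le> 2 * L \<and> speed x \<omega> \<le> speed y \<omega> \<longrightarrow> (1 + 4 * \<eta>) * speed x \<omega> < speed y \<omega>) \<and>
     k \<le> card {x \<in> lattice_box N. speed x \<omega> \<le> L}"

text \<open>One summand for each clause of \<open>typical\<close>. The third sums
  \<open>close_speeds\<close> with threshold 2L over pairs of sites, hence the argument 6L.\<close>

lemma atypical_event:
  fixes s t L \<eta> a0 D :: real and K :: nat
  assumes \<eta>: "0 < \<eta>" "\<eta> \<le> 1 / 2" and L: "0 < L" "6 * L \<le> a0"
    and F: "\<And>a b. a \<le> a0 \<Longrightarrow> 0 \<le> b \<Longrightarrow> b \<le> 1 \<Longrightarrow> b * F a \<le> F (a * b)"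
  defines "D \<equiv> (2 :: real) ^ (card (cube (0 :: int ^ 'd) K) * CARD('d))"
  shows "\<exists>A\<in>events. (\<forall>\<omega>\<in>space M - A. typical N J K k s t L \<eta> \<omega>) \<and>
    prob A \<le> card (cube (0 :: int ^ 'd) (10 * N)) * D * F s ^ J
      + card (cube (0 :: int ^ 'd) (10 * N)) * D * F t ^ (3 * CARD('d))
      + (card (lattice_box (2 * N) :: (int ^ 'd) set))\<^sup>2 * (16 * CARD('d) * \<eta> * F (6 * L) ^ (4 * CARD('d)))
      + k * (1 - F (L / (2 * CARD('d))) ^ (2 * CARD('d))) ^ (N ^ CARD('d) div k)"
proof -
  obtain A1 where A1: "A1 \<in> events" "prob A1 \<le> card (cube (0 :: int ^ 'd) (10 * N)) * D * F s ^ J"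
    "\<And>\<omega> v. \<omega> \<in> space M \<Longrightarrow> \<omega> \<notin> A1 \<Longrightarrow> v \<in> cube 0 (10 * N) \<Longrightarrow> finite (cube (0 :: int ^ 'd) (10 * N)) \<Longrightarrow>
       card (bonds_below (\<lambda>e. w e \<omega>) s v K) < J"
    by (rule many_small_bonds[of "cube 0 (10 * N)" K s J]) (rule that, assumption, simp add: D_def, blast)
  obtain A2 where A2: "A2 \<in> events" "prob A2 \<le> card (cube (0 :: int ^ 'd) (10 * N)) * D * F t ^ (3 * CARD('d))"
    "\<And>\<omega> v. \<omega> \<in> space M \<Longrightarrow> \<omega> \<notin> A2 \<Longrightarrow> v \<in> cube 0 (10 * N) \<Longrightarrow> finite (cube (0 :: int ^ 'd) (10 * N)) \<Longrightarrow>
       card (bonds_below (\<lambda>e. w e \<omega>) t v K) < 3 * CARD('d)"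
    by (rule many_small_bonds[of "cube 0 (10 * N)" K t "3 * CARD('d)"]) (rule that, assumption, simp add: D_def, blast)
  let ?B = "lattice_box (2 * N) :: (int ^ 'd) set"
  define P where "P = {z \<in> ?B \<times> ?B. fst z \<noteq> snd z \<and> \<not> fst z \<sim>\<^sub>l snd z}"
  define C where "C = (\<lambda>z. {\<omega> \<in> space M. speed (fst z) \<omega> \<le> 2 * L \<and> speed (fst z) \<omega> \<le> speed (snd z) \<omega> \<and>
     speed (snd z) \<omega> \<le> (1 + 4 * \<eta>) * speed (fst z) \<omega>})"
  define A3 where "A3 = (\<Union>z\<in>P. C z)"
  define H where "H = 16 * CARD('d) * \<eta> * F (6 * L) ^ (4 * CARD('d))"
  have H0: "0 \<le> H" using \<eta> F_nonneg by (simp add: H_def)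
  have finB: "finite ?B" by (simp add: lattice_box_cube)
  have finP: "finite P" "card P \<le> (card ?B)\<^sup>2"
  proof -
    have sub: "P \<subseteq> ?B \<times> ?B" by (auto simp: P_def)
    then show "finite P" using finB by (meson finite_SigmaI finite_subset)
    have "card P \<le> card (?B \<times> ?B)" using sub finB by (intro card_mono) auto
    then show "card P \<le> (card ?B)\<^sup>2" by (simp add: card_cartesian_product power2_eq_square)
  qed
  have Cm: "C z \<in> events" for z unfolding C_def by measurable
  have A3: "A3 \<in> events" unfolding A3_def using finP Cm by (intro sets.finite_UN) auto
  have "prob A3 \<le> (\<Sum>z\<in>P. prob (C z))"
    unfolding A3_def using finP Cm by (intro finite_measure_subadditive_finite) auto
  also have "\<dots> \<le> (\<Sum>z\<in>P. H)"
  proof (rule sum_mono)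
    fix z assume "z \<in> P"
    then show "prob (C z) \<le> H"
      using close_speeds[OF _ _ \<eta>, of "fst z" "snd z" "2 * L" a0] L F unfolding C_def H_def P_def by simp
  qed
  also have "\<dots> \<le> (card ?B)\<^sup>2 * H"
  proof -
    have "real (card P) \<le> real ((card ?B)\<^sup>2)" using finP(2) by (simp only: of_nat_le_iff)
    then show ?thesis using H0 by (simp add: mult_right_mono)
  qed
  finally have pA3: "prob A3 \<le> (card ?B)\<^sup>2 * H" .
  obtain S :: "(int ^ 'd) set" where S: "finite S" "S \<subseteq> lattice_box N" "N ^ CARD('d) \<le> card S"
    "\<And>x y. x \<in> S \<Longrightarrow> y \<in> S \<Longrightarrow> \<not> x \<sim>\<^sub>l y"
    using sparse_sites by blast
  define q where "q = F (L / (2 * CARD('d))) ^ (2 * CARD('d))"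
  have q: "0 \<le> q" "q \<le> 1" using F_nonneg F_le1 by (auto simp: q_def power_le_one)
  obtain A4 where A4: "A4 \<in> events" "prob A4 \<le> k * (1 - q) ^ (card S div k)"
    "\<forall>\<omega>\<in>space M - A4. k \<le> card {x \<in> S. speed x \<omega> \<le> L}"
    using small_speeds_exist[of S k L] S(1,4) unfolding q_def by blast
  have pA4: "prob A4 \<le> k * (1 - q) ^ (N ^ CARD('d) div k)"
  proof -
    have "(1 - q) ^ (card S div k) \<le> (1 - q) ^ (N ^ CARD('d) div k)"
      using q S(3) by (intro power_decreasing div_le_mono) auto
    then have "k * (1 - q) ^ (card S div k) \<le> k * (1 - q) ^ (N ^ CARD('d) div k)" by (intro mult_left_mono) auto
    then show ?thesis using A4(2) by linarith
  qed
  define A where "A = A1 \<union> A2 \<union> A3 \<union> A4"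
  have "typical N J K k s t L \<eta> \<omega>" if \<omega>: "\<omega> \<in> space M - A" for \<omega>
    unfolding typical_def
  proof (intro conjI ballI impI)
    fix v :: "int ^ 'd" assume "v \<in> cube 0 (10 * N)"
    then show "card (bonds_below (\<lambda>e. w e \<omega>) s v K) < J" "card (bonds_below (\<lambda>e. w e \<omega>) t v K) < 3 * CARD('d)"
      using \<omega> by (auto intro!: A1(3) A2(3) simp: A_def)
  next
    fix x y :: "int ^ 'd" assume xy: "x \<in> ?B" "y \<in> ?B"
      "x \<noteq> y \<and> \<not> x \<sim>\<^sub>l y \<and> speed x \<omega> \<le> 2 * L \<and> speed x \<omega> \<le> speed y \<omega>"
    then have "(x, y) \<in> P" by (simp add: P_def)
    then have "\<omega> \<notin> C (x, y)" using \<omega> by (auto simp: A_def A3_def)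
    then show "(1 + 4 * \<eta>) * speed x \<omega> < speed y \<omega>" using xy \<omega> by (auto simp: C_def not_le)
  next
    have "k \<le> card {x \<in> S. speed x \<omega> \<le> L}" using \<omega> A4(3) by (auto simp: A_def)
    also have "\<dots> \<le> card {x \<in> lattice_box N. speed x \<omega> \<le> L}"
      using S by (intro card_mono) (auto simp: lattice_box_cube)
    finally show "k \<le> card {x \<in> lattice_box N. speed x \<omega> \<le> L}" .
  qed
  moreover have "A \<in> events" using A1 A2 A3 A4 by (simp add: A_def)
  moreover have "prob A \<le> prob A1 + prob A2 + prob A3 + prob A4"
    using measure_Un_le[of "A1 \<union> A2 \<union> A3" M A4] measure_Un_le[of "A1 \<union> A2" M A3] measure_Un_le[of A1 M A2]
      A1(1) A2(1) A3 A4(1) unfolding A_def by auto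
  ultimately show ?thesis using A1(2) A2(2) pA3 pA4 unfolding H_def q_def by (intro bexI[of _ A]) auto
qed

end

section \<open>Quantitative estimates along dyadic scales\<close>

lemma tendsto_dyadic_powr: "0 < a \<Longrightarrow> (\<lambda>m. ((2 :: real) ^ m) powr (- a)) \<longlonglongrightarrow> 0"
proof (rule tendsto_neg_powr)
  have "filterlim (\<lambda>m. (2 :: real) ^ m) at_infinity sequentially"
    by (rule filterlim_realpow_sequentially_gt1) simp
  then show "filterlim (\<lambda>m. (2 :: real) ^ m) at_top sequentially"
    by (rule filterlim_at_infinity_imp_filterlim_at_top) simp
qed simp

lemma eventually_dyadic_powr_less:
  "0 < a \<Longrightarrow> 0 < c \<Longrightarrow> \<forall>\<^sub>F m in sequentially. ((2 :: real) ^ m) powr (- a) < c"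
  using tendsto_dyadic_powr order_tendstoD(2) by blast

lemma quantile_exists:
  fixes F :: "real \<Rightarrow> real"
  assumes "continuous_on UNIV F" "F 0 = 0" "0 < y" "y < F u" "0 < u"
  shows "\<exists>x. 0 < x \<and> x < u \<and> F x = y"
proof -
  have "\<exists>x. 0 \<le> x \<and> x \<le> u \<and> F x = y"
    using assms by (intro IVT') (auto intro: continuous_on_subset)
  then obtain x where x: "0 \<le> x" "x \<le> u" "F x = y" by blast
  moreover have "x \<noteq> 0" "x \<noteq> u" using x assms by auto
  ultimately show ?thesis by (intro exI[of _ x]) auto
qed

text \<open>The Potter bound read backwards: F(b) / F(a) = X^(\<open>\<alpha>\<close> -
  \<open>\<beta>\<close>) can only be this large if b / a is at least X^c / 2.\<close>

lemma quantile_ratio: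
  fixes X :: real
  assumes F: "F b \<le> (2 * (b / a)) powr \<kappa> * F a" and Fa: "F a = X powr (- \<alpha>)" and Fb: "F b = X powr (- \<beta>)"
    and ab: "0 < a" "0 < b" and X: "1 \<le> X" and \<kappa>: "0 < \<kappa>" and c: "c * \<kappa> \<le> \<alpha> - \<beta>"
  shows "a / b \<le> 2 * X powr (- c)"
proof -
  have X0: "0 < X powr z" for z using X by simp
  have "X powr (\<alpha> - \<beta>) = X powr (- \<beta>) / X powr (- \<alpha>)" by (simp add: powr_diff powr_minus field_simps)
  also have "\<dots> \<le> (2 * (b / a)) powr \<kappa>" using F X0[of "- \<alpha>"] unfolding Fa Fb by (simp add: field_simps)
  finally have 1: "X powr (\<alpha> - \<beta>) \<le> (2 * (b / a)) powr \<kappa>" .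
  have "(X powr c) powr \<kappa> \<le> X powr (\<alpha> - \<beta>)" unfolding powr_powr using c X by (intro powr_mono) auto
  with 1 have "(X powr c) powr \<kappa> \<le> (2 * (b / a)) powr \<kappa>" by linarith
  then have "X powr c \<le> 2 * (b / a)"
    using powr_less_mono2[OF \<kappa>, of "2 * (b / a)" "X powr c"] ab by (force simp: not_le[symmetric])
  then show ?thesis using ab X0[of c] by (simp add: powr_minus field_simps)
qed

text \<open>(2n + 2)^2 L / s is at most 32 X^-\<open>\<epsilon>\<close> and L / t at most 2
  X^(-1/3); as \<open>\<epsilon>\<close> < 1, together they are at most 34
  X^(-\<open>\<epsilon>\<close>/3). The factor \<open>\<eta>\<close>^-2 costs X^(2
  \<open>\<epsilon>\<close>/25), and -1/3 + 2/25 = -19/75.\<close>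

lemma gap_to_error:
  fixes X \<epsilon> \<delta> c P s t L n D :: real
  assumes X: "1 \<le> X" and n: "0 \<le> n" "n + 1 \<le> 2 * X" and pos: "0 < s" "0 < t" "0 < L" and P: "0 \<le> P" and D: "0 \<le> D"
    and s: "L / s \<le> 2 * X powr (- (2 + \<epsilon>))" and t: "L / t \<le> 2 * X powr (- (1 / 3))"
    and \<epsilon>: "0 < \<epsilon>" "\<epsilon> < 1"
  shows "P * ((2 * n + 2)\<^sup>2 / s + 1 / t) * L * (1 + D / (X powr (- (\<epsilon> / 25)))\<^sup>2)
    \<le> P * 34 * (1 + D) * X powr (- (19 * \<epsilon> / 75))"
proof -
  have "(2 * n + 2)\<^sup>2 \<le> (4 * X)\<^sup>2" using n by (intro power_mono) auto
  then have "(2 * n + 2)\<^sup>2 * (L / s) \<le> (16 * X powr 2) * (2 * X powr (- (2 + \<epsilon>)))"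
    using s pos X by (intro mult_mono) (auto simp: power_mult_distrib)
  also have "\<dots> = 32 * (X powr 2 * X powr (- (2 + \<epsilon>)))" by simp
  also have "\<dots> = 32 * X powr (- \<epsilon>)" unfolding powr_add[symmetric] by simp
  also have "\<dots> \<le> 32 * X powr (- (\<epsilon> / 3))" using X \<epsilon> by (intro mult_left_mono powr_mono) auto
  finally have 1: "(2 * n + 2)\<^sup>2 * (L / s) \<le> 32 * X powr (- (\<epsilon> / 3))" .
  have "X powr (- (1 / 3)) \<le> X powr (- (\<epsilon> / 3))" using X \<epsilon> by (intro powr_mono) auto
  then have 2: "L / t \<le> 2 * X powr (- (\<epsilon> / 3))" using t by linarith
  have 3: "((2 * n + 2)\<^sup>2 / s + 1 / t) * L \<le> 34 * X powr (- (\<epsilon> / 3))"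
    using 1 2 by (simp add: algebra_simps)
  have "1 + D / (X powr (- (\<epsilon> / 25)))\<^sup>2 = 1 + D * X powr (2 * \<epsilon> / 25)"
  proof -
    have "(X powr (- (\<epsilon> / 25)))\<^sup>2 = X powr (- (2 * \<epsilon> / 25))" using X by (simp add: powr_power)
    then show ?thesis by (simp add: powr_minus_divide)
  qed
  also have "\<dots> \<le> (1 + D) * X powr (2 * \<epsilon> / 25)"
    using X \<epsilon> by (simp add: distrib_right ge_one_powr_ge_zero)
  finally have 4: "1 + D / (X powr (- (\<epsilon> / 25)))\<^sup>2 \<le> (1 + D) * X powr (2 * \<epsilon> / 25)" .
  have "(((2 * n + 2)\<^sup>2 / s + 1 / t) * L) * (1 + D / (X powr (- (\<epsilon> / 25)))\<^sup>2)
      \<le> (34 * X powr (- (\<epsilon> / 3))) * ((1 + D) * X powr (2 * \<epsilon> / 25))"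
    by (rule mult_mono[OF 3 4]) (use D in auto)
  also have "\<dots> = 34 * (1 + D) * (X powr (- (\<epsilon> / 3)) * X powr (2 * \<epsilon> / 25))" by simp
  also have "X powr (- (\<epsilon> / 3)) * X powr (2 * \<epsilon> / 25) = X powr (- (19 * \<epsilon> / 75))"
    unfolding powr_add[symmetric] by (rule arg_cong[of _ _ "(powr) X"]) simp
  finally have "P * ((((2 * n + 2)\<^sup>2 / s + 1 / t) * L) * (1 + D / (X powr (- (\<epsilon> / 25)))\<^sup>2))
      \<le> P * (34 * (1 + D) * X powr (- (19 * \<epsilon> / 75)))"
    using P by (rule mult_left_mono)
  then show ?thesis by (simp only: mult.assoc)
qed

lemma prob_bound_bonds:
  fixes X D F c r \<theta> :: real and e j :: nat
  assumes X: "1 \<le> X" and D: "0 \<le> D" and c: "c \<le> (21 * X) ^ e" and F: "F = X powr (- \<theta>)"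
    and j: "real e + r \<le> \<theta> * real j"
  shows "c * D * F ^ j \<le> 21 ^ e * D * X powr (- r)"
proof -
  have "c * D * F ^ j \<le> (21 * X) ^ e * D * F ^ j"
    using c D F by (intro mult_right_mono) auto
  also have "\<dots> = 21 ^ e * D * (X powr real e * X powr (- (\<theta> * real j)))"
    using X unfolding F by (simp add: power_mult_distrib powr_realpow powr_power mult_ac)
  also have "\<dots> \<le> 21 ^ e * D * X powr (- r)"
    unfolding powr_add[symmetric] using X D j by (intro mult_left_mono powr_mono) auto
  finally show ?thesis .
qed

text \<open>The powers of X add up to 2e - \<open>\<delta>\<close> - 2e + 4e \<open>\<tau>\<close>:
  the number of pairs is cancelled by the rarity of two slow sites, and only the smallness of the
  gap remains.\<close>

lemma prob_bound_gaps:
  fixes X C c F \<tau> \<delta> :: real and e :: nat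
  assumes X: "1 \<le> X" and c: "0 \<le> c" "c \<le> (5 * X) ^ e" and F: "0 \<le> F" "F \<le> C * X powr (- 1 / 2 + \<tau>)"
    and \<tau>: "4 * e * \<tau> \<le> \<delta> / 2"
  shows "c\<^sup>2 * (16 * real e * X powr (- \<delta>) * F ^ (4 * e)) \<le> 25 ^ e * 16 * real e * C ^ (4 * e) * X powr (- (\<delta> / 2))"
proof -
  have "F ^ (4 * e) \<le> (C * X powr (- 1 / 2 + \<tau>)) ^ (4 * e)" using F by (intro power_mono) auto
  also have "\<dots> = C ^ (4 * e) * X powr (real (4 * e) * (- 1 / 2 + \<tau>))"
    using X by (simp add: power_mult_distrib powr_power)
  finally have 1: "F ^ (4 * e) \<le> C ^ (4 * e) * X powr (real (4 * e) * (- 1 / 2 + \<tau>))" .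
  have "c\<^sup>2 \<le> ((5 * X) ^ e)\<^sup>2" using c by (intro power_mono)
  also have "\<dots> = 25 ^ e * X powr real (2 * e)"
  proof -
    have "((5 * X) ^ e)\<^sup>2 = ((5 * X)\<^sup>2) ^ e" by (simp only: power_mult[symmetric] mult.commute)
    also have "\<dots> = 25 ^ e * (X\<^sup>2) ^ e" by (simp add: power_mult_distrib)
    also have "(X\<^sup>2) ^ e = X powr real (2 * e)" using X by (subst powr_realpow) (auto simp: power_mult)
    finally show ?thesis .
  qed
  finally have 2: "c\<^sup>2 \<le> 25 ^ e * X powr real (2 * e)" .
  have "c\<^sup>2 * (16 * real e * X powr (- \<delta>) * F ^ (4 * e))
      \<le> (25 ^ e * X powr real (2 * e)) * (16 * real e * X powr (- \<delta>) * (C ^ (4 * e) * X powr (real (4 * e) * (- 1 / 2 + \<tau>))))"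
    using 1 2 F by (intro mult_mono mult_nonneg_nonneg) auto
  also have "\<dots> = 25 ^ e * 16 * real e * C ^ (4 * e) * (X powr real (2 * e) * X powr (- \<delta>) * X powr (real (4 * e) * (- 1 / 2 + \<tau>)))"
    by (simp add: mult_ac)
  also have "\<dots> \<le> 25 ^ e * 16 * real e * C ^ (4 * e) * X powr (- (\<delta> / 2))"
  proof (rule mult_left_mono)
    show "X powr real (2 * e) * X powr (- \<delta>) * X powr (real (4 * e) * (- 1 / 2 + \<tau>)) \<le> X powr (- (\<delta> / 2))"
      unfolding powr_add[symmetric] using X \<tau> by (intro powr_mono) (auto simp: algebra_simps)
  qed (simp add: zero_le_even_power)
  finally show ?thesis .
qed

text \<open>Polynomial decay suffices, so (1 - q)^m <= exp(-qm) is followed by the crude exp(-y) <=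
  1/y. The condition \<open>2 * k \<le> N\<close> makes the integer division lose at most a factor
  2.\<close>

lemma prob_bound_traps:
  fixes X q c \<tau> :: real and e k N :: nat
  assumes X: "X = real N" and N: "1 \<le> N" "2 * k \<le> N" and k: "1 \<le> k" and e: "1 \<le> e"
    and q: "q \<le> 1" "c * X powr (- real e + \<tau>) \<le> q" and c: "0 < c"
  shows "k * (1 - q) ^ (N ^ e div k) \<le> 2 * k\<^sup>2 / c * X powr (- \<tau>)"
proof -
  have X1: "1 \<le> X" using X N by simp
  define m where "m = N ^ e div k"
  have "2 * k \<le> N ^ e" using N e self_le_power[of N e] by linarith
  then have "real (2 * k) \<le> real (N ^ e)" by (simp only: of_nat_le_iff)
  moreover have "real (N ^ e) < (real m + 1) * k"
  proof -
    have "N ^ e < (m + 1) * k" unfolding m_def using k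
      by (metis Suc_eq_plus1 dividend_less_div_times mult.commute mult_Suc add.commute less_eq_Suc_le zero_less_Suc not_gr_zero One_nat_def not_less_zero)
    then have "real (N ^ e) < real ((m + 1) * k)" by (simp only: of_nat_less_iff)
    then show ?thesis by (simp add: algebra_simps)
  qed
  ultimately have "X ^ e \<le> 2 * k * m" using X k by (simp add: algebra_simps)
  then have m: "X powr real e / (2 * k) \<le> m" using X1 k by (simp add: powr_realpow field_simps)
  have "0 < c * X powr (- real e + \<tau>)" using c X1 by simp
  then have q0: "0 < q" using q by linarith
  have "c / (2 * k) * X powr \<tau> = (c * X powr (- real e + \<tau>)) * (X powr real e / (2 * k))"
    using X1 by (simp add: powr_add[symmetric] field_simps)
  also have "\<dots> \<le> q * m" using m q q0 by (intro mult_mono) auto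
  finally have qm: "c / (2 * k) * X powr \<tau> \<le> q * m" .
  have y: "0 < c / (2 * k) * X powr \<tau>" using c k X1 by simp
  have "(1 - q) ^ m \<le> exp (- q) ^ m" using q exp_ge_add_one_self[of "- q"] by (intro power_mono) auto
  also have "\<dots> = exp (- (q * m))" by (simp add: exp_of_nat_mult[symmetric] mult.commute)
  also have "\<dots> \<le> inverse (c / (2 * k) * X powr \<tau>)"
  proof -
    have "c / (2 * k) * X powr \<tau> \<le> exp (q * m)" using qm exp_ge_add_one_self[of "q * m"] by linarith
    then show ?thesis unfolding exp_minus using y by (intro le_imp_inverse_le)
  qed
  also have "\<dots> = 2 * k / c * X powr (- \<tau>)" by (simp add: powr_minus field_simps)
  finally have "k * (1 - q) ^ m \<le> k * (2 * k / c * X powr (- \<tau>))" by (intro mult_left_mono) auto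
  then show ?thesis by (simp add: m_def power2_eq_square mult_ac)
qed

section \<open>Almost sure localization\<close>

lemma cube_mono: "m \<le> n \<Longrightarrow> cube (v :: int ^ 'd) m \<subseteq> cube v n"
  by (auto simp: cube_def intro: order_trans)

context iid_conductances
begin

lemma AE_all_bonds_pos: "AE \<omega> in M. \<forall>u k. 0 < w (bond u k) \<omega>"
proof -
  have "AE \<omega> in M. 0 < w (bond u k) \<omega>" for u :: "int ^ 'd" and k
    by (rule positive) simp
  then show ?thesis by (simp add: AE_all_countable)
qed

lemma typical_localization:
  fixes \<epsilon> X :: real and p q :: 'd
  assumes ty: "typical N J k' k s t L \<eta> \<omega>" and k': "k' = J + 1"
    and pos: "\<And>u j. 0 < w (bond u j) \<omega>"
    and eig: "dirichlet_eigensystem (\<lambda>e. w e \<omega>) n lam psi"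
    and n: "N \<le> n" "n < 2 * N" and J: "1 \<le> J" and k: "1 \<le> k" and pq: "p \<noteq> q"
    and par: "0 < t" "t \<le> s" "0 < L" "6 * L < t" and \<eta>: "\<eta> = X powr (- (\<epsilon> / 25))" "\<eta> \<le> 1 / 2"
    and X: "X = real N" and eps: "0 < \<epsilon>" "\<epsilon> < 1"
    and s: "L / s \<le> 2 * X powr (- (2 + \<epsilon>))" and t: "L / t \<le> 2 * X powr (- (1 / 3))"
    and nu: "(CARD('d) + 1) * 50 * (2 * real k' * CARD('d))\<^sup>2 * (2 * k' + 1) ^ CARD('d) * 34 * (1 + real (2 * CARD('d)))
        * X powr (- (19 * \<epsilon> / 75)) \<le> \<nu>" "\<nu> < 1 / 2"
  shows "1 - sqrt \<nu> \<le> lam k / speed_order_stat (\<lambda>e. w e \<omega>) n k \<and>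
    lam k / speed_order_stat (\<lambda>e. w e \<omega>) n k \<le> 1 \<and>
    sqrt (1 - \<nu>) \<le> psi k (speed_site (\<lambda>e. w e \<omega>) n k)"
proof -
  let ?w = "\<lambda>e. w e \<omega>"
  have N: "1 \<le> N" using n by simp
  interpret G: lattice_geometry ?w s t J k' p q
    using pq J k' par pos by unfold_locales auto
  have boxes: "lattice_box n \<subseteq> (lattice_box (2 * N) :: (int ^ 'd) set)"
    "lattice_box N \<subseteq> (lattice_box n :: (int ^ 'd) set)"
    "cube 0 (3 * n + 4) \<subseteq> (cube 0 (10 * N) :: (int ^ 'd) set)"
    unfolding lattice_box_cube using n N by (auto intro!: cube_mono)
  have "card {x \<in> lattice_box N. speed x \<omega> \<le> L} \<le> card {x \<in> lattice_box n. speed x \<omega> \<le> L}"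
    using boxes(2) by (intro card_mono) (auto simp: lattice_box_cube)
  then have kc: "k \<le> card {x \<in> lattice_box n. speed x \<omega> \<le> L}" using ty unfolding typical_def by linarith
  have \<eta>0: "0 < \<eta>" unfolding \<eta>(1) X using N by simp
  have P: "G.poincare_const = (CARD('d) + 1) * 50 * (2 * real k' * CARD('d))\<^sup>2 * (2 * k' + 1) ^ CARD('d)"
    by (simp add: G.poincare_const_def G.path_bound_def)
  have "G.poincare_const * ((2 * real n + 2)\<^sup>2 / s + 1 / t) * L * (1 + 2 * CARD('d) / \<eta>\<^sup>2)
      \<le> G.poincare_const * 34 * (1 + real (2 * CARD('d))) * X powr (- (19 * \<epsilon> / 75))"
    unfolding \<eta>(1)
  proof (rule gap_to_error)
    have "real (n + 1) \<le> real (2 * N)" using n by (simp only: of_nat_le_iff)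
    then show "real n + 1 \<le> 2 * X" by (simp add: X)
    show "0 \<le> G.poincare_const" by (simp add: P)
  qed (use N par s t eps X in auto)
  also have "\<dots> \<le> \<nu>" using nu(1) by (simp add: P add.commute)
  finally have nu': "G.poincare_const * ((2 * real n + 2)\<^sup>2 / s + 1 / t) * L * (1 + 2 * CARD('d) / \<eta>\<^sup>2) \<le> \<nu>" .
  interpret E: box_eigen ?w s t J k' p q n k lam psi L \<eta> \<nu>
  proof unfold_locales
    show "dirichlet_eigensystem ?w n lam psi" by (fact eig)
    fix v :: "int ^ 'd" assume "v \<in> cube 0 (3 * n + 4)"
    then have "v \<in> cube 0 (10 * N)" using boxes(3) by blast
    then show "card (bonds_below ?w s v k') < J" "card (bonds_below ?w t v k') < 3 * CARD('d)"
      using ty unfolding typical_def by blast+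
  next
    fix x y :: "int ^ 'd"
    assume "x \<in> lattice_box n" "y \<in> lattice_box n" "x \<noteq> y" "\<not> x \<sim>\<^sub>l y" "speed x \<omega> \<le> 2 * L" "speed x \<omega> \<le> speed y \<omega>"
    then show "(1 + 4 * \<eta>) * speed x \<omega> < speed y \<omega>"
      using ty boxes(1) unfolding typical_def by blast
  qed (use k speed_order_stat_le[OF k kc] par \<eta> \<eta>0 nu nu' in auto)
  show ?thesis using E.localization by blast
qed

lemma dyadic_typical:
  fixes \<gamma> \<epsilon>\<^sub>1 :: real and k :: nat
  assumes F_cont: "continuous_on UNIV F"
    and gamma: "0 \<le> \<gamma>" "\<gamma> * (2 + \<epsilon>\<^sub>1) < 1 / 2"
    and F_regvar: "regularly_varying_at_zero F \<gamma>"
    and F_lower: "\<exists>a_star>0. \<forall>a\<le>a_star. \<forall>b. 0 \<le> b \<and> b \<le> 1 \<longrightarrow> F (a * b) \<ge> b * F a"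
    and eps1: "0 < \<epsilon>\<^sub>1" "\<epsilon>\<^sub>1 < 1" and k: "1 \<le> k"
  obtains J s t L where "1 \<le> J"
    "AE \<omega> in M. \<forall>\<^sub>F m in sequentially. typical (2 ^ m) J (J + 1) k (s m) (t m) (L m) ((2 ^ m) powr (- (\<epsilon>\<^sub>1 / 25))) \<omega>"
    "\<forall>\<^sub>F m in sequentially. 0 < t m \<and> t m \<le> s m \<and> 0 < L m \<and> 6 * L m < t m \<and>
       L m / s m \<le> 2 * (2 ^ m) powr (- (2 + \<epsilon>\<^sub>1)) \<and> L m / t m \<le> 2 * (2 ^ m) powr (- (1 / 3)) \<and>
       (2 ^ m) powr (- (\<epsilon>\<^sub>1 / 25)) \<le> (1 / 2 :: real)"
proof -
  define d where "d = CARD('d)"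
  have d1: "1 \<le> d" by (simp add: d_def Suc_le_eq)
  obtain a0 where a0: "0 < a0" and low: "\<And>a b. a \<le> a0 \<Longrightarrow> 0 \<le> b \<Longrightarrow> b \<le> 1 \<Longrightarrow> b * F a \<le> F (a * b)"
    using F_lower by blast
  \<comment> \<open>The midpoint of \<open>\<gamma>\<close> and 1 / (2 (2 +
    \<open>\<epsilon>\<^sub>1\<close>)): above \<open>\<gamma>\<close> as Potter's bound requires,
    yet with \<open>\<kappa>\<close> (2 + \<open>\<epsilon>\<^sub>1\<close>) < 1/2, which also
    forces \<open>\<kappa>\<close> < 1/4.\<close>
  define \<kappa> where "\<kappa> = (\<gamma> + 1 / (2 * (2 + \<epsilon>\<^sub>1))) / 2"
  have g': "\<gamma> < 1 / (2 * (2 + \<epsilon>\<^sub>1))" using gamma eps1 by (simp add: field_simps)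
  have \<kappa>: "\<gamma> < \<kappa>" "\<kappa> < 1 / (2 * (2 + \<epsilon>\<^sub>1))" using g' unfolding \<kappa>_def by simp_all
  have \<kappa>0: "0 < \<kappa>" using \<kappa> gamma by linarith
  have \<kappa>2: "\<kappa> * (2 + \<epsilon>\<^sub>1) < 1 / 2" using \<kappa>(2) eps1 by (simp add: field_simps)
  have \<kappa>4: "\<kappa> < 1 / 4"
  proof -
    have "1 / (2 * (2 + \<epsilon>\<^sub>1)) \<le> 1 / 4" using eps1 by (intro divide_left_mono) auto
    then show ?thesis using \<kappa> by linarith
  qed
  obtain u0 where u0: "0 < u0" and potter: "\<And>a b. 0 < a \<Longrightarrow> a \<le> b \<Longrightarrow> b \<le> u0 \<Longrightarrow> F b \<le> (2 * (b / a)) powr \<kappa> * F a"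
    using potter_bound[OF F_regvar F_mono F_nonneg \<kappa>(1) \<kappa>0] by blast
  \<comment> \<open>Quantiles below \<open>u1\<close> stay in the range of both the Potter bound and
    the scaling assumption even after multiplication by 6.\<close>
  define u1 where "u1 = min u0 a0 / 12"
  have u1: "0 < u1" "12 * u1 \<le> u0" "12 * u1 \<le> a0" using u0 a0 by (auto simp: u1_def)
  have Fpos: "0 < F x" if "0 < x" for x
    by (rule regularly_varying_positive[OF F_regvar]) (auto intro: F_mono F_nonneg that)
  define g where "g = 1 / 2 - \<kappa> * (2 + \<epsilon>\<^sub>1)"
  have g: "0 < g" using \<kappa>2 by (simp add: g_def)
  define \<delta> where "\<delta> = \<epsilon>\<^sub>1 / 25"
  have \<delta>: "0 < \<delta>" using eps1 by (simp add: \<delta>_def)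
  \<comment> \<open>The bound 1/24 leaves 1/2 - \<open>\<tau>\<close> - 3/8 >= 1/12 >
    \<open>\<kappa>\<close>/3 for L / t. The bound \<open>\<delta>\<close>/(8d) is for the near
    ties. The bound g/2, with the same one on \<open>\<theta>\<close>, leaves
    \<open>\<kappa>\<close> (2 + \<open>\<epsilon>\<^sub>1\<close>) <= 1/2 - \<open>\<tau>\<close> -
    \<open>\<theta>\<close> for L / s.\<close>
  define \<tau> where "\<tau> = min (1 / 24) (min (\<delta> / (8 * d)) (g / 2))"
  define \<theta> where "\<theta> = min (1 / 4) (g / 2)"
  have \<tau>: "0 < \<tau>" "\<tau> \<le> 1 / 24" "\<tau> \<le> \<delta> / (8 * d)" "\<tau> \<le> g / 2" using \<delta> g d1 by (auto simp: \<tau>_def)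
  have \<theta>: "0 < \<theta>" "\<theta> \<le> 1 / 4" "\<theta> \<le> g / 2" using g by (auto simp: \<theta>_def)
  \<comment> \<open>Large enough that X^d cubes times F(s)^J is at most X^-1, up to a
    constant.\<close>
  define J where "J = nat \<lceil>(real d + 1) / \<theta>\<rceil>"
  have J\<theta>: "real d + 1 \<le> \<theta> * J"
  proof -
    have "(real d + 1) / \<theta> \<le> real J" unfolding J_def by linarith
    then show ?thesis using \<theta> by (simp add: field_simps)
  qed
  have J1: "1 \<le> J" using J\<theta> by (cases J) auto
  define qf where "qf = (\<lambda>y. SOME x. 0 < x \<and> x < u1 \<and> F x = y)"
  have qf: "0 < qf y \<and> qf y < u1 \<and> F (qf y) = y" if "0 < y" "y < F u1" for y
    unfolding qf_def using quantile_exists[OF F_cont F_zero that u1(1)] by (rule someI_ex)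
  define X where "X = (\<lambda>m :: nat. (2 :: real) ^ m)"
  have X1: "1 \<le> X m" for m by (simp add: X_def)
  define s where "s = (\<lambda>m. qf (X m powr (- \<theta>)))"
  define t where "t = (\<lambda>m. qf (X m powr (- (3 / 8))))"
  define L where "L = (\<lambda>m. qf (X m powr (- (1 / 2 - \<tau>))))"
  define \<eta> where "\<eta> = (\<lambda>m. X m powr (- \<delta>))"
  define good where "good = (\<lambda>m.
      0 < s m \<and> s m < u1 \<and> F (s m) = X m powr (- \<theta>) \<and> 0 < t m \<and> t m < u1 \<and> F (t m) = X m powr (- (3 / 8)) \<and>
      0 < L m \<and> L m < u1 \<and> F (L m) = X m powr (- (1 / 2 - \<tau>)) \<and>
      \<eta> m \<le> 1 / 2 \<and> X m powr (- (1 / 3)) < 1 / 12 \<and> 2 * k \<le> (2 :: nat) ^ m \<and> 1 < X m)"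
  have ev_good: "\<forall>\<^sub>F m in sequentially. good m"
  proof -
    have "\<forall>\<^sub>F m in sequentially. X m powr (- \<theta>) < F u1"
      "\<forall>\<^sub>F m in sequentially. X m powr (- (3 / 8)) < F u1"
      "\<forall>\<^sub>F m in sequentially. X m powr (- (1 / 2 - \<tau>)) < F u1"
      "\<forall>\<^sub>F m in sequentially. \<eta> m < 1 / 2" "\<forall>\<^sub>F m in sequentially. X m powr (- (1 / 3)) < 1 / 12"
      unfolding X_def \<eta>_def 
      by (rule eventually_dyadic_powr_less; use \<theta> \<tau> \<delta> Fpos[OF u1(1)] in simp)+
    moreover have "\<forall>\<^sub>F m in sequentially. 2 * k \<le> (2 :: nat) ^ m"
    proof (rule eventually_sequentiallyI)
      fix m assume "2 * k \<le> m"
      then show "2 * k \<le> (2 :: nat) ^ m" using less_exp[of m] by linarith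
    qed
    moreover have "\<forall>\<^sub>F m in sequentially. 1 < X m"
      by (rule eventually_sequentiallyI[of 1]) (simp add: X_def)
    ultimately show ?thesis
    proof eventually_elim
      case (elim m)
      have y: "0 < X m powr z" for z using X1[of m] by simp
      show ?case using qf[OF y elim(1)] qf[OF y elim(2)] qf[OF y elim(3)] elim(4-)
        unfolding good_def s_def t_def L_def by simp
    qed
  qed
  have ord: "L m \<le> t m" "t m \<le> s m" if "good m" for m
  proof -
    have lt: "x \<le> y" if "F x < F y" for x y using F_mono[of y x] that by (cases "x \<le> y") auto
    have "X m powr (- (1 / 2 - \<tau>)) < X m powr (- (3 / 8))" "X m powr (- (3 / 8)) < X m powr (- \<theta>)"
      using that \<tau> \<theta> unfolding good_def by (auto intro!: powr_less_mono)
    then show "L m \<le> t m" "t m \<le> s m" using that unfolding good_def by (auto intro!: lt)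
  qed
  have rat: "L m / s m \<le> 2 * X m powr (- (2 + \<epsilon>\<^sub>1))" "L m / t m \<le> 2 * X m powr (- (1 / 3))" if gm: "good m" for m
  proof -
    note G = gm[unfolded good_def]
    have ps: "F (s m) \<le> (2 * (s m / L m)) powr \<kappa> * F (L m)" and pt: "F (t m) \<le> (2 * (t m / L m)) powr \<kappa> * F (L m)"
      using G ord[OF gm] u1 by (intro potter; linarith)+
    have FL: "F (L m) = X m powr (- (1 / 2 - \<tau>))" and Fs: "F (s m) = X m powr (- \<theta>)" and Ft: "F (t m) = X m powr (- (3 / 8))"
      and p: "0 < L m" "0 < s m" "0 < t m" using G by blast+
    show "L m / s m \<le> 2 * X m powr (- (2 + \<epsilon>\<^sub>1))"
      by (rule quantile_ratio[OF ps FL Fs p(1,2) X1 \<kappa>0]) (use \<tau> \<theta> in \<open>simp add: g_def mult.commute\<close>)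
    show "L m / t m \<le> 2 * X m powr (- (1 / 3))"
      by (rule quantile_ratio[OF pt FL Ft p(1,3) X1 \<kappa>0]) (use \<tau> \<kappa>4 in simp)
  qed
  define D where "D = (2 :: real) ^ (card (cube (0 :: int ^ 'd) (J + 1)) * CARD('d))"
  define bound where "bound = (\<lambda>m. card (cube (0 :: int ^ 'd) (10 * 2 ^ m)) * D * F (s m) ^ J
      + card (cube (0 :: int ^ 'd) (10 * 2 ^ m)) * D * F (t m) ^ (3 * CARD('d))
      + (card (lattice_box (2 * 2 ^ m) :: (int ^ 'd) set))\<^sup>2 * (16 * CARD('d) * \<eta> m * F (6 * L m) ^ (4 * CARD('d)))
      + k * (1 - F (L m / (2 * CARD('d))) ^ (2 * CARD('d))) ^ ((2 ^ m) ^ CARD('d) div k))"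
  \<comment> \<open>For the finitely many \<open>m\<close> that are not good, any event will
    do.\<close>
  have "\<exists>A. A \<in> events \<and> (good m \<longrightarrow> prob A \<le> bound m \<and>
      (\<forall>\<omega>\<in>space M - A. typical (2 ^ m) J (J + 1) k (s m) (t m) (L m) (\<eta> m) \<omega>))" for m
  proof (cases "good m")
    case True
    have "0 < \<eta> m" using X1[of m] by (simp add: \<eta>_def)
    moreover have "\<eta> m \<le> 1 / 2" "0 < L m" "6 * L m \<le> a0" using True u1 by (auto simp: good_def)
    ultimately show ?thesis
      using atypical_event[of "\<eta> m" "L m" a0 "2 ^ m" J "J + 1" k "s m" "t m"] low unfolding bound_def D_def by blast
  qed auto
  then obtain bad where bad: "\<And>m. bad m \<in> events \<and> (good m \<longrightarrow> prob (bad m) \<le> bound m \<and>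
      (\<forall>\<omega>\<in>space M - bad m. typical (2 ^ m) J (J + 1) k (s m) (t m) (L m) (\<eta> m) \<omega>))"
    by metis
  define C1 where "C1 = 21 ^ d * D"
  \<comment> \<open>Here 12 = 2 * 6 comes from Potter's bound for F(6L) against F(L).\<close>
  define C3 where "C3 = 25 ^ d * 16 * real d * (12 powr \<kappa>) ^ (4 * d)"
  \<comment> \<open>From F(L / (2d)) >= F(L) / (2d), an instance of the scaling assumption, raised
    to the power 2d.\<close>
  define c4 where "c4 = (1 / (2 * real d)) ^ (2 * d)"
  define C4 where "C4 = 2 * (real k)\<^sup>2 / c4"
  \<comment> \<open>A rate common to all four terms: the bonds below \<open>s\<close> give X^-1,
    those below \<open>t\<close> give exponent 9d/8 - d >= 1/8, near ties give
    \<open>\<delta>\<close>/2, and missing slow sites give 2d \<open>\<tau>\<close>.\<close>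
  define r where "r = min (1 / 8) (min (\<delta> / 2) (2 * d * \<tau>))"
  have r0: "0 < r" using \<delta> \<tau> d1 by (simp add: r_def)
  have D0: "0 \<le> D" by (simp add: D_def)
  have c40: "0 < c4" using d1 by (simp add: c4_def)
  have pb: "prob (bad m) \<le> (C1 + C1 + C3 + C4) * (2 ^ m) powr (- r)" if gm: "good m" for m
  proof -
    note G = gm[unfolded good_def]
    have X0: "0 < X m" using X1[of m] by linarith
    have mono: "X m powr (- z) \<le> X m powr (- r)" if "r \<le> z" for z
      using X1[of m] that by (intro powr_mono) auto
    have cc: "real (card (cube (0 :: int ^ 'd) (10 * 2 ^ m))) \<le> (21 * X m) ^ d"
    proof -
      have "real (card (cube (0 :: int ^ 'd) (10 * 2 ^ m))) = (20 * X m + 1) ^ d"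
        by (simp add: card_cube d_def X_def algebra_simps)
      also have "\<dots> \<le> (21 * X m) ^ d" using X1[of m] by (intro power_mono) auto
      finally show ?thesis .
    qed
    have "card (cube (0 :: int ^ 'd) (10 * 2 ^ m)) * D * F (s m) ^ J \<le> 21 ^ d * D * X m powr (- 1)"
      by (rule prob_bound_bonds[OF X1 D0 cc]) (use G J\<theta> in auto)
    also have "\<dots> \<le> C1 * X m powr (- r)"
      unfolding C1_def using D0 by (intro mult_left_mono mono) (auto simp: r_def)
    finally have 1: "card (cube (0 :: int ^ 'd) (10 * 2 ^ m)) * D * F (s m) ^ J \<le> C1 * X m powr (- r)" .
    have "card (cube (0 :: int ^ 'd) (10 * 2 ^ m)) * D * F (t m) ^ (3 * d) \<le> 21 ^ d * D * X m powr (- (1 / 8))"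
      by (rule prob_bound_bonds[OF X1 D0 cc]) (use G d1 in auto)
    also have "\<dots> \<le> C1 * X m powr (- r)"
      unfolding C1_def using D0 by (intro mult_left_mono mono) (auto simp: r_def)
    finally have 2: "card (cube (0 :: int ^ 'd) (10 * 2 ^ m)) * D * F (t m) ^ (3 * d) \<le> C1 * X m powr (- r)" .
    have "F (6 * L m) \<le> (2 * (6 * L m / L m)) powr \<kappa> * F (L m)"
      using G u1 by (intro potter) auto
    then have F6: "F (6 * L m) \<le> 12 powr \<kappa> * X m powr (- 1 / 2 + \<tau>)" using G by simp
    have cb: "real (card (lattice_box (2 * 2 ^ m) :: (int ^ 'd) set)) \<le> (5 * X m) ^ d"
    proof -
      have "real (card (lattice_box (2 * 2 ^ m) :: (int ^ 'd) set)) = (4 * X m + 1) ^ d"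
        unfolding lattice_box_cube by (simp add: card_cube d_def X_def algebra_simps)
      also have "\<dots> \<le> (5 * X m) ^ d" using X1[of m] by (intro power_mono) auto
      finally show ?thesis .
    qed
    have "(real (card (lattice_box (2 * 2 ^ m) :: (int ^ 'd) set)))\<^sup>2 * (16 * real d * X m powr (- \<delta>) * F (6 * L m) ^ (4 * d))
        \<le> C3 * X m powr (- (\<delta> / 2))"
      unfolding C3_def
    proof (rule prob_bound_gaps[OF X1 _ cb F_nonneg F6])
      show "real (4 * d) * \<tau> \<le> \<delta> / 2" using \<tau>(3) d1 by (simp add: field_simps)
    qed simp
    also have "\<dots> \<le> C3 * X m powr (- r)"
      by (intro mult_left_mono mono) (auto simp: r_def C3_def)
    finally have 3: "(real (card (lattice_box (2 * 2 ^ m) :: (int ^ 'd) set)))\<^sup>2 * (16 * real d * \<eta> m * F (6 * L m) ^ (4 * d))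
        \<le> C3 * X m powr (- r)" by (simp add: \<eta>_def)
    have "k * (1 - F (L m / (2 * d)) ^ (2 * d)) ^ ((2 ^ m) ^ d div k) \<le> 2 * (real k)\<^sup>2 / c4 * X m powr (- (2 * d * \<tau>))"
    proof -
      have q1: "F (L m / (2 * d)) ^ (2 * d) \<le> 1" using F_nonneg F_le1 by (simp add: power_le_one)
      have "1 / (2 * real d) * F (L m) \<le> F (L m * (1 / (2 * real d)))"
        using G u1 d1 by (intro low) auto
      then have "(1 / (2 * real d) * F (L m)) ^ (2 * d) \<le> F (L m / (2 * d)) ^ (2 * d)"
        using F_nonneg by (intro power_mono) auto
      moreover have "(1 / (2 * real d) * F (L m)) ^ (2 * d) = c4 * X m powr (- real d + 2 * d * \<tau>)"
      proof -
        have "F (L m) ^ (2 * d) = X m powr (real (2 * d) * (- (1 / 2 - \<tau>)))"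
          using G X0 by (simp add: powr_power)
        also have "real (2 * d) * (- (1 / 2 - \<tau>)) = - real d + 2 * d * \<tau>" by (simp add: algebra_simps)
        finally show ?thesis by (simp only: power_mult_distrib c4_def)
      qed
      ultimately have q2: "c4 * X m powr (- real d + 2 * d * \<tau>) \<le> F (L m / (2 * d)) ^ (2 * d)" by simp
      have "real k * (1 - F (L m / (2 * d)) ^ (2 * d)) ^ ((2 ^ m) ^ d div k) \<le> real (2 * k\<^sup>2) / c4 * X m powr (- (2 * d * \<tau>))"
        by (rule prob_bound_traps[OF _ _ _ k d1 q1 q2 c40]) (use G in \<open>auto simp: X_def\<close>)
      then show ?thesis by simp
    qed
    also have "\<dots> \<le> C4 * X m powr (- r)"
      unfolding C4_def using c40 by (intro mult_left_mono mono) (auto simp: r_def)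
    finally have 4: "k * (1 - F (L m / (2 * d)) ^ (2 * d)) ^ ((2 ^ m) ^ d div k) \<le> C4 * X m powr (- r)" .
    have "prob (bad m) \<le> C1 * X m powr (- r) + C1 * X m powr (- r) + C3 * X m powr (- r) + C4 * X m powr (- r)"
      using bad[of m] gm 1 2 3 4 unfolding bound_def d_def[symmetric] by simp
    then show ?thesis by (simp add: distrib_right X_def)
  qed
  have "AE \<omega> in M. \<forall>\<^sub>F m in sequentially. \<omega> \<notin> bad m"
    by (rule borel_cantelli_geometric[where r = r and C = "C1 + C1 + C3 + C4"])
       (use bad r0 ev_good pb in \<open>auto elim: eventually_mono\<close>)
  then have AEty: "AE \<omega> in M. \<forall>\<^sub>F m in sequentially. typical (2 ^ m) J (J + 1) k (s m) (t m) (L m) (\<eta> m) \<omega>"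
    using AE_space
  proof eventually_elim
    case (elim \<omega>)
    show ?case using elim(1) ev_good
      by eventually_elim (use bad elim(2) in blast)
  qed
  show ?thesis
  proof (rule that[of J s t L])
    show "AE \<omega> in M. \<forall>\<^sub>F m in sequentially. typical (2 ^ m) J (J + 1) k (s m) (t m) (L m) ((2 ^ m) powr (- (\<epsilon>\<^sub>1 / 25))) \<omega>"
      using AEty unfolding \<eta>_def X_def \<delta>_def .
    show "\<forall>\<^sub>F m in sequentially. 0 < t m \<and> t m \<le> s m \<and> 0 < L m \<and> 6 * L m < t m \<and>
       L m / s m \<le> 2 * (2 ^ m) powr (- (2 + \<epsilon>\<^sub>1)) \<and> L m / t m \<le> 2 * (2 ^ m) powr (- (1 / 3)) \<and>
       (2 ^ m) powr (- (\<epsilon>\<^sub>1 / 25)) \<le> (1 / 2 :: real)"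
      using ev_good
    proof eventually_elim
      case (elim m)
      have "L m / t m < 1 / 6" using rat(2)[OF elim] elim unfolding good_def by linarith
      then have "6 * L m < t m" using elim unfolding good_def by (simp add: field_simps)
      then show ?case using rat[OF elim] ord[OF elim] elim unfolding good_def X_def \<eta>_def \<delta>_def by simp
    qed
  qed (fact J1)
qed

end

theorem mainTheorem1:
  fixes M :: "'a measure"
    and w :: "(int ^ 'd) set \<Rightarrow> 'a \<Rightarrow> real"
    and F :: "real \<Rightarrow> real"
    and \<gamma> \<epsilon>\<^sub>1 :: real
    and lam :: "nat \<Rightarrow> 'a \<Rightarrow> nat \<Rightarrow> real"
    and psi :: "nat \<Rightarrow> 'a \<Rightarrow> nat \<Rightarrow> int ^ 'd \<Rightarrow> real"
    and k :: nat
  assumes dim: "CARD('d) \<ge> 2"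
    and prob: "prob_space M"
    and indep: "prob_space.indep_vars M (\<lambda>_. borel) w lattice_edges"
    and ident: "\<And>e. e \<in> lattice_edges \<Longrightarrow> cdf (distr M borel (w e)) = F"
    and positive: "\<And>e. e \<in> lattice_edges \<Longrightarrow> AE \<omega> in M. 0 < w e \<omega>"
    and F_cont: "continuous_on UNIV F"
    and gamma: "0 \<le> \<gamma>" "\<gamma> < 1 / 4"
    and F_regvar: "regularly_varying_at_zero F \<gamma>"
    and F_lower: "\<exists>a_star>0. \<forall>a\<le>a_star. \<forall>b. 0 \<le> b \<and> b \<le> 1 \<longrightarrow> F (a * b) \<ge> b * F a"
    and eps1: "0 < \<epsilon>\<^sub>1" "\<epsilon>\<^sub>1 < 1"
    and eps1_zero: "\<gamma> = 0 \<Longrightarrow>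
      monotonically_to_zero (\<lambda>n. real n powr (2 + \<epsilon>\<^sub>1) * quantile_scale F (real n))"
    and eps1_pos: "\<gamma> > 0 \<Longrightarrow> - 1 / (2 * \<gamma>) < - (2 + \<epsilon>\<^sub>1)"
    and eigen: "\<And>n \<omega>. \<omega> \<in> space M \<Longrightarrow>
      dirichlet_eigensystem (\<lambda>e. w e \<omega>) n (lam n \<omega>) (psi n \<omega>)"
    and k: "k \<ge> 1"
  shows "(AE \<omega> in M. (\<lambda>n. lam n \<omega> k / speed_order_stat (\<lambda>e. w e \<omega>) n k) \<longlonglongrightarrow> 1) \<and>
    (\<forall>\<epsilon>. 0 < \<epsilon> \<and> \<epsilon> < \<epsilon>\<^sub>1 \<longrightarrow>
      (AE \<omega> in M. \<forall>\<^sub>F n in sequentially.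
        1 - real n powr (- \<epsilon> / 8) \<le> lam n \<omega> k / speed_order_stat (\<lambda>e. w e \<omega>) n k \<and>
        lam n \<omega> k / speed_order_stat (\<lambda>e. w e \<omega>) n k \<le> 1 \<and>
        psi n \<omega> k (speed_site (\<lambda>e. w e \<omega>) n k) \<ge> sqrt (1 - real n powr (- \<epsilon> / 4))))"
proof -
  interpret iid_conductances M w F
    using prob indep ident positive by (intro iid_conductances.intro iid_conductances_axioms.intro) auto
  obtain p q :: 'd where pq: "p \<noteq> q"
  proof -
    have "\<not> card (UNIV :: 'd set) \<le> Suc 0" using dim by simp
    then show ?thesis using that by (auto simp: card_le_Suc0_iff_eq)
  qed
  have g: "\<gamma> * (2 + \<epsilon>\<^sub>1) < 1 / 2"
  proof (cases "\<gamma> = 0")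
    case False
    then have "0 < \<gamma>" using gamma by simp
    then show ?thesis using eps1_pos by (simp add: field_simps)
  qed simp
  obtain J s t L where J: "1 \<le> J"
    and ty: "AE \<omega> in M. \<forall>\<^sub>F m in sequentially. typical (2 ^ m) J (J + 1) k (s m) (t m) (L m) ((2 ^ m) powr (- (\<epsilon>\<^sub>1 / 25))) \<omega>"
    and par: "\<forall>\<^sub>F m in sequentially. 0 < t m \<and> t m \<le> s m \<and> 0 < L m \<and> 6 * L m < t m \<and>
       L m / s m \<le> 2 * (2 ^ m) powr (- (2 + \<epsilon>\<^sub>1)) \<and> L m / t m \<le> 2 * (2 ^ m) powr (- (1 / 3)) \<and>
       (2 ^ m) powr (- (\<epsilon>\<^sub>1 / 25)) \<le> (1 / 2 :: real)"
    by (rule dyadic_typical[OF F_cont gamma(1) g F_regvar F_lower eps1 k])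
  define C where "C = (CARD('d) + 1) * 50 * (2 * real (J + 1) * CARD('d))\<^sup>2 * (2 * (J + 1) + 1) ^ CARD('d) * 34 * (1 + real (2 * CARD('d)))"
  have C0: "0 < C" unfolding C_def by (intro mult_pos_pos) auto
  define localized where "localized \<epsilon> \<omega> n \<longleftrightarrow>
      1 - real n powr (- \<epsilon> / 8) \<le> lam n \<omega> k / speed_order_stat (\<lambda>e. w e \<omega>) n k \<and>
      lam n \<omega> k / speed_order_stat (\<lambda>e. w e \<omega>) n k \<le> 1 \<and>
      sqrt (1 - real n powr (- \<epsilon> / 4)) \<le> psi n \<omega> k (speed_site (\<lambda>e. w e \<omega>) n k)" for \<epsilon> \<omega> n
  have main: "AE \<omega> in M. \<forall>\<^sub>F n in sequentially. localized \<epsilon> \<omega> n"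
    if \<epsilon>: "0 < \<epsilon>" "\<epsilon> < \<epsilon>\<^sub>1" for \<epsilon>
    using ty AE_all_bonds_pos AE_space
  proof eventually_elim
    case (elim \<omega>)
    have "\<forall>\<^sub>F m in sequentially. ((2 :: real) ^ m) powr (- (19 * \<epsilon>\<^sub>1 / 75)) < 1 / (2 * C)"
      "\<forall>\<^sub>F m in sequentially. ((2 :: real) ^ m) powr (- (\<epsilon>\<^sub>1 / 300)) < 2 powr (- (\<epsilon>\<^sub>1 / 4)) / C"
      by (rule eventually_dyadic_powr_less; use eps1 C0 in simp)+
    with elim(1) par have "\<forall>\<^sub>F m in sequentially. \<forall>n. 2 ^ m \<le> n \<and> n < 2 * 2 ^ m \<longrightarrow> localized \<epsilon> \<omega> n"
    proof eventually_elim
      case (elim m)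
      note E = elim
      define X where "X = (2 :: real) ^ m"
      have X1: "1 \<le> X" by (simp add: X_def)
      \<comment> \<open>Since 19/75 = 1/4 + 1/300, the spare power
        X^(-\<open>\<epsilon>\<^sub>1\<close>/300) absorbs both \<open>C\<close> and the factor
        2^(\<open>\<epsilon>\<^sub>1\<close>/4) lost in passing from X to n <= 2X.\<close>
      define \<nu> where "\<nu> = C * X powr (- (19 * \<epsilon>\<^sub>1 / 75))"
      have \<nu>half: "\<nu> < 1 / 2" using E(3) C0 unfolding \<nu>_def X_def by (simp add: field_simps)
      show ?case
      proof (intro allI impI)
        fix n :: nat assume n: "2 ^ m \<le> n \<and> n < 2 * 2 ^ m"
        have loc: "1 - sqrt \<nu> \<le> lam n \<omega> k / speed_order_stat (\<lambda>e. w e \<omega>) n k \<and>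
          lam n \<omega> k / speed_order_stat (\<lambda>e. w e \<omega>) n k \<le> 1 \<and>
          sqrt (1 - \<nu>) \<le> psi n \<omega> k (speed_site (\<lambda>e. w e \<omega>) n k)"
          by (rule typical_localization[OF E(1) refl _ eigen, where X = X and \<epsilon> = "\<epsilon>\<^sub>1" and p = p and q = q])
             (use \<open>\<forall>u k. 0 < w (bond u k) \<omega>\<close> \<open>\<omega> \<in> space M\<close> n J k pq E(2) eps1 \<nu>half in \<open>auto simp: X_def \<nu>_def C_def\<close>)
        have nX: "real n \<le> 2 * X" "1 \<le> real n"
        proof -
          have "real n \<le> real (2 * 2 ^ m)" using n by (simp only: of_nat_le_iff less_imp_le)
          then show "real n \<le> 2 * X" by (simp add: X_def)
          have "1 \<le> n" using n by (metis less_le_trans one_le_numeral one_le_power order_trans)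
          then show "1 \<le> real n" by simp
        qed
        have "\<nu> = (C * X powr (- (\<epsilon>\<^sub>1 / 300))) * X powr (- (\<epsilon>\<^sub>1 / 4))"
          unfolding \<nu>_def mult.assoc powr_add[symmetric] by simp
        also have "\<dots> \<le> 2 powr (- (\<epsilon>\<^sub>1 / 4)) * X powr (- (\<epsilon>\<^sub>1 / 4))"
          using E(4) C0 unfolding X_def by (intro mult_right_mono) (auto simp: field_simps)
        also have "\<dots> = (2 * X) powr (- (\<epsilon>\<^sub>1 / 4))" using X1 by (simp add: powr_mult)
        also have "\<dots> \<le> real n powr (- (\<epsilon>\<^sub>1 / 4))" using nX eps1 by (intro powr_mono2') auto
        also have "\<dots> \<le> real n powr (- \<epsilon> / 4)" using nX \<epsilon> by (intro powr_mono) auto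
        finally have \<nu>: "\<nu> \<le> real n powr (- \<epsilon> / 4)" .
        have "sqrt \<nu> \<le> sqrt (real n powr (- \<epsilon> / 4))" using \<nu> by (rule real_sqrt_le_mono)
        also have "\<dots> = real n powr (- \<epsilon> / 8)"
          using nX by (simp add: powr_half_sqrt[symmetric] powr_powr)
        finally have "1 - real n powr (- \<epsilon> / 8) \<le> 1 - sqrt \<nu>" by simp
        moreover have "sqrt (1 - real n powr (- \<epsilon> / 4)) \<le> sqrt (1 - \<nu>)" using \<nu> by simp
        ultimately show "localized \<epsilon> \<omega> n" unfolding localized_def using loc by linarith
      qed
    qed
    then obtain m0 where m0: "\<And>m n. m0 \<le> m \<Longrightarrow> 2 ^ m \<le> n \<Longrightarrow> n < 2 * 2 ^ m \<Longrightarrow> localized \<epsilon> \<omega> n"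
      unfolding eventually_sequentially by blast
    show ?case
    proof (rule eventually_sequentiallyI)
      fix n :: nat assume n: "2 ^ m0 \<le> n"
      then have "1 \<le> n" by (metis one_le_numeral one_le_power order_trans)
      then obtain m where m: "2 ^ m \<le> n" "n < 2 ^ (m + 1)" using ex_power_ivl1[of 2 n] by auto
      have "(2 :: nat) ^ m0 < 2 ^ (m + 1)" using n m by linarith
      then have "m0 < m + 1" by (rule power_less_imp_less_exp[rotated]) simp
      then have "m0 \<le> m" by simp
      then show "localized \<epsilon> \<omega> n" using m by (intro m0) auto
    qed
  qed
  have "AE \<omega> in M. \<forall>\<^sub>F n in sequentially. localized (\<epsilon>\<^sub>1 / 2) \<omega> n" using eps1 by (intro main) auto
  then have "AE \<omega> in M. (\<lambda>n. lam n \<omega> k / speed_order_stat (\<lambda>e. w e \<omega>) n k) \<longlonglongrightarrow> 1"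
  proof eventually_elim
    case ev: (elim \<omega>)
    have "(\<lambda>n. real n powr (- (\<epsilon>\<^sub>1 / 2) / 8)) \<longlonglongrightarrow> 0"
      by (rule tendsto_neg_powr) (use eps1 in \<open>auto simp: filterlim_real_sequentially\<close>)
    then have lim: "(\<lambda>n. 1 - real n powr (- (\<epsilon>\<^sub>1 / 2) / 8)) \<longlonglongrightarrow> 1"
      using tendsto_diff[OF tendsto_const, of _ 0 sequentially 1] by simp
    show ?case
      by (rule tendsto_sandwich[OF _ _ lim tendsto_const]; rule eventually_mono[OF ev]) (simp_all add: localized_def)
  qed
  then show ?thesis using main unfolding localized_def by blast
qed

end
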